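(* Suppose that $\mathbf E N<\infty$. Let $\alpha>1$ be the exponent in condition (A) of the context (recall that (A$'$) is the special case of (A) in which the slowly varying factor converges to a positive constant). Consider the relation, as $t\to+\infty$ through the integers, $$\mathbf P(S_N=t)\sim(\mathbf E N)\,\mathbf P(X_1=t).\qquad(\ast)$$ (i) Let $1<\alpha<2$. Then (A$'$) implies $(\ast)$. (ii) Let $\alpha=2$. Assume that $\mathbf E(N\ln^{2+\tau}N)<\infty$ for some $\tau>0$. Then (A$'$) implies $(\ast)$. (iii) Let $2<\alpha<3$. If $\mu\le0$, then (A$'$) and (B) imply $(\ast)$. If $\mu>0$, then (A$'$), (B) and (D) imply $(\ast)$. (iv) Let $\alpha=3$. Assume (A$'$) and (B). If $\mu>0$, assume in addition that $\mathbf P(N=t)=o\bigl(t^{-3}(\ln\ln t)^{-1}\bigr)$ as $t\to+\infty$; if $\mu=0$, assume in addition that $\mathbf E(N\ln^{1+\tau}N)<\infty$ for some $\tau>0$. (No additional assumption is made if $\mu<0$.) Then $(\ast)$ holds. (v) Let $\alpha>3$. Assume (A) and (C). If $\mu=0$, assume in addition that (E$_\tau$) holds for some $\tau>0$; if $\mu>0$, assume in addition that (D) holds. (No additional assumption is made if $\mu<0$.) Then $(\ast)$ holds. Moreover, for $\mu=0$, conditions (A$'$), (C) and (E$_\tau$) with $\tau=0$ imply $(\ast)$.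
   Context: $X_1,X_2,\dots$ are i.i.d. integer valued random variables (not necessarily non-negative); $N$ is a non-negative integer valued random variable independent of $\{X_i\}$; $S_N=X_1+\dots+X_N$ (with $S_0=0$). When $X_1$ has a finite first moment, $\mu=\mathbf E X_1$. $f(t)\sim g(t)$ means $f(t)/g(t)\to1$ as $t\to+\infty$. All asymptotics are as $t\to+\infty$. Conditions: (A) $\mathbf P(X_1=t)=t^{-\alpha}L_1(t)$ for $t=1,2,\dots$, where $L_1$ is slowly varying at infinity. (A$'$) $\mathbf P(X_1=t)\sim a t^{-\alpha}$ for some constant $a>0$. (B) $\mathbf P(X_1<-t)=O\bigl(\mathbf P(X_1>t)\bigr)$. (C) $\mathbf E\bigl(X_1^2\,\mathbb I_{\{X_1<-t\}}\bigr)=o(1/\log t)$. (D) $\mathbf P(N=t)=o\bigl(\mathbf P(X_1=t)\bigr)$. (E$_\tau$) $\mathbf P\bigl(N>t^2\ln^{-\tau}t\bigr)=o\bigl(t\,\mathbf P(X_1=t)\bigr)$. *)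

theory Defs
  imports "HOL-Probability.Probability" "HOL-Library.Landau_Symbols"
begin

unbundle asymp_equiv_syntax

text \<open>
  The summands are \<open>X 1, X 2, \<dots>\<close>; the value \<open>X 0\<close> is not used. The last assumption says that the
  counting variable is independent of the whole family of summands, not merely of each summand; it is stated through the generated \<open>\<sigma>\<close>-algebras because
  \<open>indep_var\<close> needs both variables to have the same type.
\<close>

locale random_sum = prob_space M for M :: "'a measure" +
  fixes X :: "nat \<Rightarrow> 'a \<Rightarrow> int" and N :: "'a \<Rightarrow> nat"
  assumes indep_X: "indep_vars (\<lambda>_. count_space UNIV) X {1..}"
    and ident_X: "\<And>i. i \<ge> 1 \<Longrightarrow>
      distr M (count_space UNIV) (X i) = distr M (count_space UNIV) (X 1)"
    and measurable_N: "N \<in> measurable M (count_space UNIV)"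
    and indep_N_X: "indep_set
      (sets (vimage_algebra (space M) N (count_space UNIV)))
      (sets (vimage_algebra (space M) (\<lambda>\<omega>. \<lambda>i\<in>{1..}. X i \<omega>)
        (\<Pi>\<^sub>M i\<in>{1..}. count_space UNIV)))"

definition random_sum_value :: "(nat \<Rightarrow> 'a \<Rightarrow> int) \<Rightarrow> ('a \<Rightarrow> nat) \<Rightarrow> 'a \<Rightarrow> int" where
  "random_sum_value X N \<omega> = (\<Sum>i=1..N \<omega>. X i \<omega>)"

text \<open>Positivity is only required near infinity, so that finitely many atoms may vanish below.\<close>

definition slowly_varying :: "(real \<Rightarrow> real) \<Rightarrow> bool" where
  "slowly_varying L \<longleftrightarrow>
     L \<in> borel_measurable borel \<and>
     (\<forall>\<^sub>F x in at_top. L x > 0) \<and>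
     (\<forall>c>0. ((\<lambda>x. L (c * x) / L x) \<longlongrightarrow> 1) at_top)"

definition cond_A :: "'a measure \<Rightarrow> ('a \<Rightarrow> int) \<Rightarrow> real \<Rightarrow> bool" where
  "cond_A M Y \<alpha> \<longleftrightarrow>
     (\<exists>L. slowly_varying L \<and>
       (\<forall>t::nat. t \<ge> 1 \<longrightarrow> \<P>(\<omega> in M. Y \<omega> = int t) = real t powr (-\<alpha>) * L (real t)))"

definition cond_A' :: "'a measure \<Rightarrow> ('a \<Rightarrow> int) \<Rightarrow> real \<Rightarrow> bool" where
  "cond_A' M Y \<alpha> \<longleftrightarrow>
     (\<exists>a>0. (\<lambda>t::nat. \<P>(\<omega> in M. Y \<omega> = int t)) \<sim>[at_top] (\<lambda>t. a * real t powr (-\<alpha>)))"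

text \<open>
  For an integer-valued variable both tails below are step functions constant on \<open>[n, n+1)\<close>, so
  letting \<open>t\<close> tend to infinity through the naturals is the same as through the reals.
\<close>

definition cond_B :: "'a measure \<Rightarrow> ('a \<Rightarrow> int) \<Rightarrow> bool" where
  "cond_B M Y \<longleftrightarrow>
     (\<lambda>t::nat. \<P>(\<omega> in M. Y \<omega> < - int t)) \<in> O(\<lambda>t. \<P>(\<omega> in M. Y \<omega> > int t))"

text \<open>
  Integrability is stated explicitly because the Bochner integral of a non-integrable function
  is 0, which would make the asymptotic condition vacuous for an infinite truncated moment.
\<close>

definition cond_C :: "'a measure \<Rightarrow> ('a \<Rightarrow> int) \<Rightarrow> bool" where
  "cond_C M Y \<longleftrightarrow>
     (\<forall>t::nat. integrable M (\<lambda>\<omega>. (real_of_int (Y \<omega>))\<^sup>2 * indicator {\<omega>. Y \<omega> < - int t} \<omega>)) \<and>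
     (\<lambda>t::nat. \<integral>\<omega>. (real_of_int (Y \<omega>))\<^sup>2 * indicator {\<omega>. Y \<omega> < - int t} \<omega> \<partial>M)
       \<in> o(\<lambda>t. 1 / ln (real t))"

definition cond_D :: "'a measure \<Rightarrow> ('a \<Rightarrow> int) \<Rightarrow> ('a \<Rightarrow> nat) \<Rightarrow> bool" where
  "cond_D M Y N \<longleftrightarrow>
     (\<lambda>t::nat. \<P>(\<omega> in M. N \<omega> = t)) \<in> o(\<lambda>t. \<P>(\<omega> in M. Y \<omega> = int t))"

definition cond_E :: "'a measure \<Rightarrow> ('a \<Rightarrow> int) \<Rightarrow> ('a \<Rightarrow> nat) \<Rightarrow> real \<Rightarrow> bool" where
  "cond_E M Y N \<tau> \<longleftrightarrow>
     (\<lambda>t::nat. \<P>(\<omega> in M. real (N \<omega>) > (real t)\<^sup>2 * ln (real t) powr (-\<tau>)))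
       \<in> o(\<lambda>t. real t * \<P>(\<omega> in M. Y \<omega> = int t))"

text \<open>
  If \<open>N = 0\<close> almost surely, both sides vanish; \<open>asymp_equiv\<close> then counts the quotient \<open>0/0\<close> as 1.
\<close>

definition random_sum_asymp :: "'a measure \<Rightarrow> (nat \<Rightarrow> 'a \<Rightarrow> int) \<Rightarrow> ('a \<Rightarrow> nat) \<Rightarrow> bool" where
  "random_sum_asymp M X N \<longleftrightarrow>
     (\<lambda>t::nat. \<P>(\<omega> in M. random_sum_value X N \<omega> = int t)) \<sim>[at_top]
     (\<lambda>t. (\<integral>\<omega>. real (N \<omega>) \<partial>M) * \<P>(\<omega> in M. X 1 \<omega> = int t))"

end

theory Submission
  imports Defs "HOL-Real_Asymp.Real_Asymp"
begin

text \<open>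
  Write \<open>S\<^sub>n\<close> for the walk with step law \<open>p\<close> and \<open>\<mu>\<close> for its drift. If \<open>S\<^sub>n = t\<close>, then either some step
  exceeds a fixed fraction of \<open>u = t - n \<mu>\<close>, which has probability at most \<open>n\<close> times the largest atom
  of \<open>p\<close> there, or all steps are smaller. In the second case one half of the path contributes at
  least \<open>u/2\<close>: a Chernoff bound with truncation at \<open>y = u/(2 K)\<close> gives the factor \<open>(n q(y))\<^sup>K\<close> for that half, and
  the other half contributes a concentration bound, which comes from Fourier inversion. With \<open>K\<close>
  large this yields \<open>P(S\<^sub>n = t) \<le> C n P(X\<^sub>1 = t) + R(n, t)\<close>, and dominated convergence reduces the claim
  to \<open>E R(N, t) = o(P(X\<^sub>1 = t))\<close>.

  For \<open>\<mu> < 0\<close>, and for \<open>\<alpha> \<in> (1, 2)\<close> or \<open>\<alpha> \<in> (2, 3)\<close> with \<open>\<mu> = 0\<close>, one may take \<open>R = 0\<close>. For \<open>\<mu> > 0\<close> the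
  remaining range is \<open>n \<ge> t/(2 \<mu>)\<close>, where \<open>P(N = n) = o(P(X\<^sub>1 = t))\<close> and the Green function
  \<open>\<Sum>\<^sub>n P(S\<^sub>n = t)\<close> is bounded. In the boundary cases \<open>\<alpha> = 2\<close> and \<open>\<alpha> = 3\<close>, \<open>\<mu> = 0\<close> the moment
  condition on \<open>N\<close> pays for the logarithms, and for \<open>\<alpha> > 3\<close>, \<open>\<mu> = 0\<close> the remainder
  \<open>min(1, (n/t\<^sup>2)\<^sup>K)/t\<close> is summed by parts against the tail of \<open>N\<close>.
\<close>

section \<open>One big jump and truncated Chernoff bounds\<close>

text \<open>The obstacle is that a point probability is wanted, while a Chernoff bound controls
  tails and carries no local factor. When no drift helps, the critical sizes of \<open>n\<close> are
  of order \<open>t powr (\<alpha> - 1)\<close> for \<open>\<alpha> < 3\<close> and of order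
  \<open>t^2\<close> beyond; there the Chernoff factor is of order one and only concentration makes
  the bound small. Cutting the path keeps both factors, since the half that is not asked to be large
  still has to hit one prescribed value.

  Steps are truncated only from above, so the left tail enters solely through \<open>q(y)\<close>: a
  truncated mean when the step is not centred, a truncated second moment when it is. This is where
  (B) and (C) are spent. Aperiodicity comes from (A), which makes two neighbouring atoms positive.
  Large steps are compared with \<open>P(X_1 = t)\<close> atom by atom, by Potter bounds; both (A)
  and (A') are reduced to these bounds and to ratios of neighbouring atoms that tend to one.\<close>

definition walk :: "int pmf \<Rightarrow> nat \<Rightarrow> int pmf" where
  "walk p n = map_pmf sum_list (replicate_pmf n p)"

lemma walk_0: "walk p 0 = return_pmf 0"
  by (simp add: walk_def)

lemma walk_add:
  "walk p (m + n) = bind_pmf (walk p m) (\<lambda>j. map_pmf (\<lambda>k. j + k) (walk p n))"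
  unfolding walk_def replicate_pmf_distrib
  by (simp add: map_pmf_def bind_assoc_pmf bind_return_pmf)

lemma walk_1: "walk p 1 = p"
  by (simp add: walk_def map_pmf_def bind_assoc_pmf bind_return_pmf bind_return_pmf')

lemma pmf_map_plus: "pmf (map_pmf (\<lambda>k. j + k) q) (t::int) = pmf q (t - j)"
  using pmf_map_inj'[of "\<lambda>k. j + k" q "t - j"] by (simp add: inj_on_def)

lemma pmf_walk_add:
  "pmf (walk p (m + n)) t = measure_pmf.expectation (walk p m) (\<lambda>j. pmf (walk p n) (t - j))"
  by (simp add: walk_add pmf_bind pmf_map_plus)

lemma pmf_walk_Suc:
  "pmf (walk p (Suc n)) t = measure_pmf.expectation p (\<lambda>k. pmf (walk p n) (t - k))"
  using pmf_walk_add[of p 1 n t] unfolding walk_1 by simp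

lemma integrable_pmf_bounded:
  fixes g :: "'b \<Rightarrow> real"
  assumes "\<And>x. \<bar>g x\<bar> \<le> B"
  shows "integrable (measure_pmf p) g"
  by (rule measure_pmf.integrable_const_bound[where B = B]) (use assms in auto)

lemma expectation_le_const:
  fixes g :: "'b \<Rightarrow> real"
  assumes "\<And>x. 0 \<le> g x" "\<And>x. g x \<le> c"
  shows "measure_pmf.expectation p g \<le> c"
proof -
  have "measure_pmf.expectation p g \<le> measure_pmf.expectation p (\<lambda>_. c)"
    using assms order_trans[OF assms(1) assms(2)]
    by (intro integral_mono integrable_pmf_bounded[where B = c]) auto
  then show ?thesis by simp
qed

lemma walk_bound_Suc:
  assumes "\<And>t. pmf (walk p n) t \<le> c"
  shows "pmf (walk p (Suc n)) t \<le> c"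
  unfolding pmf_walk_Suc by (rule expectation_le_const) (use assms in auto)

text \<open>Every further step averages the point masses, so the largest atom cannot grow. A
  concentration bound at \<open>n div 2\<close> therefore serves both halves of a path and the path
  itself.\<close>

lemma walk_bound_mono:
  assumes "m \<le> n" "\<And>t. pmf (walk p m) t \<le> c"
  shows "pmf (walk p n) t \<le> c"
  using assms(1) 
proof (induction n arbitrary: t rule: dec_induct)
  case base then show ?case by (rule assms(2))
next
  case (step n) then show ?case by (intro walk_bound_Suc) auto
qed

lemma emeasure_replicate_Suc:
  "emeasure (replicate_pmf (Suc n) p) A = (\<integral>\<^sup>+x. emeasure (replicate_pmf n p) {xs. x # xs \<in> A} \<partial>p)"
proof -
  have "replicate_pmf (Suc n) p = bind_pmf p (\<lambda>x. map_pmf ((#) x) (replicate_pmf n p))"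
    by (simp add: map_pmf_def)
  then show ?thesis by (simp only: emeasure_bind_pmf emeasure_map_pmf vimage_def)
qed

lemma emeasure_walk: "emeasure (replicate_pmf n p) {xs. sum_list xs = t} = ennreal (pmf (walk p n) t)"
  by (simp add: walk_def emeasure_pmf_single[symmetric] vimage_def)

text \<open>A union bound over the position of the step in \<open>B\<close>. Once the other steps
  are fixed, that step is forced to a single value, which costs at most \<open>M\<close>; hence the
  bound is local, with an atom in place of the probability of \<open>B\<close>.\<close>

lemma replicate_big_jump:
  fixes p :: "int pmf"
  assumes "\<And>k. k \<in> B \<Longrightarrow> pmf p k \<le> M" "M \<ge> 0"
  shows "emeasure (replicate_pmf n p) {xs. sum_list xs = t \<and> (\<exists>x\<in>set xs. x \<in> B)} \<le> ennreal (real n * M)"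
proof (induction n arbitrary: t)
  case 0
  then show ?case by simp
next
  case (Suc n)
  let ?R = "replicate_pmf n p"
  let ?E = "\<lambda>t. {xs. sum_list xs = t \<and> (\<exists>x\<in>set xs. x \<in> B)}"
  have "emeasure (replicate_pmf (Suc n) p) (?E t) =
      (\<integral>\<^sup>+x. emeasure ?R {xs. x # xs \<in> ?E t} \<partial>p)"
    by (rule emeasure_replicate_Suc)
  also have "\<dots> \<le> (\<integral>\<^sup>+x. indicator B x * ennreal (pmf (walk p n) (t - x)) + ennreal (real n * M) \<partial>p)"
  proof (rule nn_integral_mono)
    fix x
    show "emeasure ?R {xs. x # xs \<in> ?E t}
      \<le> indicator B x * ennreal (pmf (walk p n) (t - x)) + ennreal (real n * M)"
    proof (cases "x \<in> B")
      case True
      have "emeasure ?R {xs. x # xs \<in> ?E t} \<le> emeasure ?R {xs. sum_list xs = t - x}"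
        by (intro emeasure_mono) auto
      also have "\<dots> = ennreal (pmf (walk p n) (t - x))" by (rule emeasure_walk)
      finally show ?thesis using True by (auto intro: order_trans)
    next
      case False
      have "emeasure ?R {xs. x # xs \<in> ?E t} \<le> emeasure ?R (?E (t - x))"
        by (intro emeasure_mono) (use False in auto)
      also have "\<dots> \<le> ennreal (real n * M)" by (rule Suc.IH)
      finally show ?thesis using False by (auto intro: order_trans)
    qed
  qed
  also have "\<dots> = (\<integral>\<^sup>+x. indicator B x * ennreal (pmf (walk p n) (t - x)) \<partial>p) + ennreal (real n * M)"
    by (subst nn_integral_add) auto
  also have "(\<integral>\<^sup>+x. indicator B x * ennreal (pmf (walk p n) (t - x)) \<partial>p)
     = (\<integral>\<^sup>+x. ennreal (pmf p x) * (indicator B x * ennreal (pmf (walk p n) (t - x))) \<partial>count_space UNIV)"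
    by (rule nn_integral_measure_pmf)
  \<comment> \<open>The atom of the large step is replaced by \<open>M\<close>; what remains is a
    sum of atoms of \<open>walk p n\<close> over distinct points, at most one.\<close>
  also have "\<dots> \<le> (\<integral>\<^sup>+x. ennreal M * ennreal (pmf (walk p n) (t - x)) \<partial>count_space UNIV)"
  proof (intro nn_integral_mono)
    fix x
    show "ennreal (pmf p x) * (indicator B x * ennreal (pmf (walk p n) (t - x)))
       \<le> ennreal M * ennreal (pmf (walk p n) (t - x))"
      using assms by (cases "x \<in> B") (auto intro!: mult_right_mono ennreal_leI)
  qed
  also have "\<dots> = ennreal M * (\<integral>\<^sup>+x. ennreal (pmf (walk p n) (t - x)) \<partial>count_space UNIV)"
    by (rule nn_integral_cmult) auto
  also have "(\<integral>\<^sup>+x. ennreal (pmf (walk p n) (t - x)) \<partial>count_space UNIV) = emeasure (walk p n) (range (\<lambda>x. t - x))"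
    by (rule nn_integral_pmf') (auto simp: inj_on_def)
  also have "\<dots> \<le> 1" by (rule measure_pmf.emeasure_le_1)
  finally have "emeasure (replicate_pmf (Suc n) p) (?E t) \<le> ennreal M * 1 + ennreal (real n * M)"
    by (auto simp: mult_left_mono add_right_mono)
  also have "\<dots> = ennreal (real (Suc n) * M)"
    using assms(2) by (simp flip: ennreal_plus add: algebra_simps)
  finally show ?case .
qed

text \<open>The truncation is from above only, and \<open>l\<close> stays free. The shape
  \<open>1 + exp (l * y) * q\<close> is made for the choice
  \<open>exp (l * y) = 1 / (n * q)\<close>, which keeps the \<open>n\<close>-th power below
  \<open>e\<close>. In applications \<open>q\<close> is a truncated mean or a truncated second
  moment at scale \<open>y\<close>.\<close>

definition mgf_bound :: "'b pmf \<Rightarrow> ('b \<Rightarrow> real) \<Rightarrow> real \<Rightarrow> real \<Rightarrow> bool" where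
  "mgf_bound p f y q \<longleftrightarrow>
     (\<forall>l\<ge>0. (\<integral>\<^sup>+x. ennreal (exp (l * f x)) * indicator {x. f x \<le> y} x \<partial>p) \<le> ennreal (1 + exp (l * y) * q))"

lemma mgf_bound_mono: "mgf_bound p f y q \<Longrightarrow> q \<le> q' \<Longrightarrow> mgf_bound p f y q'"
  unfolding mgf_bound_def by (meson add_left_mono ennreal_leI exp_ge_zero mult_left_mono order_trans)

lemma nn_integral_replicate_truncated_exp:
  "(\<integral>\<^sup>+xs. ennreal (exp (l * (\<Sum>x\<leftarrow>xs. f x))) * indicator {xs. \<forall>x\<in>set xs. f x \<le> y} xs \<partial>replicate_pmf n p)
   = (\<integral>\<^sup>+x. ennreal (exp (l * f x)) * indicator {x. f x \<le> y} x \<partial>p) ^ n"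
proof (induction n)
  case 0
  then show ?case by simp
next
  case (Suc n)
  let ?g = "\<lambda>x. ennreal (exp (l * f x)) * indicator {x. f x \<le> y} x"
  let ?G = "\<lambda>xs. ennreal (exp (l * (\<Sum>x\<leftarrow>xs. f x))) * indicator {xs. \<forall>x\<in>set xs. f x \<le> y} xs"
  have G: "?G (x # xs) = ?g x * ?G xs" for x xs
    by (auto simp: indicator_def distrib_left exp_add ennreal_mult)
  have "(\<integral>\<^sup>+xs. ?G xs \<partial>replicate_pmf (Suc n) p) = (\<integral>\<^sup>+x. (\<integral>\<^sup>+xs. ?G (x # xs) \<partial>replicate_pmf n p) \<partial>p)"
    by (simp add: nn_integral_return del: sum_list.Cons)
  also have "\<dots> = (\<integral>\<^sup>+x. ?g x * (\<integral>\<^sup>+xs. ?G xs \<partial>replicate_pmf n p) \<partial>p)"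
    unfolding G by (subst nn_integral_cmult) auto
  also have "\<dots> = (\<integral>\<^sup>+x. ?g x \<partial>p) * (\<integral>\<^sup>+xs. ?G xs \<partial>replicate_pmf n p)"
    by (rule nn_integral_multc) auto
  finally show ?case using Suc.IH by simp
qed

text \<open>Markov's inequality at the \<open>l\<close> with
  \<open>exp (l * y) = 1 / (n * q)\<close>, nonnegative because \<open>n * q \<le> 1\<close>: the
  moment factor is at most \<open>(1 + 1/n)^n \<le> e\<close>, and the exponential prefactor becomes
  \<open>(n * q) powr (x / y)\<close>. The path has length \<open>m \<le> n\<close> while
  \<open>q\<close> is weighed against \<open>n\<close>, so both halves of a path obtain the same
  bound.\<close>

lemma truncated_chernoff:
  assumes mgf: "mgf_bound p f y q" and y: "y > 0" and q: "q > 0" and mn: "m \<le> n" and nq: "real n * q \<le> 1"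
    and n: "n > 0"
  shows "measure (replicate_pmf m p) {xs. (\<Sum>x\<leftarrow>xs. f x) \<ge> x \<and> (\<forall>x\<in>set xs. f x \<le> y)}
      \<le> exp 1 * (real n * q) powr (x / y)"
proof -
  let ?R = "replicate_pmf m p"
  let ?E = "{xs. (\<Sum>x\<leftarrow>xs. f x) \<ge> x \<and> (\<forall>x\<in>set xs. f x \<le> y)}"
  define l where "l = - ln (real n * q) / y"
  have nq0: "real n * q > 0" using n q by simp
  have l: "l \<ge> 0" unfolding l_def using y nq nq0 by (simp add: divide_nonpos_pos)
  have ely: "exp (l * y) = 1 / (real n * q)"
    unfolding l_def using y nq0 q n by (simp add: exp_minus inverse_eq_divide exp_ln)
  have elx: "exp (- l * x) = (real n * q) powr (x / y)"
    unfolding l_def powr_def using nq0 q n by (simp add: mult.commute)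
  have "emeasure ?R ?E = (\<integral>\<^sup>+xs. indicator ?E xs \<partial>?R)" by simp
  also have "\<dots> \<le> (\<integral>\<^sup>+xs. ennreal (exp (- l * x)) * (ennreal (exp (l * (\<Sum>x\<leftarrow>xs. f x))) *
        indicator {xs. \<forall>x\<in>set xs. f x \<le> y} xs) \<partial>?R)"
  proof (rule nn_integral_mono)
    fix xs
    have "1 \<le> exp (- (l * x)) * exp (l * (\<Sum>x\<leftarrow>xs. f x))" if "(\<Sum>x\<leftarrow>xs. f x) \<ge> x"
      using that l by (simp add: mult_left_mono flip: exp_add)
    then show "indicator ?E xs \<le> ennreal (exp (- l * x)) * (ennreal (exp (l * (\<Sum>x\<leftarrow>xs. f x))) *
        indicator {xs. \<forall>x\<in>set xs. f x \<le> y} xs)"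
      by (auto simp: indicator_def ennreal_mult[symmetric])
  qed
  also have "\<dots> = ennreal (exp (- l * x)) * (\<integral>\<^sup>+x. ennreal (exp (l * f x)) * indicator {x. f x \<le> y} x \<partial>p) ^ m"
    by (subst nn_integral_cmult) (auto simp: nn_integral_replicate_truncated_exp)
  also have "\<dots> \<le> ennreal (exp (- l * x)) * ennreal (1 + exp (l * y) * q) ^ m"
    using mgf l by (intro mult_left_mono power_mono) (auto simp: mgf_bound_def)
  also have "\<dots> = ennreal (exp (- l * x) * (1 + exp (l * y) * q) ^ m)"
    using q by (subst ennreal_power) (auto simp: ennreal_mult intro!: add_nonneg_nonneg)
  also have "\<dots> \<le> ennreal (exp (- l * x) * exp 1)"
  proof (intro ennreal_leI mult_left_mono)
    have "(1 + exp (l * y) * q) ^ m \<le> (1 + exp (l * y) * q) ^ n"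
      using mn q by (intro power_increasing) auto
    also have "\<dots> = (1 + 1 / real n) ^ n" using ely q by simp
    also have "\<dots> \<le> exp (1 / real n) ^ n"
      by (intro power_mono exp_ge_add_one_self) auto
    also have "\<dots> = exp 1" using n by (simp flip: exp_of_nat_mult)
    finally show "(1 + exp (l * y) * q) ^ m \<le> exp 1" .
  qed auto
  finally have "ennreal (measure ?R ?E) \<le> ennreal (exp (- l * x) * exp 1)"
    by (simp add: measure_pmf.emeasure_eq_measure)
  then have "measure ?R ?E \<le> exp (- l * x) * exp 1" by (subst (asm) ennreal_le_iff) auto
  then show ?thesis unfolding elx by (simp add: mult.commute)
qed

section \<open>Splitting a path into two halves\<close>

lemma emeasure_pair_pmf:
  "emeasure (pair_pmf A B) Z = (\<integral>\<^sup>+x. emeasure B {y. (x, y) \<in> Z} \<partial>A)"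
proof -
  have "pair_pmf A B = bind_pmf A (\<lambda>x. map_pmf (Pair x) B)"
    by (simp add: pair_pmf_def map_pmf_def)
  then show ?thesis by (simp only: emeasure_bind_pmf emeasure_map_pmf vimage_def)
qed

text \<open>If \<open>f\<close> sums to \<open>u\<close> along a path, it sums to at least \<open>u/2\<close> over the first or the second half, and
  the other half contributes its concentration bound.\<close>

lemma walk_halving:
  fixes f :: "int \<Rightarrow> real"
  assumes det: "\<And>xs. length xs = m + n \<Longrightarrow> sum_list xs = t \<Longrightarrow> (\<Sum>x\<leftarrow>xs. f x) = u"
    and c: "\<And>s. pmf (walk p m) s \<le> c" "\<And>s. pmf (walk p n) s \<le> c"
  shows "measure (replicate_pmf (m + n) p) {xs. sum_list xs = t \<and> (\<forall>x\<in>set xs. P x)}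
    \<le> c * (measure (replicate_pmf m p) {xs. (\<Sum>x\<leftarrow>xs. f x) \<ge> u / 2 \<and> (\<forall>x\<in>set xs. P x)}
         + measure (replicate_pmf n p) {xs. (\<Sum>x\<leftarrow>xs. f x) \<ge> u / 2 \<and> (\<forall>x\<in>set xs. P x)})"
proof -
  let ?A = "replicate_pmf m p" and ?B = "replicate_pmf n p"
  define E where "E = {xs. (\<Sum>x\<leftarrow>xs. f x) \<ge> u / 2 \<and> (\<forall>x\<in>set xs. P x)}"
  let ?F = "{xs. sum_list xs = t \<and> (\<forall>x\<in>set xs. P x)}"
  have c0: "c \<ge> 0" by (rule order_trans[OF pmf_nonneg c(1)])
  have eq: "replicate_pmf (m + n) p = map_pmf (\<lambda>(xs, ys). xs @ ys) (pair_pmf ?A ?B)"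
    unfolding replicate_pmf_distrib pair_pmf_def by (simp add: map_bind_pmf map_pmf_def bind_assoc_pmf bind_return_pmf)
  have "emeasure (replicate_pmf (m + n) p) ?F = emeasure (pair_pmf ?A ?B) {(xs, ys). xs @ ys \<in> ?F}"
    unfolding eq emeasure_map_pmf by (simp add: vimage_def case_prod_unfold)
  \<comment> \<open>Restricting to the support fixes the lengths of \<open>xs\<close> and
    \<open>ys\<close>, which \<open>det\<close> requires.\<close>
  also have "\<dots> = emeasure (pair_pmf ?A ?B) ({(xs, ys). xs @ ys \<in> ?F} \<inter> set_pmf (pair_pmf ?A ?B))"
    by (rule emeasure_Int_set_pmf[symmetric])
  also have "\<dots> \<le> emeasure (pair_pmf ?A ?B) ({(xs, ys). xs \<in> E \<and> sum_list ys = t - sum_list xs}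
      \<union> {(xs, ys). ys \<in> E \<and> sum_list xs = t - sum_list ys})"
  proof (intro emeasure_mono subsetI)
    fix z assume z: "z \<in> {(xs, ys). xs @ ys \<in> ?F} \<inter> set_pmf (pair_pmf ?A ?B)"
    obtain xs ys where [simp]: "z = (xs, ys)" by (cases z)
    have len: "length (xs @ ys) = m + n" using z by (auto simp: set_replicate_pmf)
    have F: "xs @ ys \<in> ?F" using z by auto
    have "(\<Sum>x\<leftarrow>xs @ ys. f x) = u" using F by (intro det len) auto
    then have "(\<Sum>x\<leftarrow>xs. f x) \<ge> u / 2 \<or> (\<Sum>x\<leftarrow>ys. f x) \<ge> u / 2" by auto
    then show "z \<in> {(xs, ys). xs \<in> E \<and> sum_list ys = t - sum_list xs}
      \<union> {(xs, ys). ys \<in> E \<and> sum_list xs = t - sum_list ys}"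
      using F by (auto simp: E_def)
  qed auto
  also have "\<dots> \<le> emeasure (pair_pmf ?A ?B) {(xs, ys). xs \<in> E \<and> sum_list ys = t - sum_list xs}
      + emeasure (pair_pmf ?A ?B) {(xs, ys). ys \<in> E \<and> sum_list xs = t - sum_list ys}"
    by (intro emeasure_subadditive) auto
  also have "emeasure (pair_pmf ?A ?B) {(xs, ys). xs \<in> E \<and> sum_list ys = t - sum_list xs}
     = (\<integral>\<^sup>+xs. indicator E xs * emeasure ?B {ys. sum_list ys = t - sum_list xs} \<partial>?A)"
    unfolding emeasure_pair_pmf by (intro nn_integral_cong) (simp split: split_indicator)
  also have "\<dots> \<le> (\<integral>\<^sup>+xs. ennreal c * indicator E xs \<partial>?A)"
    unfolding emeasure_walk
    by (intro nn_integral_mono) (auto simp: indicator_def c intro!: ennreal_leI)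
  also have "\<dots> = ennreal c * emeasure ?A E" by (subst nn_integral_cmult) auto
  \<comment> \<open>Exchanging the two halves brings the second event into the form of the
    first.\<close>
  also have "emeasure (pair_pmf ?A ?B) {(xs, ys). ys \<in> E \<and> sum_list xs = t - sum_list ys}
     = emeasure (pair_pmf ?B ?A) {(xs, ys). xs \<in> E \<and> sum_list ys = t - sum_list xs}"
    by (subst pair_commute_pmf) (simp add: vimage_def case_prod_unfold)
  also have "\<dots>
     = (\<integral>\<^sup>+xs. indicator E xs * emeasure ?A {ys. sum_list ys = t - sum_list xs} \<partial>?B)"
    unfolding emeasure_pair_pmf by (intro nn_integral_cong) (simp split: split_indicator)
  also have "\<dots> \<le> (\<integral>\<^sup>+xs. ennreal c * indicator E xs \<partial>?B)"
    unfolding emeasure_walk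
    by (intro nn_integral_mono) (auto simp: indicator_def c intro!: ennreal_leI)
  also have "\<dots> = ennreal c * emeasure ?B E" by (subst nn_integral_cmult) auto
  finally have "ennreal (measure (replicate_pmf (m + n) p) ?F) \<le> ennreal (c * (measure ?A E + measure ?B E))"
    using c0 by (simp add: measure_pmf.emeasure_eq_measure distrib_left ennreal_mult ennreal_plus add_mono)
  then show ?thesis unfolding E_def using c0 by (subst (asm) ennreal_le_iff) auto
qed

text \<open>Either some step exceeds \<open>y\<close>, where \<open>replicate_big_jump\<close>
  applies, or all are at most \<open>y\<close>, where \<open>walk_halving\<close> does. Each half
  has only to reach \<open>u / 2\<close>, whence the exponent \<open>u / (2 * y)\<close> in place of
  \<open>u / y\<close>; the loss is harmless because \<open>y\<close> may be taken as any fraction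
  of \<open>u\<close>.\<close>

lemma walk_local_deviation:
  fixes f :: "int \<Rightarrow> real"
  assumes det: "\<And>xs. length xs = n \<Longrightarrow> sum_list xs = t \<Longrightarrow> (\<Sum>x\<leftarrow>xs. f x) = u"
    and mgf: "mgf_bound p f y q" and y: "y > 0" and q: "q > 0" and nq: "real n * q \<le> 1" and n: "n > 0"
    and M: "\<And>k. f k > y \<Longrightarrow> pmf p k \<le> M" "M \<ge> 0"
    and c: "\<And>s. pmf (walk p (n div 2)) s \<le> c"
  shows "pmf (walk p n) t \<le> real n * M + 2 * exp 1 * c * (real n * q) powr (u / (2 * y))"
proof -
  let ?m = "n div 2" let ?k = "n - n div 2"
  have n_eq: "n = ?m + ?k" by simp
  have c0: "c \<ge> 0" by (rule order_trans[OF pmf_nonneg c])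
  have c': "pmf (walk p ?k) s \<le> c" for s by (rule walk_bound_mono[OF _ c]) linarith
  let ?R = "replicate_pmf n p"
  have "pmf (walk p n) t = measure ?R {xs. sum_list xs = t}"
    using emeasure_walk[of n p t] by (simp add: measure_pmf.emeasure_eq_measure)
  also have "\<dots> \<le> measure ?R ({xs. sum_list xs = t \<and> (\<exists>x\<in>set xs. x \<in> {k. f k > y})} \<union>
      {xs. sum_list xs = t \<and> (\<forall>x\<in>set xs. f x \<le> y)})"
    by (intro measure_pmf.finite_measure_mono) force+
  also have "\<dots> \<le> measure ?R {xs. sum_list xs = t \<and> (\<exists>x\<in>set xs. x \<in> {k. f k > y})} +
      measure ?R {xs. sum_list xs = t \<and> (\<forall>x\<in>set xs. f x \<le> y)}"
    by (intro measure_subadditive) auto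
  also have "measure ?R {xs. sum_list xs = t \<and> (\<exists>x\<in>set xs. x \<in> {k. f k > y})} \<le> real n * M"
    using replicate_big_jump[of "{k. f k > y}" p M n t] M
    by (simp add: measure_pmf.emeasure_eq_measure)
  also have "measure ?R {xs. sum_list xs = t \<and> (\<forall>x\<in>set xs. f x \<le> y)} \<le>
      c * (measure (replicate_pmf ?m p) {xs. (\<Sum>x\<leftarrow>xs. f x) \<ge> u / 2 \<and> (\<forall>x\<in>set xs. f x \<le> y)}
         + measure (replicate_pmf ?k p) {xs. (\<Sum>x\<leftarrow>xs. f x) \<ge> u / 2 \<and> (\<forall>x\<in>set xs. f x \<le> y)})"
    using walk_halving[of ?m ?k t f u p c "\<lambda>x. f x \<le> y"] det c c' n_eq by simp
  also have "\<dots> \<le> c * (exp 1 * (real n * q) powr (u / 2 / y) + exp 1 * (real n * q) powr (u / 2 / y))"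
    using c0 by (intro mult_left_mono add_mono truncated_chernoff[OF mgf y q _ nq n]) auto
  finally show ?thesis by (simp add: algebra_simps)
qed

section \<open>Concentration of the walk\<close>

text \<open>Adding \<open>B\<close> makes the integrand nonnegative, so that the rule for
  nonnegative integrals over \<open>bind_pmf\<close> applies; the constant is subtracted again at
  the end.\<close>

lemma expectation_bind_bounded:
  fixes h :: "'b \<Rightarrow> real"
  assumes B: "\<And>x. \<bar>h x\<bar> \<le> B"
  shows "measure_pmf.expectation (bind_pmf p g) h =
    measure_pmf.expectation p (\<lambda>x. measure_pmf.expectation (g x) h)"
proof -
  define h' where "h' x = h x + B" for x
  have B0: "B \<ge> 0" using B[of undefined] by linarith
  have h'0: "h' x \<ge> 0" and h'B: "h' x \<le> 2 * B" for x using B[of x] unfolding h'_def by linarith+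
  have int: "integrable (measure_pmf q) h'" for q
    by (rule integrable_pmf_bounded[where B = "2 * B"]) (use h'0 h'B in auto)
  have inth: "integrable (measure_pmf q) h" for q
    by (rule integrable_pmf_bounded[OF B])
  have ex0: "measure_pmf.expectation q h' \<ge> 0" for q using h'0 by simp
  have exB: "measure_pmf.expectation q h' \<le> 2 * B" for q by (rule expectation_le_const[OF h'0 h'B])
  have "ennreal (measure_pmf.expectation (bind_pmf p g) h') = (\<integral>\<^sup>+x. h' x \<partial>bind_pmf p g)"
    by (rule nn_integral_eq_integral[symmetric]) (use int h'0 in auto)
  also have "\<dots> = (\<integral>\<^sup>+x. \<integral>\<^sup>+y. h' y \<partial>g x \<partial>p)" by simp
  also have "\<dots> = (\<integral>\<^sup>+x. ennreal (measure_pmf.expectation (g x) h') \<partial>p)"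
    by (intro nn_integral_cong nn_integral_eq_integral) (use int h'0 in auto)
  also have "\<dots> = ennreal (measure_pmf.expectation p (\<lambda>x. measure_pmf.expectation (g x) h'))"
    by (intro nn_integral_eq_integral integrable_pmf_bounded[where B = "2 * B"])
       (use ex0 exB in \<open>auto\<close>)
  finally have "measure_pmf.expectation (bind_pmf p g) h' =
      measure_pmf.expectation p (\<lambda>x. measure_pmf.expectation (g x) h')"
    by (subst (asm) ennreal_inj) (auto intro!: ex0 integral_nonneg_AE)
  moreover have "measure_pmf.expectation q h' = measure_pmf.expectation q h + B" for q
    unfolding h'_def using inth by (subst Bochner_Integration.integral_add) auto
  moreover have "integrable (measure_pmf p) (\<lambda>x. measure_pmf.expectation (g x) h)"
  proof (rule integrable_pmf_bounded[where B = B])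
    fix x
    have "\<bar>measure_pmf.expectation (g x) h\<bar> \<le> measure_pmf.expectation (g x) (\<lambda>x. \<bar>h x\<bar>)"
      by (rule integral_abs_bound)
    also have "\<dots> \<le> B" by (rule expectation_le_const) (use B in auto)
    finally show "\<bar>measure_pmf.expectation (g x) h\<bar> \<le> B" .
  qed
  ultimately show ?thesis by (simp add: Bochner_Integration.integral_add)
qed

lemma expectation_ge_finite_sum:
  fixes g :: "'b \<Rightarrow> real"
  assumes "finite A" "\<And>x. g x \<ge> 0" "\<And>x. g x \<le> B"
  shows "(\<Sum>k\<in>A. pmf p k * g k) \<le> measure_pmf.expectation p g"
proof -
  have "(\<Sum>k\<in>A. pmf p k * g k) = measure_pmf.expectation p (\<lambda>k. g k * indicator A k)"
    by (subst integral_measure_pmf_real[OF assms(1)]) (auto simp: indicator_def mult.commute split: if_splits)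
  also have "\<dots> \<le> measure_pmf.expectation p g"
    by (intro integral_mono integrable_pmf_bounded[where B = B])
       (use assms order_trans[OF assms(2,3)] in \<open>auto simp: indicator_def\<close>)
  finally show ?thesis .
qed

text \<open>Built from two real expectations, so that only real-valued conditioning and Fubini arguments are needed.\<close>

definition char_pmf :: "int pmf \<Rightarrow> real \<Rightarrow> complex" where
  "char_pmf q \<theta> = Complex (measure_pmf.expectation q (\<lambda>k. cos (\<theta> * real_of_int k)))
     (measure_pmf.expectation q (\<lambda>k. sin (\<theta> * real_of_int k)))"

lemma integrable_trig [simp]:
  fixes g :: "'b \<Rightarrow> real"
  shows "integrable (measure_pmf q) (\<lambda>k. cos (g k))" "integrable (measure_pmf q) (\<lambda>k. sin (g k))"
  using integrable_pmf_bounded[of "\<lambda>k. cos (g k)" 1] integrable_pmf_bounded[of "\<lambda>k. sin (g k)" 1]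
  by auto

lemma expectation_cos_shift:
  "measure_pmf.expectation q (\<lambda>k. cos (\<theta> * (real_of_int k - b))) =
     Re (char_pmf q \<theta>) * cos (\<theta> * b) + Im (char_pmf q \<theta>) * sin (\<theta> * b)"
  by (simp add: char_pmf_def right_diff_distrib cos_diff)

lemma char_walk: "char_pmf (walk p n) \<theta> = char_pmf p \<theta> ^ n"
proof (induction n)
  case 0
  then show ?case by (simp add: walk_0 char_pmf_def complex_eq_iff)
next
  case (Suc n)
  have w: "walk p (Suc n) = bind_pmf p (\<lambda>j. map_pmf (\<lambda>k. j + k) (walk p n))"
    using walk_add[of p 1 n] unfolding walk_1 by simp
  have "char_pmf (walk p (Suc n)) \<theta> = char_pmf p \<theta> * char_pmf (walk p n) \<theta>"
    unfolding char_pmf_def w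
    by (subst (1 2) expectation_bind_bounded[where B = 1])
       (simp_all add: complex_eq_iff distrib_left cos_add sin_add mult.commute)
  then show ?case using Suc by simp
qed

section \<open>Fourier inversion for integer-valued laws\<close>

lemma integral_cos_int:
  "(\<integral>\<theta>. indicator {-pi..pi} \<theta> *\<^sub>R cos (\<theta> * real_of_int m) \<partial>lborel) = (if m = 0 then 2 * pi else 0)"
proof (cases "m = 0")
  case True
  then show ?thesis by simp
next
  case False
  have "(\<integral>\<theta>. indicator {-pi..pi} \<theta> *\<^sub>R cos (\<theta> * real_of_int m) \<partial>lborel)
     = sin (pi * real_of_int m) / real_of_int m - sin (- pi * real_of_int m) / real_of_int m"
  proof (rule integral_FTC_atLeastAtMost)
    show "((\<lambda>\<theta>. sin (\<theta> * real_of_int m) / real_of_int m) has_vector_derivative cos (x * real_of_int m))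
      (at x within {-pi..pi})" for x
      unfolding has_real_derivative_iff_has_vector_derivative[symmetric]
      using False by (auto intro!: derivative_eq_intros)
  qed (auto intro!: continuous_intros)
  also have "sin (pi * real_of_int m) = 0" by (auto simp: sin_zero_iff_int2)
  finally show ?thesis using False by simp
qed

text \<open>The Cauchy-shaped majorant integrates to at most \<open>B * pi / s\<close>, whence
  \<open>B / (2 * s)\<close> after division by \<open>2 * pi\<close>. Here \<open>s\<close> is the
  scale of the walk, so the largest atom is of order \<open>1 / s\<close>.\<close>

lemma concentration_fourier:
  assumes bnd: "\<And>\<theta>. \<bar>\<theta>\<bar> \<le> pi \<Longrightarrow> cmod (char_pmf q \<theta>) \<le> B / (1 + (s * \<theta>)\<^sup>2)" and s: "s > 0"
  shows "pmf q t \<le> B / (2 * s)"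
proof -
  let ?L = "restrict_space lborel {-pi..pi}"
  interpret L: finite_measure ?L
    by (rule finite_measureI) (simp add: emeasure_restrict_space space_restrict_space)
  interpret Q: pair_sigma_finite "measure_pmf q" ?L ..
  interpret QL: finite_measure "measure_pmf q \<Otimes>\<^sub>M ?L"
    by (rule finite_measure_pair_measure) unfold_locales
  have B0: "B \<ge> 0" using order_trans[OF norm_ge_zero bnd[of 0]] by simp
  let ?f = "\<lambda>k \<theta>. cos (\<theta> * (real_of_int k - real_of_int t))"
  have meas: "case_prod ?f \<in> borel_measurable (measure_pmf q \<Otimes>\<^sub>M ?L)"
  proof -
    have "case_prod ?f \<in> borel_measurable (count_space UNIV \<Otimes>\<^sub>M ?L)"
      by (rule measurable_pair_measure_countable1) (auto intro!: measurable_restrict_space1)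
    moreover have "sets (count_space UNIV \<Otimes>\<^sub>M ?L) = sets (measure_pmf q \<Otimes>\<^sub>M ?L)"
      by (rule sets_pair_measure_cong) auto
    ultimately show ?thesis using measurable_cong_sets by blast
  qed
  have intf: "integrable (measure_pmf q \<Otimes>\<^sub>M ?L) (case_prod ?f)"
    by (rule QL.integrable_const_bound[where B = 1]) (use meas in auto)
  \<comment> \<open>Orthogonality of the cosines writes the indicator of \<open>t\<close> as an
    integral over the angle; Fubini then exchanges it with the expectation.\<close>
  have "2 * pi * pmf q t = measure_pmf.expectation q (\<lambda>k. 2 * pi * indicator {t} k)"
    by (simp add: measure_pmf_single)
  also have "\<dots> = measure_pmf.expectation q (\<lambda>k. (\<integral>\<theta>. ?f k \<theta> \<partial>?L))"
  proof (intro Bochner_Integration.integral_cong refl)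
    fix k
    show "2 * pi * indicator {t} k = (\<integral>\<theta>. ?f k \<theta> \<partial>?L)"
      using integral_cos_int[of "k - t"] by (subst integral_restrict_space) auto
  qed
  also have "\<dots> = (\<integral>\<theta>. measure_pmf.expectation q (\<lambda>k. ?f k \<theta>) \<partial>?L)"
    by (rule Q.Fubini_integral[symmetric, OF intf])
  also have "\<dots> \<le> (\<integral>\<theta>. B / (1 + (s * \<theta>)\<^sup>2) \<partial>?L)"
  proof (rule integral_mono)
    show "integrable ?L (\<lambda>\<theta>. measure_pmf.expectation q (\<lambda>k. ?f k \<theta>))"
      using Q.integrable_snd[OF intf] by simp
    show "integrable ?L (\<lambda>\<theta>. B / (1 + (s * \<theta>)\<^sup>2))"
    proof (rule L.integrable_const_bound[where B = B])
      show "AE \<theta> in ?L. norm (B / (1 + (s * \<theta>)\<^sup>2)) \<le> B"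
      proof (rule AE_I2)
        fix \<theta>
        have "B * 1 \<le> B * (1 + (s * \<theta>)\<^sup>2)" by (rule mult_left_mono) (use B0 in auto)
        then show "norm (B / (1 + (s * \<theta>)\<^sup>2)) \<le> B"
          using B0 by (simp add: divide_le_eq add_pos_nonneg abs_of_nonneg)
      qed
    qed (auto intro!: measurable_restrict_space1)
    fix \<theta> assume "\<theta> \<in> space ?L"
    then have th: "\<bar>\<theta>\<bar> \<le> pi" by (auto simp: space_restrict_space)
    \<comment> \<open>The integrand is the real part of the rotated characteristic function, hence
      at most its modulus.\<close>
    let ?C = "Re (char_pmf q \<theta>)" and ?S = "Im (char_pmf q \<theta>)"
    have "?C * cos (\<theta> * t) + ?S * sin (\<theta> * t) = Re (char_pmf q \<theta> * cis (- \<theta> * t))"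
      by simp
    also have "\<dots> \<le> cmod (char_pmf q \<theta> * cis (- \<theta> * t))" by (rule complex_Re_le_cmod)
    also have "\<dots> = cmod (char_pmf q \<theta>)" by (simp add: norm_mult)
    also have "\<dots> \<le> B / (1 + (s * \<theta>)\<^sup>2)" by (rule bnd[OF th])
    finally show "measure_pmf.expectation q (\<lambda>k. ?f k \<theta>) \<le> B / (1 + (s * \<theta>)\<^sup>2)"
      unfolding expectation_cos_shift .
  qed
  also have "\<dots> = (\<integral>\<theta>. indicator {-pi..pi} \<theta> *\<^sub>R (B / (1 + (s * \<theta>)\<^sup>2)) \<partial>lborel)"
    by (subst integral_restrict_space) auto
  also have "\<dots> = B / s * arctan (s * pi) - B / s * arctan (s * (- pi))"
  proof (rule integral_FTC_atLeastAtMost)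
    have nz: "1 + (s * x)\<^sup>2 \<noteq> 0" for x :: real
      by (metis add_pos_nonneg less_numeral_extra(3) zero_le_power2 zero_less_one)
    show "continuous_on {-pi..pi} (\<lambda>\<theta>. B / (1 + (s * \<theta>)\<^sup>2))"
      using nz by (intro continuous_intros) auto
    fix x :: real
    show "((\<lambda>\<theta>. B / s * arctan (s * \<theta>)) has_vector_derivative B / (1 + (s * x)\<^sup>2)) (at x within {-pi..pi})"
      unfolding has_real_derivative_iff_has_vector_derivative[symmetric]
      using s nz[of x] by (auto intro!: derivative_eq_intros simp: divide_simps)
  qed auto
  also have "\<dots> = 2 * (B / s) * arctan (s * pi)" by (simp add: arctan_minus)
  also have "\<dots> \<le> 2 * (B / s) * (pi / 2)"
    using B0 s arctan_ubound[of "s * pi"] by (intro mult_left_mono) auto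
  finally have "pi * (2 * pmf q t) \<le> pi * (B / s)" by (simp add: mult_ac)
  then have "2 * pmf q t \<le> B / s" using pi_gt_zero by (simp only: mult_le_cancel_left_pos)
  then show ?thesis by simp
qed

text \<open>The squared modulus is the characteristic function of a symmetrised step
  \<open>X - X'\<close>, so one minus it is the mean of
  \<open>1 - cos (\<theta> * (X - X'))\<close>. Keeping only \<open>X' = a\<close> and
  \<open>X\<close> in \<open>A\<close> leaves at least \<open>g\<close>; then
  \<open>1 - g \<le> exp (- g)\<close>.\<close>

lemma cmod_char_power_le:
  assumes fin: "finite A" and g: "g \<le> pmf p a * (\<Sum>k\<in>A. pmf p k * (1 - cos (\<theta> * (real_of_int k - real_of_int a))))"
  shows "cmod (char_pmf p \<theta>) ^ n \<le> exp (- (real n * g / 2))"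
proof -
  let ?C = "Re (char_pmf p \<theta>)" and ?S = "Im (char_pmf p \<theta>)"
  let ?h = "\<lambda>x::int. measure_pmf.expectation p (\<lambda>k. 1 - cos (\<theta> * (real_of_int k - real_of_int x)))"
  have h: "?h x = 1 - (?C * cos (\<theta> * x) + ?S * sin (\<theta> * x))" for x
    using expectation_cos_shift[of p \<theta> "real_of_int x"] by (simp add: Bochner_Integration.integral_diff)
  have h0: "?h x \<ge> 0" for x by (rule integral_nonneg_AE) auto
  have h2: "?h x \<le> 2" for x
  proof (rule expectation_le_const)
    show "1 - cos (\<theta> * (real_of_int k - real_of_int x)) \<le> 2" for k
      using cos_ge_minus_one[of "\<theta> * (real_of_int k - real_of_int x)"] by linarith
  qed auto
  have "g \<le> pmf p a * ?h a"
  proof (rule order_trans[OF g], intro mult_left_mono expectation_ge_finite_sum[where B = 2] fin)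
    show "1 - cos (\<theta> * (real_of_int k - real_of_int a)) \<le> 2" for k
      using cos_ge_minus_one[of "\<theta> * (real_of_int k - real_of_int a)"] by linarith
  qed auto
  also have "\<dots> \<le> measure_pmf.expectation p ?h"
    using expectation_ge_finite_sum[of "{a}" ?h 2 p] h0 h2 by simp
  also have "\<dots> = 1 - (?C * ?C + ?S * ?S)"
    unfolding h by (subst Bochner_Integration.integral_diff) (auto simp: char_pmf_def)
  also have "?C * ?C + ?S * ?S = (cmod (char_pmf p \<theta>))\<^sup>2"
    by (simp add: cmod_power2 flip: power2_eq_square)
  finally have "(cmod (char_pmf p \<theta>))\<^sup>2 \<le> 1 + (- g)" by linarith
  also have "\<dots> \<le> exp (- g)" by (rule exp_ge_add_one_self)
  also have "\<dots> = (exp (- g / 2))\<^sup>2" by (simp flip: exp_double)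
  finally have "cmod (char_pmf p \<theta>) \<le> exp (- g / 2)" by (rule power2_le_imp_le) auto
  then have "cmod (char_pmf p \<theta>) ^ n \<le> exp (- g / 2) ^ n" by (intro power_mono) auto
  also have "\<dots> = exp (- (real n * g / 2))" by (simp flip: exp_of_nat_mult)
  finally show ?thesis .
qed

section \<open>Quadratic lower bounds for \<open>1 - cos\<close>\<close>

lemma one_minus_cos_ge_small:
  fixes x :: real assumes "\<bar>x\<bar> \<le> 1" shows "1 - cos x \<ge> x\<^sup>2 / 4"
proof -
  obtain t where "cos x = (\<Sum>m<4. cos_coeff m * x ^ m) + (cos (t + 1/2 * real 4 * pi) / fact 4) * x ^ 4"
    using Maclaurin_cos_expansion[of x 4] by blast
  moreover have "cos (t + 1/2 * real 4 * pi) / fact 4 * x ^ 4 \<le> 1 / 24 * x ^ 4"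
    by (intro mult_right_mono) (auto simp: fact_numeral)
  moreover have "(\<Sum>m<4. cos_coeff m * x ^ m) = 1 - x\<^sup>2 / 2"
    by (simp add: cos_coeff_def lessThan_nat_numeral fact_numeral)
  moreover have "x ^ 4 \<le> x\<^sup>2"
    using power_decreasing[of 2 4 "\<bar>x\<bar>"] assms by (simp add: power_even_abs)
  moreover have "x\<^sup>2 \<ge> 0" by simp
  ultimately show ?thesis by linarith
qed

lemma one_minus_cos_ge:
  fixes x :: real assumes "1 \<le> x" "x \<le> 4" shows "1 - cos x \<ge> 1 / 4"
proof -
  have c1: "cos 1 \<le> (3/4 :: real)" using one_minus_cos_ge_small[of 1] by simp
  show ?thesis
  proof (cases "x \<le> pi")
    case True
    have "cos x \<le> cos 1" using assms True by (intro cos_monotone_0_pi_le) auto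
    then show ?thesis using c1 by linarith
  next
    case False
    \<comment> \<open>Beyond \<open>pi\<close> the point is reflected to \<open>2 * pi - x\<close>,
      which lies between \<open>1\<close> and \<open>pi\<close> because
      \<open>x \<le> 4\<close>.\<close>
    have "cos (2 * pi - x) \<le> cos 1"
      using assms False pi_gt3 by (intro cos_monotone_0_pi_le) auto
    moreover have "cos (2 * pi - x) = cos x" by (simp add: cos_diff)
    ultimately show ?thesis using c1 by linarith
  qed
qed

text \<open>The constant is \<open>64 = 4 * 4^2\<close>: beyond one, \<open>1 - cos x\<close> is at
  least \<open>1/4\<close>, while \<open>x^2 \<le> 16\<close>.\<close>

lemma one_minus_cos_ge_quadratic:
  fixes x :: real assumes "\<bar>x\<bar> \<le> pi" shows "1 - cos x \<ge> x\<^sup>2 / 64"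
proof (cases "\<bar>x\<bar> \<le> 1")
  case True
  then show ?thesis using one_minus_cos_ge_small[of x] zero_le_power2[of x] by linarith
next
  case False
  have "1 / 4 \<le> 1 - cos \<bar>x\<bar>"
    using assms False pi_less_4 by (intro one_minus_cos_ge) auto
  moreover have "\<bar>x\<bar>\<^sup>2 \<le> 4\<^sup>2" using assms pi_less_4 by (intro power_mono) auto
  ultimately show ?thesis by (simp add: abs_if split: if_splits)
qed

text \<open>Converts stretched exponential decay into the Cauchy shape that
  \<open>concentration_fourier\<close> expects.\<close>

lemma exp_powr_decay:
  fixes b c :: real assumes "b > 0" "c > 0"
  shows "\<exists>B>0. \<forall>x\<ge>0. exp (- c * x powr b) \<le> B / (1 + x\<^sup>2)"
proof -
  have "((\<lambda>x. exp (- c * x powr b) * (1 + x\<^sup>2)) \<longlongrightarrow> 0) at_top"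
    using assms by real_asymp
  then have "\<forall>\<^sub>F x in at_top. exp (- c * x powr b) * (1 + x\<^sup>2) < 1"
    by (rule order_tendstoD) auto
  then obtain X where X: "\<And>x. x \<ge> X \<Longrightarrow> exp (- c * x powr b) * (1 + x\<^sup>2) < 1"
    by (auto simp: eventually_at_top_linorder)
  define B where "B = 1 + \<bar>X\<bar>\<^sup>2"
  have "exp (- c * x powr b) * (1 + x\<^sup>2) \<le> B" if "x \<ge> 0" for x
  proof (cases "x \<ge> X")
    case True
    then show ?thesis using X[OF True] unfolding B_def by (intro less_imp_le[OF less_le_trans[OF X[OF True]]]) auto
  next
    case False
    have "exp (- c * x powr b) * (1 + x\<^sup>2) \<le> 1 * (1 + x\<^sup>2)"
      using assms by (intro mult_right_mono) auto
    also have "x\<^sup>2 \<le> \<bar>X\<bar>\<^sup>2" using False that by (intro power_mono) auto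
    finally show ?thesis unfolding B_def by simp
  qed
  then have "\<forall>x\<ge>0. exp (- c * x powr b) \<le> B / (1 + x\<^sup>2)"
    by (auto simp: pos_le_divide_eq add_pos_nonneg)
  moreover have "B > 0" unfolding B_def by (simp add: add_pos_nonneg)
  ultimately show ?thesis by blast
qed

section \<open>Concentration from lower bounds on atoms\<close>

lemma exp_minus_le_inverse: "exp (- z) \<le> 1 / (1 + z)" if "z \<ge> 0" for z :: real
  using exp_ge_add_one_self[of z] that
  by (simp only: exp_minus inverse_eq_divide) (intro divide_left_mono mult_pos_pos; simp)

text \<open>Two atoms at distance one make the law aperiodic: in \<open>cmod_char_power_le\<close>
  the difference \<open>1\<close> alone leaves the gap \<open>1 - cos \<theta>\<close>, which
  vanishes on \<open>[-pi, pi]\<close> only at the origin.\<close>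

lemma char_two_atoms:
  assumes th: "\<bar>\<theta>\<bar> \<le> pi"
  shows "cmod (char_pmf p \<theta>) ^ n \<le> exp (- (real n * (pmf p a * pmf p (a + 1) / 64 * \<theta>\<^sup>2) / 2))"
proof (rule cmod_char_power_le[where A = "{a + 1}"])
  have "pmf p a * (pmf p (a + 1) * (\<theta>\<^sup>2 / 64)) \<le> pmf p a * (pmf p (a + 1) * (1 - cos \<theta>))"
    using one_minus_cos_ge_quadratic[OF th] by (intro mult_left_mono) auto
  then show "pmf p a * pmf p (a + 1) / 64 * \<theta>\<^sup>2 \<le>
    pmf p a * (\<Sum>k\<in>{a + 1}. pmf p k * (1 - cos (\<theta> * (real_of_int k - real_of_int a))))"
    by simp
qed auto

text \<open>The quadratic gap of two neighbouring atoms gives Gaussian decay at the scale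
  \<open>sqrt (c * n)\<close>; \<open>128\<close> is the \<open>64\<close> of
  \<open>char_two_atoms\<close> times the \<open>2\<close> in its exponent.\<close>

lemma concentration_sqrt:
  assumes "pmf p a > 0" "pmf p (a + 1) > 0"
  shows "\<exists>C>0. \<forall>n>0. \<forall>t. pmf (walk p n) t \<le> C * real n powr (- 1 / 2)"
proof -
  define c where "c = pmf p a * pmf p (a + 1) / 128"
  have c: "c > 0" using assms by (simp add: c_def)
  have "pmf (walk p n) t \<le> 1 / (2 * sqrt c) * real n powr (- 1 / 2)" if n: "n > 0" for n t
  proof -
    have "pmf (walk p n) t \<le> 1 / (2 * sqrt (c * n))"
    proof (rule concentration_fourier)
      fix \<theta> :: real assume th: "\<bar>\<theta>\<bar> \<le> pi"
      have "cmod (char_pmf (walk p n) \<theta>) \<le> exp (- ((sqrt (c * n) * \<theta>)\<^sup>2))"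
        using char_two_atoms[OF th, of p n a] c
        by (simp add: char_walk norm_power power_mult_distrib c_def algebra_simps)
      also have "\<dots> \<le> 1 / (1 + (sqrt (c * n) * \<theta>)\<^sup>2)" by (rule exp_minus_le_inverse) simp
      finally show "cmod (char_pmf (walk p n) \<theta>) \<le> 1 / (1 + (sqrt (c * n) * \<theta>)\<^sup>2)" .
    qed (use c n in auto)
    also have "\<dots> = 1 / (2 * sqrt c) * real n powr (- 1 / 2)"
      using n by (simp add: real_sqrt_mult powr_minus powr_half_sqrt inverse_eq_divide)
    finally show ?thesis .
  qed
  then show ?thesis using c by (intro exI[of _ "1 / (2 * sqrt c)"]) auto
qed

text \<open>For small \<open>\<theta>\<close> there are about \<open>1 / |\<theta>|\<close> atoms at
  distance about \<open>1 / |\<theta>|\<close> from \<open>k1\<close>, each of mass at least of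
  order \<open>|\<theta>| powr (1 + b)\<close>, so the gap is of order
  \<open>|\<theta>| powr b\<close>. For \<open>b < 2\<close> this exceeds the quadratic gap of two
  atoms, and the scale of the walk becomes \<open>n powr (1 / b)\<close>.\<close>

lemma concentration_heavy:
  fixes p :: "int pmf" and b c :: real and k1 :: nat
  assumes c: "c > 0" and b: "b > 0" and k1: "k1 > 0"
    and low: "\<And>k. k \<ge> k1 \<Longrightarrow> pmf p (int k) \<ge> c * real k powr (- (1 + b))"
  shows "\<exists>C>0. \<forall>n>0. \<forall>t. pmf (walk p n) t \<le> C * real n powr (- 1 / b)"
proof -
  define p0 where "p0 = pmf p (int k1)"
  define p1 where "p1 = pmf p (int k1 + 1)"
  have p0: "p0 > 0" unfolding p0_def using low[of k1] c k1
    by (auto intro: less_le_trans[of 0 "c * real k1 powr (- (1 + b))"])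
  have "pmf p (int (k1 + 1)) > 0" using low[of "k1 + 1"] c
    by (auto intro: less_le_trans[of 0 "c * real (k1+1) powr (- (1 + b))"])
  then have p1: "p1 > 0" unfolding p1_def by (simp add: add.commute)
  \<comment> \<open>\<open>c1\<close> serves small angles, \<open>c2\<close> the angles away from
    the origin; the half in \<open>c3\<close> is the one in the exponent of
    \<open>cmod_char_power_le\<close>.\<close>
  define c1 where "c1 = p0 * (c * 3 powr (- (1 + b)) / 4 * 2 powr (- b))"
  define c2 where "c2 = p0 * p1 / 64 / (real k1)\<^sup>2 * pi powr (- b)"
  define c3 where "c3 = min c1 c2 / 2"
  have c3: "c3 > 0" unfolding c3_def c1_def c2_def using p0 p1 c k1 by simp
  have main: "cmod (char_pmf p \<theta>) ^ n \<le> exp (- c3 * (real n * \<bar>\<theta>\<bar> powr b))" if th: "\<bar>\<theta>\<bar> \<le> pi" for \<theta> n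
  proof (cases "\<bar>\<theta>\<bar> \<ge> 1 / real k1 \<or> \<theta> = 0")
    case True
    have "c2 * \<bar>\<theta>\<bar> powr b \<le> p0 * p1 / 64 * \<theta>\<^sup>2"
    proof (cases "\<theta> = 0")
      case False
      then have th1: "\<bar>\<theta>\<bar> \<ge> 1 / real k1" using True by auto
      have "\<bar>\<theta>\<bar> powr b \<le> pi powr b" using th b by (intro powr_mono2) auto
      then have "c2 * \<bar>\<theta>\<bar> powr b \<le> c2 * pi powr b" 
        unfolding c2_def using p0 p1 by (intro mult_left_mono) auto
      also have "\<dots> = p0 * p1 / 64 * (1 / real k1)\<^sup>2"
        unfolding c2_def by (simp add: powr_minus power_divide)
      also have "\<dots> \<le> p0 * p1 / 64 * \<bar>\<theta>\<bar>\<^sup>2"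
        using th1 p0 p1 by (intro mult_left_mono power_mono) auto
      finally show ?thesis by simp
    qed simp
    moreover have "c3 * \<bar>\<theta>\<bar> powr b \<le> c2 / 2 * \<bar>\<theta>\<bar> powr b"
      by (intro mult_right_mono) (auto simp: c3_def)
    ultimately have "c3 * \<bar>\<theta>\<bar> powr b \<le> p0 * p1 / 64 * \<theta>\<^sup>2 / 2" by simp
    then have "real n * (c3 * \<bar>\<theta>\<bar> powr b) \<le> real n * (p0 * p1 / 64 * \<theta>\<^sup>2 / 2)" by (intro mult_left_mono) auto
    then have "- (real n * (p0 * p1 / 64 * \<theta>\<^sup>2) / 2) \<le> - c3 * (real n * \<bar>\<theta>\<bar> powr b)" by (simp add: algebra_simps)
    moreover have "cmod (char_pmf p \<theta>) ^ n \<le> exp (- (real n * (p0 * p1 / 64 * \<theta>\<^sup>2) / 2))"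
      unfolding p0_def p1_def by (rule char_two_atoms[OF th])
    ultimately show ?thesis by (metis exp_le_cancel_iff order_trans)
  next
    case False
    then have th1: "\<bar>\<theta>\<bar> < 1 / real k1" and th0: "\<bar>\<theta>\<bar> > 0" by auto
    \<comment> \<open>all \<open>d \<in> [m, 2 m)\<close> satisfy \<open>1 \<le> d \<bar>\<theta>\<bar> \<le> 4\<close>, where \<open>cos\<close> stays away from \<open>1\<close>\<close>
    define m where "m = nat \<lceil>1 / \<bar>\<theta>\<bar>\<rceil>"
    have m1: "1 / \<bar>\<theta>\<bar> \<le> real m" unfolding m_def by linarith
    have thk: "real k1 < 1 / \<bar>\<theta>\<bar>" using th1 th0 k1 by (simp add: field_simps)
    have k1m: "k1 \<le> m" using m1 thk by simp
    have m2: "real m \<le> 1 / \<bar>\<theta>\<bar> + 1" unfolding m_def using ceiling_correct[of "1 / \<bar>\<theta>\<bar>"] by (simp add: of_nat_nat)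
    have "1 \<le> 1 / \<bar>\<theta>\<bar>" using thk k1 by linarith
    with m2 have m3: "real m \<le> 2 / \<bar>\<theta>\<bar>" by simp
    have m0: "m > 0" using k1m k1 by simp
    let ?A = "(\<lambda>d. int k1 + int d) ` {m..<2 * m}"
    have atom: "c * (3 * real m) powr (- (1 + b)) * (1 / 4) \<le>
        pmf p (int k1 + int d) * (1 - cos (\<theta> * (real_of_int (int k1 + int d) - real_of_int (int k1))))"
      if d: "d \<in> {m..<2*m}" for d
    proof -
      have "1 \<le> real m * \<bar>\<theta>\<bar>" using m1 th0 by (simp add: field_simps)
      also have "\<dots> \<le> real d * \<bar>\<theta>\<bar>" using d by (intro mult_right_mono) auto
      finally have a: "1 \<le> real d * \<bar>\<theta>\<bar>" .
      have "real d * \<bar>\<theta>\<bar> \<le> real (2 * m) * \<bar>\<theta>\<bar>" using d by (intro mult_right_mono) auto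
      also have "\<dots> \<le> 4" using m3 th0 by (simp add: field_simps)
      finally have "1 - cos (real d * \<bar>\<theta>\<bar>) \<ge> 1 / 4" using a by (intro one_minus_cos_ge) auto
      moreover have "cos (real d * \<bar>\<theta>\<bar>) = cos (\<theta> * real d)" by (cases "\<theta> \<ge> 0") (auto simp: mult.commute)
      ultimately have g: "1 / 4 \<le> 1 - cos (\<theta> * real d)" by simp
      \<comment> \<open>\<open>k1 \<le> m\<close> and \<open>d < 2 * m\<close> put the atom
        \<open>k1 + d\<close> below \<open>3 * m\<close>.\<close>
      have "c * (3 * real m) powr (- (1 + b)) \<le> c * real (k1 + d) powr (- (1 + b))"
        using d k1m k1 c b by (intro mult_left_mono powr_mono2') auto
      also have "\<dots> \<le> pmf p (int (k1 + d))" by (rule low) simp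
      finally show ?thesis using g c by (intro mult_mono) auto
    qed
    have "real m * (c * (3 * real m) powr (- (1 + b)) * (1 / 4)) \<le>
      (\<Sum>d\<in>{m..<2*m}. pmf p (int k1 + int d) * (1 - cos (\<theta> * (real_of_int (int k1 + int d) - real_of_int (int k1)))))"
      using sum_mono[OF atom, of "{m..<2*m}" "\<lambda>d. d"] by simp
    also have "\<dots> = (\<Sum>k\<in>?A. pmf p k * (1 - cos (\<theta> * (real_of_int k - real_of_int (int k1)))))"
      by (subst sum.reindex) (auto simp: inj_on_def)
    finally have S: "real m * (c * (3 * real m) powr (- (1 + b)) * (1 / 4)) \<le> \<dots>" .
    have "2 powr (- b) * \<bar>\<theta>\<bar> powr b = (2 / \<bar>\<theta>\<bar>) powr (- b)"
      using th0 by (simp add: powr_divide powr_minus field_simps)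
    also have "\<dots> \<le> real m powr (- b)" using m3 m0 b by (intro powr_mono2') auto
    also have "\<dots> = real m * real m powr (- (1 + b))" using m0 by (simp add: powr_diff powr_minus field_simps powr_add)
    finally have "2 powr (- b) * \<bar>\<theta>\<bar> powr b * (c * 3 powr (- (1+b)) * (1/4)) \<le>
        real m * real m powr (- (1 + b)) * (c * 3 powr (- (1+b)) * (1/4))"
      using c by (intro mult_right_mono) auto
    also have "\<dots> = real m * (c * (3 * real m) powr (- (1 + b)) * (1 / 4))"
      using m0 by (subst powr_mult) auto
    also note S
    finally have "p0 * (2 powr (- b) * \<bar>\<theta>\<bar> powr b * (c * 3 powr (- (1+b)) * (1/4))) \<le> p0 * (\<Sum>k\<in>?A. pmf p k * (1 - cos (\<theta> * (real_of_int k - real_of_int (int k1)))))"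
      using p0 by (intro mult_left_mono) auto
    moreover have "c1 * \<bar>\<theta>\<bar> powr b = p0 * (2 powr (- b) * \<bar>\<theta>\<bar> powr b * (c * 3 powr (- (1+b)) * (1/4)))"
      unfolding c1_def by simp
    ultimately have "c1 * \<bar>\<theta>\<bar> powr b \<le> p0 * (\<Sum>k\<in>?A. pmf p k * (1 - cos (\<theta> * (real_of_int k - real_of_int (int k1)))))" by (simp only:)
    then have "cmod (char_pmf p \<theta>) ^ n \<le> exp (- (real n * (c1 * \<bar>\<theta>\<bar> powr b) / 2))"
      unfolding p0_def by (intro cmod_char_power_le[of ?A _ _ "int k1"]) auto
    moreover have "c3 * \<bar>\<theta>\<bar> powr b \<le> c1 / 2 * \<bar>\<theta>\<bar> powr b"
      by (intro mult_right_mono) (auto simp: c3_def)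
    then have "real n * (c3 * \<bar>\<theta>\<bar> powr b) \<le> real n * (c1 / 2 * \<bar>\<theta>\<bar> powr b)" by (intro mult_left_mono) auto
    then have "- (real n * (c1 * \<bar>\<theta>\<bar> powr b) / 2) \<le> - c3 * (real n * \<bar>\<theta>\<bar> powr b)" by (simp add: algebra_simps)
    ultimately show ?thesis by (metis exp_le_cancel_iff order_trans)
  qed
  obtain B where B: "B > 0" "\<And>x. x \<ge> 0 \<Longrightarrow> exp (- c3 * x powr b) \<le> B / (1 + x\<^sup>2)"
    using exp_powr_decay[OF b c3] by blast
  have "pmf (walk p n) t \<le> B / 2 * real n powr (- 1 / b)" if n: "n > 0" for n t
  proof -
    let ?s = "real n powr (1 / b)"
    have "pmf (walk p n) t \<le> B / (2 * ?s)"
    proof (rule concentration_fourier)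
      fix \<theta> :: real assume th: "\<bar>\<theta>\<bar> \<le> pi"
      have "cmod (char_pmf (walk p n) \<theta>) \<le> exp (- c3 * (real n * \<bar>\<theta>\<bar> powr b))"
        using main[OF th, of n] by (simp add: char_walk norm_power)
      also have "real n * \<bar>\<theta>\<bar> powr b = (?s * \<bar>\<theta>\<bar>) powr b"
        using b n by (simp add: powr_mult powr_powr)
      also have "exp (- c3 * \<dots>) \<le> B / (1 + (?s * \<bar>\<theta>\<bar>)\<^sup>2)" by (rule B) auto
      finally show "cmod (char_pmf (walk p n) \<theta>) \<le> B / (1 + (?s * \<theta>)\<^sup>2)" by (simp add: power_mult_distrib)
    qed (use n in auto)
    also have "\<dots> = B / 2 * real n powr (- 1 / b)"
      using powr_minus[of "real n" "1 / b"] by (simp add: field_simps)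
    finally show ?thesis .
  qed
  then show ?thesis using B(1) by (intro exI[of _ "B / 2"]) auto
qed

text \<open>With atoms of order \<open>k^(-3)\<close> the truncated variance grows like a logarithm:
  the atoms at distance \<open>d\<close> with \<open>d * |\<theta>| \<le> 1\<close> contribute
  \<open>d^(-3) * (d * \<theta>)^2 = \<theta>^2 / d\<close>, a harmonic sum of order
  \<open>\<theta>^2 * ln n\<close>. The scale is thus \<open>sqrt (n * ln n)\<close>.\<close>

lemma concentration_log:
  fixes p :: "int pmf" and c :: real and k1 :: nat
  assumes c: "c > 0" and k1: "k1 > 0"
    and low: "\<And>k. k \<ge> k1 \<Longrightarrow> pmf p (int k) \<ge> c * real k powr (- 3)"
  shows "\<exists>C>0. \<forall>n>1. \<forall>t. pmf (walk p n) t \<le> C * (real n * ln (real n)) powr (- 1 / 2)"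
proof -
  define p0 where "p0 = pmf p (int k1)"
  define p1 where "p1 = pmf p (int k1 + 1)"
  have p0: "p0 > 0" unfolding p0_def using low[of k1] c k1
    by (auto intro: less_le_trans[of 0 "c * real k1 powr (- 3)"])
  have "pmf p (int (k1 + 1)) > 0" using low[of "k1 + 1"] c
    by (auto intro: less_le_trans[of 0 "c * real (k1+1) powr (- 3)"])
  then have p1: "p1 > 0" unfolding p1_def by (simp add: add.commute)
  define c1 where "c1 = p0 * (c * (real k1 + 1) powr (- 3) / 4) / 8"
  define c2 where "c2 = p0 * p1 / 128"
  have c1: "c1 > 0" unfolding c1_def using p0 c k1 by simp
  have c2: "c2 > 0" unfolding c2_def using p0 p1 by simp
  \<comment> \<open>Angles up to \<open>n powr (-1/4)\<close> allow distances up to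
    \<open>n powr (1/4)\<close>, whose harmonic sum is still a fixed fraction of
    \<open>ln n\<close>; larger angles leave \<open>n * \<theta>^2 \<ge> sqrt n\<close> for the
    two-atom bound.\<close>
  have small: "cmod (char_pmf p \<theta>) ^ n \<le> exp (- (c1 * (real n * ln (real n)) * \<theta>\<^sup>2))"
    if n: "n > 1" and th: "\<bar>\<theta>\<bar> \<le> real n powr (- 1 / 4)" for \<theta> n
  proof -
    define D where "D = nat \<lfloor>real n powr (1 / 4)\<rfloor>"
    have D: "real D \<le> real n powr (1 / 4)" "real n powr (1 / 4) \<le> real D + 1"
      unfolding D_def by simp linarith
    let ?A = "(\<lambda>d. int k1 + int d) ` {1..D}"
    let ?K = "c * (real k1 + 1) powr (- 3) / 4"
    have atom: "?K * \<theta>\<^sup>2 * inverse (real d) \<le>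
        pmf p (int k1 + int d) * (1 - cos (\<theta> * (real_of_int (int k1 + int d) - real_of_int (int k1))))"
      if d: "d \<in> {1..D}" for d
    proof -
      have d0: "real d > 0" using d by simp
      have "\<bar>\<theta> * real d\<bar> \<le> real n powr (- 1 / 4) * real n powr (1 / 4)"
        unfolding abs_mult using th d D by (intro mult_mono) auto
      also have "\<dots> = 1" using n by (simp flip: powr_add)
      finally have cosd: "(\<theta> * real d)\<^sup>2 / 4 \<le> 1 - cos (\<theta> * real d)" by (rule one_minus_cos_ge_small)
      have "real k1 + real d \<le> (real k1 + 1) * real d"
        using d k1 mult_left_mono[of 1 "real d" "real k1"] by (simp add: algebra_simps)
      then have "c * ((real k1 + 1) * real d) powr (- 3) \<le> c * real (k1 + d) powr (- 3)"
        using d k1 c by (intro mult_left_mono powr_mono2') auto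
      also have "\<dots> \<le> pmf p (int (k1 + d))" by (rule low) simp
      finally have pd: "c * ((real k1 + 1) * real d) powr (- 3) \<le> pmf p (int k1 + int d)" by simp
      have "?K * \<theta>\<^sup>2 * inverse (real d) = c * ((real k1 + 1) * real d) powr (- 3) * ((\<theta> * real d)\<^sup>2 / 4)"
      proof -
        have "real d powr (- 3) * (real d)\<^sup>2 = inverse (real d)"
          using d0 by (simp add: powr_minus powr_numeral field_simps power2_eq_square power3_eq_cube)
        then show ?thesis using d0 k1
          by (subst powr_mult) (auto simp: power_mult_distrib mult.assoc mult.left_commute)
      qed
      also have "\<dots> \<le> pmf p (int k1 + int d) * (1 - cos (\<theta> * real d))"
        using pd cosd by (intro mult_mono) auto
      finally show ?thesis by simp
    qed
    have "ln (real n) / 4 = ln (real n powr (1 / 4))" using n by (simp add: ln_powr)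
    also have "\<dots> \<le> ln (real D + 1)" using D n by (subst ln_le_cancel_iff) auto
    also have "\<dots> \<le> harm D" by (rule ln_le_harm)
    finally have "?K * \<theta>\<^sup>2 * (ln (real n) / 4) \<le> ?K * \<theta>\<^sup>2 * harm D" using c by (intro mult_left_mono) auto
    also have "\<dots> = (\<Sum>d\<in>{1..D}. ?K * \<theta>\<^sup>2 * inverse (real d))" by (simp add: harm_def sum_distrib_left)
    also have "\<dots> \<le> (\<Sum>d\<in>{1..D}. pmf p (int k1 + int d) * (1 - cos (\<theta> * (real_of_int (int k1 + int d) - real_of_int (int k1)))))"
      by (rule sum_mono[OF atom])
    also have "\<dots> = (\<Sum>k\<in>?A. pmf p k * (1 - cos (\<theta> * (real_of_int k - real_of_int (int k1)))))"
      by (subst sum.reindex) (auto simp: inj_on_def)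
    finally have "p0 * (?K * \<theta>\<^sup>2 * (ln (real n) / 4)) \<le> p0 * \<dots>" using p0 by (intro mult_left_mono) auto
    then have "cmod (char_pmf p \<theta>) ^ n \<le> exp (- (real n * (p0 * (?K * \<theta>\<^sup>2 * (ln (real n) / 4))) / 2))"
      unfolding p0_def by (intro cmod_char_power_le[of ?A _ _ "int k1"]) auto
    also have "- (real n * (p0 * (?K * \<theta>\<^sup>2 * (ln (real n) / 4))) / 2) = - (c1 * (real n * ln (real n)) * \<theta>\<^sup>2)"
      unfolding c1_def by (simp add: algebra_simps)
    finally show ?thesis .
  qed
  obtain B where B: "B > 0" "\<And>x. x \<ge> 0 \<Longrightarrow> exp (- c2 * x powr (1/2)) \<le> B / (1 + x\<^sup>2)"
    using exp_powr_decay[of "1/2" c2] c2 by auto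
  define B' where "B' = 1 + B * (1 + c1 * pi\<^sup>2)"
  have B': "B' \<ge> 1" unfolding B'_def using B c1 by simp
  have "pmf (walk p n) t \<le> B' / (2 * sqrt c1) * (real n * ln (real n)) powr (- 1 / 2)" if n: "n > 1" for n t
  proof -
    let ?s = "sqrt (c1 * (real n * ln (real n)))"
    have s0: "?s > 0" using n c1 by simp
    have s2: "?s\<^sup>2 = c1 * (real n * ln (real n))" using n c1 by simp
    have "pmf (walk p n) t \<le> B' / (2 * ?s)"
    proof (rule concentration_fourier)
      fix \<theta> :: real assume th: "\<bar>\<theta>\<bar> \<le> pi"
      have cm: "cmod (char_pmf (walk p n) \<theta>) = cmod (char_pmf p \<theta>) ^ n" by (simp add: char_walk norm_power)
      show "cmod (char_pmf (walk p n) \<theta>) \<le> B' / (1 + (?s * \<theta>)\<^sup>2)"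
      proof (cases "\<bar>\<theta>\<bar> \<le> real n powr (- 1 / 4)")
        case True
        have "cmod (char_pmf p \<theta>) ^ n \<le> exp (- (?s * \<theta>)\<^sup>2)"
          using small[OF n True] unfolding power_mult_distrib s2 .
        also have "\<dots> \<le> 1 / (1 + (?s * \<theta>)\<^sup>2)" by (rule exp_minus_le_inverse) simp
        also have "\<dots> \<le> B' / (1 + (?s * \<theta>)\<^sup>2)" using B' by (intro divide_right_mono) auto
        finally show ?thesis unfolding cm .
      next
        case False
        have "(real n powr (- 1 / 4))\<^sup>2 \<le> \<bar>\<theta>\<bar>\<^sup>2" using False by (intro power_mono) auto
        moreover have "(real n powr (- 1 / 4))\<^sup>2 = real n powr (-1/2)" using n by (simp add: powr_power)
        ultimately have "real n powr (-1/2) \<le> \<theta>\<^sup>2" by simp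
        then have "c2 * (real n * real n powr (-1/2)) \<le> c2 * (real n * \<theta>\<^sup>2)" using c2 by (intro mult_left_mono) auto
        moreover have "real n * real n powr (-1/2) = real n powr (1/2)"
          using n powr_add[of "real n" 1 "-1/2"] by simp
        ultimately have "c2 * real n powr (1/2) \<le> c2 * (real n * \<theta>\<^sup>2)" by simp
        moreover have "cmod (char_pmf p \<theta>) ^ n \<le> exp (- (c2 * (real n * \<theta>\<^sup>2)))"
          using char_two_atoms[OF th, of p n "int k1"] by (simp add: c2_def p0_def p1_def algebra_simps)
        ultimately have "cmod (char_pmf p \<theta>) ^ n \<le> exp (- c2 * real n powr (1/2))" by (simp add: order_trans)
        also have "\<dots> \<le> B / (1 + (real n)\<^sup>2)" by (rule B) simp
        \<comment> \<open>The stretched exponential in \<open>sqrt n\<close> has been weakened to a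
          multiple of \<open>1 / (1 + n^2)\<close>, and \<open>(?s * \<theta>)^2\<close> is at most
          a multiple of \<open>n^2\<close> because \<open>ln n \<le> n\<close>.\<close>
        also have "\<dots> \<le> B' / (1 + (?s * \<theta>)\<^sup>2)"
        proof -
          have "(?s * \<theta>)\<^sup>2 = c1 * (real n * ln (real n)) * \<theta>\<^sup>2" unfolding power_mult_distrib s2 ..
          also have "\<dots> \<le> c1 * (real n * real n) * pi\<^sup>2"
            using c1 n th ln_le_minus_one[of "real n"] abs_le_square_iff[of \<theta> pi]
            by (intro mult_mono) auto
          also have "\<dots> = c1 * pi\<^sup>2 * (real n)\<^sup>2" by (simp add: power2_eq_square)
          finally have "1 + (?s * \<theta>)\<^sup>2 \<le> (1 + c1 * pi\<^sup>2) * (1 + (real n)\<^sup>2)"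
            using c1 by (simp add: algebra_simps add_increasing)
          then have "B * (1 + (?s * \<theta>)\<^sup>2) \<le> B * ((1 + c1 * pi\<^sup>2) * (1 + (real n)\<^sup>2))"
            using B by (intro mult_left_mono) auto
          also have "\<dots> \<le> B' * (1 + (real n)\<^sup>2)"
            unfolding B'_def using B c1 by (simp add: algebra_simps)
          finally show ?thesis by (simp add: divide_le_eq pos_le_divide_eq add_pos_nonneg field_simps)
        qed
        finally show ?thesis unfolding cm .
      qed
    qed (use s0 in auto)
    also have "\<dots> = B' / (2 * sqrt c1) * (real n * ln (real n)) powr (- 1 / 2)"
      using n c1 by (simp add: real_sqrt_mult powr_minus powr_half_sqrt inverse_eq_divide)
    finally show ?thesis .
  qed
  then show ?thesis using B' c1 by (intro exI[of _ "B' / (2 * sqrt c1)"]) auto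
qed

section \<open>Truncated moments\<close>

text \<open>Termwise in the power series: \<open>(s Z)\<^sup>k \<le> s\<^sup>2 Z\<^sup>k\<close> for \<open>k \<ge> 2\<close>.\<close>

lemma exp_remainder_le:
  fixes s Z :: real
  assumes "\<bar>s\<bar> \<le> 1" "Z \<ge> 0"
  shows "exp (s * Z) \<le> 1 + s * Z + s\<^sup>2 * exp Z"
proof -
  have sums: "(\<lambda>k. x ^ (k + 2) / fact (k + 2)) sums (exp x - 1 - x)" for x :: real
    using sums_split_initial_segment[OF exp_converges[of x], of 2]
    by (simp add: numeral_eq_Suc divide_inverse mult.commute algebra_simps)
  have "exp (s * Z) - 1 - s * Z \<le> s\<^sup>2 * (exp Z - 1 - Z)"
  proof (rule sums_le[OF _ sums sums_mult[OF sums]])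
    fix k
    have "(s * Z) ^ (k + 2) \<le> \<bar>s\<bar> ^ (k + 2) * Z ^ (k + 2)"
      using abs_ge_self[of "(s * Z) ^ (k + 2)"]
      by (simp only: power_mult_distrib abs_mult power_abs abs_of_nonneg[OF assms(2)])
    also have "\<bar>s\<bar> ^ (k + 2) \<le> \<bar>s\<bar> ^ 2" using assms by (intro power_decreasing) auto
    finally have "(s * Z) ^ (k + 2) \<le> s\<^sup>2 * Z ^ (k + 2)" using assms by (simp add: mult_right_mono)
    then show "(s * Z) ^ (k + 2) / fact (k + 2) \<le> s\<^sup>2 * (Z ^ (k + 2) / fact (k + 2))"
      by (simp add: divide_right_mono)
  qed
  also have "\<dots> \<le> s\<^sup>2 * exp Z" using assms by (intro mult_left_mono) auto
  finally show ?thesis by simp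
qed

text \<open>Quadratic up to one and linear beyond, in the manner of Huber's loss: a first moment
  makes it integrable, while inside the truncation level it measures the variance.\<close>

definition huber :: "real \<Rightarrow> real" where
  "huber z = min (z\<^sup>2) \<bar>z\<bar>"

lemma huber_nonneg [simp]: "huber z \<ge> 0"
  by (simp add: huber_def)

lemma huber_le_square: "huber z \<le> z\<^sup>2"
  by (simp add: huber_def)

lemma huber_mono: "\<bar>a\<bar> \<le> \<bar>b\<bar> \<Longrightarrow> huber a \<le> huber b"
  unfolding huber_def by (intro min.mono) (auto simp: abs_le_square_iff)

lemma huber_double: "huber (2 * z) \<le> 4 * huber z"
  by (auto simp: huber_def power_mult_distrib min_def)

text \<open>Quasi-subadditivity, by which a bound for the uncentred step passes to the centred
  one.\<close>

lemma huber_add: "huber (a + b) \<le> 4 * (huber a + huber b)"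
proof -
  have "huber (a + b) \<le> huber (2 * (max \<bar>a\<bar> \<bar>b\<bar>))" by (rule huber_mono) auto
  also have "\<dots> \<le> 4 * huber (max \<bar>a\<bar> \<bar>b\<bar>)" by (rule huber_double)
  also have "huber (max \<bar>a\<bar> \<bar>b\<bar>) \<le> huber a + huber b"
    by (cases "\<bar>a\<bar> \<le> \<bar>b\<bar>") (auto simp: max_def huber_def)
  finally show ?thesis by simp
qed

lemma huber_small: "\<bar>z\<bar> \<le> 1 \<Longrightarrow> huber z = z\<^sup>2"
  using mult_left_le[of "\<bar>z\<bar>" "\<bar>z\<bar>"] by (simp add: huber_def power2_eq_square min_def)

lemma huber_large: "\<bar>z\<bar> \<ge> 1 \<Longrightarrow> huber z = \<bar>z\<bar>"
  using mult_left_mono[of 1 "\<bar>z\<bar>" "\<bar>z\<bar>"] by (auto simp: huber_def power2_eq_square min_def)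

lemma huber_ge_one: "\<bar>z\<bar> \<ge> 1 \<Longrightarrow> huber z \<ge> 1"
  using power_mono[of 1 "\<bar>z\<bar>" 2] by (auto simp: huber_def)

lemma integrable_huber:
  assumes "integrable (measure_pmf p) f"
  shows "integrable (measure_pmf p) (\<lambda>x. huber (f x / y))"
proof (rule Bochner_Integration.integrable_bound)
  show "integrable (measure_pmf p) (\<lambda>x. f x / y)" using assms by simp
qed (auto simp: huber_def)

text \<open>Pointwise, below the level \<open>y\<close>, one has
  \<open>exp (l * f) \<le> 1 + l * f + exp (l * y) * huber (f / y)\<close>; centring removes the
  linear term in the mean.\<close>

lemma mgf_bound_centred:
  assumes f: "integrable (measure_pmf p) f" "measure_pmf.expectation p f = 0" and y: "y > 0"
  shows "mgf_bound p f y (measure_pmf.expectation p (\<lambda>x. huber (f x / y)))"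
  unfolding mgf_bound_def
proof (intro allI impI)
  fix l :: real assume l: "l \<ge> 0"
  let ?g = "\<lambda>x. 1 + l * f x + exp (l * y) * huber (f x / y)"
  have pt: "exp (l * f x) * indicator {x. f x \<le> y} x \<le> ?g x" for x
  proof -
    consider "f x > y" | "\<bar>f x\<bar> \<le> y" | "f x < - y" by linarith
    then show ?thesis
    proof cases
      case 1
      then show ?thesis using l y by (auto intro!: add_nonneg_nonneg)
    next
      case 2
      \<comment> \<open>The series bound with \<open>s = f x / y\<close> and
        \<open>Z = l * y\<close> yields the quadratic branch of \<open>huber\<close>.\<close>
      have a: "\<bar>f x / y\<bar> \<le> 1" using 2 y by simp
      have "f x / y * (l * y) = l * f x" using y by simp
      then have "exp (l * f x) \<le> ?g x"
        using exp_remainder_le[OF a, of "l * y"] l y by (simp add: huber_small[OF a] mult.commute)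
      then show ?thesis using 2 by (simp add: indicator_def)
    next
      case 3
      have h: "huber (f x / y) = \<bar>f x / y\<bar>" using 3 y by (intro huber_large) (simp add: field_simps)
      have e1: "exp (l * f x) \<le> 1" using l 3 y by (simp add: mult_nonneg_nonpos)
      \<comment> \<open>The linear term \<open>l * f x\<close> is now negative and large;
        \<open>l * y \<le> exp (l * y)\<close> lets the linear branch of \<open>huber\<close> pay
        for it.\<close>
      have "l * y \<le> exp (l * y)" using exp_ge_add_one_self[of "l * y"] by linarith
      then have "l * y * \<bar>f x / y\<bar> \<le> exp (l * y) * \<bar>f x / y\<bar>"
        by (intro mult_right_mono) auto
      moreover have "l * y * \<bar>f x / y\<bar> = - l * f x" using y 3 by simp
      ultimately have "exp (l * f x) \<le> ?g x" unfolding h using e1 by linarith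
      then show ?thesis using 3 y by (simp add: indicator_def)
    qed
  qed
  have int: "integrable (measure_pmf p) ?g" using f integrable_huber[OF f(1)] by auto
  have "(\<integral>\<^sup>+x. ennreal (exp (l * f x)) * indicator {x. f x \<le> y} x \<partial>p)
      = (\<integral>\<^sup>+x. ennreal (exp (l * f x) * indicator {x. f x \<le> y} x) \<partial>p)"
    by (intro nn_integral_cong) (auto simp: indicator_def)
  also have "\<dots> \<le> (\<integral>\<^sup>+x. ennreal (?g x) \<partial>p)" using pt by (intro nn_integral_mono ennreal_leI) auto
  also have "\<dots> = ennreal (measure_pmf.expectation p ?g)"
  proof (intro nn_integral_eq_integral int AE_I2)
    show "0 \<le> ?g x" for x by (rule order_trans[OF _ pt]) auto
  qed
  also have "measure_pmf.expectation p ?g = 1 + exp (l * y) * measure_pmf.expectation p (\<lambda>x. huber (f x / y))"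
    using f integrable_huber[OF f(1), of y] by (simp add: Bochner_Integration.integral_add)
  finally show "(\<integral>\<^sup>+x. ennreal (exp (l * f x)) * indicator {x. f x \<le> y} x \<partial>p) \<le>
     ennreal (1 + exp (l * y) * measure_pmf.expectation p (\<lambda>x. huber (f x / y)))" .
qed

text \<open>For steps that are not centred: where \<open>f\<close> is negative the exponential is at
  most one, and on \<open>[0, y]\<close> convexity puts it below the chord. Only the positive part
  of \<open>f\<close> enters, so the left tail may be arbitrarily heavy.\<close>

lemma mgf_bound_onesided:
  fixes f :: "'b \<Rightarrow> real"
  assumes y: "y > 0"
  shows "mgf_bound p f y (measure_pmf.expectation p (\<lambda>x. min (max (f x) 0 / y) 1))"
  unfolding mgf_bound_def
proof (intro allI impI)
  fix l :: real assume l: "l \<ge> 0"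
  let ?h = "\<lambda>x. min (max (f x) 0 / y) 1"
  let ?g = "\<lambda>x. 1 + exp (l * y) * ?h x"
  have h01: "0 \<le> ?h x" "?h x \<le> 1" for x using y by auto
  have inth: "integrable (measure_pmf p) ?h" by (rule integrable_pmf_bounded[where B = 1]) (use h01 in auto)
  have pt: "exp (l * f x) * indicator {x. f x \<le> y} x \<le> ?g x" for x
  proof -
    consider "f x > y" | "0 \<le> f x" "f x \<le> y" | "f x < 0" by linarith
    then show ?thesis
    proof cases
      case 1
      then show ?thesis using h01[of x] by (auto intro!: add_nonneg_nonneg mult_nonneg_nonneg)
    next
      case 2
      have "convex_on UNIV (exp :: real \<Rightarrow> real)" by (rule exp_convex)
      then have "exp ((1 - f x / y) *\<^sub>R 0 + (f x / y) *\<^sub>R (l * y)) \<le> (1 - f x / y) * exp 0 + (f x / y) * exp (l * y)"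
        using 2 y by (intro convex_onD) auto
      moreover have "(1 - f x / y) * exp 0 + (f x / y) * exp (l * y) \<le> 1 + exp (l * y) * (f x / y)"
      proof -
        have "0 \<le> f x / y" using 2 y by simp
        then show ?thesis by (simp only: exp_zero mult_1_right mult.commute[of "exp (l * y)"])
      qed
      moreover have "(1 - f x / y) *\<^sub>R 0 + (f x / y) *\<^sub>R (l * y) = l * f x" "?h x = f x / y"
        using 2 y by auto
      ultimately have "exp (l * f x) \<le> ?g x" by (simp only:)
      then show ?thesis using 2 by (simp add: indicator_def)
    next
      case 3
      then have "exp (l * f x) \<le> 1" using l by (simp add: mult_nonneg_nonpos)
      then show ?thesis using 3 y by (auto simp: indicator_def)
    qed
  qed
  have "(\<integral>\<^sup>+x. ennreal (exp (l * f x)) * indicator {x. f x \<le> y} x \<partial>p)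
      = (\<integral>\<^sup>+x. ennreal (exp (l * f x) * indicator {x. f x \<le> y} x) \<partial>p)"
    by (intro nn_integral_cong) (auto simp: indicator_def)
  also have "\<dots> \<le> (\<integral>\<^sup>+x. ennreal (?g x) \<partial>p)" using pt by (intro nn_integral_mono ennreal_leI) auto
  also have "\<dots> = ennreal (measure_pmf.expectation p ?g)"
  proof (intro nn_integral_eq_integral AE_I2)
    show "0 \<le> ?g x" for x by (rule order_trans[OF _ pt]) auto
  qed (use inth in auto)
  also have "measure_pmf.expectation p ?g = 1 + exp (l * y) * measure_pmf.expectation p ?h"
    using inth by (simp add: Bochner_Integration.integral_add)
  finally show "(\<integral>\<^sup>+x. ennreal (exp (l * f x)) * indicator {x. f x \<le> y} x \<partial>p) \<le>
     ennreal (1 + exp (l * y) * measure_pmf.expectation p ?h)" .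
qed

text \<open>Summation by parts: \<open>F (Z x)\<close> is the sum of the increments of
  \<open>F\<close> below \<open>Z x\<close>, and Tonelli exchanges this sum with the expectation.
  Tail bounds thereby become moment bounds.\<close>

lemma expectation_abel:
  fixes Z :: "'b \<Rightarrow> nat" and F T :: "nat \<Rightarrow> real"
  assumes F0: "F 0 = 0" and mono: "\<And>k. F k \<le> F (Suc k)"
    and T: "\<And>k. measure (measure_pmf p) {x. Z x > k} \<le> T k"
    and sm: "summable (\<lambda>k. (F (Suc k) - F k) * T k)"
  shows "integrable (measure_pmf p) (\<lambda>x. F (Z x))"
    and "measure_pmf.expectation p (\<lambda>x. F (Z x)) \<le> (\<Sum>k. (F (Suc k) - F k) * T k)"
proof -
  let ?d = "\<lambda>k. F (Suc k) - F k"
  have d0: "?d k \<ge> 0" for k using mono[of k] by simp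
  have T0: "T k \<ge> 0" for k by (rule order_trans[OF measure_nonneg T])
  have Fn0: "F n \<ge> 0" for n using mono F0 by (induction n) (auto intro: order_trans)
  have eq: "ennreal (F n) = (\<Sum>k. ennreal (?d k) * indicator {k. k < n} k)" for n
  proof -
    have "(\<Sum>k. ennreal (?d k) * indicator {k. k < n} k) = (\<Sum>k<n. ennreal (?d k) * indicator {k. k < n} k)"
      by (rule suminf_finite) auto
    also have "\<dots> = (\<Sum>k<n. ennreal (?d k))" by (intro sum.cong) auto
    also have "\<dots> = ennreal (\<Sum>k<n. ?d k)" using d0 by (intro sum_ennreal) auto
    also have "(\<Sum>k<n. ?d k) = F n" using F0 by (simp add: sum_lessThan_telescope)
    finally show ?thesis by simp
  qed
  have "(\<integral>\<^sup>+x. ennreal (F (Z x)) \<partial>p) = (\<integral>\<^sup>+x. (\<Sum>k. ennreal (?d k) * indicator {x. k < Z x} x) \<partial>p)"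
    unfolding eq by (intro nn_integral_cong suminf_cong) (auto simp: indicator_def)
  also have "\<dots> = (\<Sum>k. \<integral>\<^sup>+x. ennreal (?d k) * indicator {x. k < Z x} x \<partial>p)"
    by (rule nn_integral_suminf) auto
  also have "\<dots> = (\<Sum>k. ennreal (?d k * measure (measure_pmf p) {x. Z x > k}))"
    using d0 by (intro suminf_cong) (simp add: nn_integral_cmult measure_pmf.emeasure_eq_measure ennreal_mult)
  also have "\<dots> \<le> (\<Sum>k. ennreal (?d k * T k))"
    using d0 T by (intro suminf_le ennreal_leI mult_left_mono) auto
  also have "\<dots> = ennreal (\<Sum>k. ?d k * T k)"
    using d0 T0 sm by (intro suminf_ennreal2) auto
  finally have le: "(\<integral>\<^sup>+x. ennreal (F (Z x)) \<partial>p) \<le> ennreal (\<Sum>k. ?d k * T k)" .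
  show int: "integrable (measure_pmf p) (\<lambda>x. F (Z x))"
  proof (rule integrableI_bounded)
    show "(\<integral>\<^sup>+x. ennreal (norm (F (Z x))) \<partial>p) < \<infinity>" using le Fn0 by (auto simp: less_top[symmetric] top_unique)
  qed auto
  have "ennreal (measure_pmf.expectation p (\<lambda>x. F (Z x))) \<le> ennreal (\<Sum>k. ?d k * T k)"
    using le int Fn0 by (subst nn_integral_eq_integral[symmetric]) auto
  moreover have "(\<Sum>k. ?d k * T k) \<ge> 0" using d0 T0 sm by (intro suminf_nonneg) auto
  ultimately show "measure_pmf.expectation p (\<lambda>x. F (Z x)) \<le> (\<Sum>k. ?d k * T k)"
    by (subst (asm) ennreal_le_iff) auto
qed

section \<open>Power sums and their tails\<close>

lemma powr_step_mvt:
  fixes x e :: real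
  assumes "x > 0"
  shows "\<exists>z>x. z < x + 1 \<and> (x + 1) powr e - x powr e = e * z powr (e - 1)"
proof -
  have "\<exists>z>x. z < x + 1 \<and> (x + 1) powr e - x powr e = (x + 1 - x) * (e * z powr (e - 1))"
    by (rule MVT2) (use assms in \<open>auto intro!: derivative_eq_intros simp: powr_diff\<close>)
  then show ?thesis by auto
qed

text \<open>A partial power sum acquires a logarithm exactly at the exponent one; with this factor
  the boundary indices share their lemmas with the open ranges. The summand \<open>1\<close> keeps
  it at least one for \<open>x \<ge> 1\<close>.\<close>

definition log_corr :: "real \<Rightarrow> real \<Rightarrow> real" where
  "log_corr \<gamma> x = (if \<gamma> = 1 then 1 + ln x else 1)"

lemma log_corr_ge_1: "x \<ge> 1 \<Longrightarrow> log_corr \<gamma> x \<ge> 1"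
  by (simp add: log_corr_def)

lemma log_corr_double: "x \<ge> 1 \<Longrightarrow> y \<ge> 1 \<Longrightarrow> x \<le> 2 * y \<Longrightarrow> log_corr \<gamma> x \<le> 2 * log_corr \<gamma> y"
proof -
  assume a: "x \<ge> 1" "y \<ge> 1" "x \<le> 2 * y"
  then have "ln x \<le> ln 2 + ln y" using ln_le_cancel_iff[of x "2 * y"] by (simp add: ln_mult)
  moreover have "ln 2 \<le> (1::real)" using ln_le_minus_one[of 2] by simp
  moreover have "0 \<le> ln y" using a by simp
  ultimately have "1 + ln x \<le> 2 * (1 + ln y)" by argo
  then show ?thesis using a by (simp add: log_corr_def)
qed

lemma sum_powr_le:
  assumes "0 \<le> \<gamma>" "\<gamma> \<le> 1"
  shows "\<exists>C>0. \<forall>m\<ge>1. (\<Sum>k<m. real (Suc k) powr (-\<gamma>)) \<le> C * real m powr (1 - \<gamma>) * log_corr \<gamma> (real m)"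
proof (cases "\<gamma> = 1")
  case True
  have "(\<Sum>k<m. real (Suc k) powr (-1)) \<le> 1 + ln (real m)" if "m \<ge> 1" for m
    using that
  proof (induction m rule: nat_induct_at_least)
    case base
    then show ?case by simp
  next
    case (Suc m)
    have "ln (real m / real (Suc m)) \<le> real m / real (Suc m) - 1"
      using Suc.hyps by (intro ln_le_minus_one) auto
    then have "inverse (real (Suc m)) \<le> ln (real (Suc m)) - ln (real m)"
      using Suc.hyps by (simp add: ln_div field_simps)
    then show ?case using Suc.IH by (simp add: powr_minus)
  qed
  then show ?thesis using True by (intro exI[of _ 1]) (auto simp: log_corr_def)
next
  case False
  define a where "a = 1 - \<gamma>"
  have a: "0 < a" "a \<le> 1" using assms False unfolding a_def by auto
  have "a * (\<Sum>k<m. real (Suc k) powr (-\<gamma>)) \<le> real m powr a" for m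
  proof (induction m)
    case (Suc m)
    have "a * real (Suc m) powr (-\<gamma>) \<le> real (Suc m) powr a - real m powr a"
    proof (cases "m = 0")
      case True
      then show ?thesis using a by simp
    next
      case False
      then obtain z where z: "z > real m" "z < real m + 1" "(real m + 1) powr a - real m powr a = a * z powr (a - 1)"
        using powr_step_mvt[of "real m" a] by auto
      have "(real m + 1) powr (a - 1) \<le> z powr (a - 1)"
        using z a False by (intro powr_mono2') auto
      then have "a * (real m + 1) powr (a - 1) \<le> (real m + 1) powr a - real m powr a"
        unfolding z(3) using a by (intro mult_left_mono) auto
      then show ?thesis by (simp add: a_def add.commute)
    qed
    then show ?case using Suc by (simp add: distrib_left)
  qed simp
  then have "(\<Sum>k<m. real (Suc k) powr (-\<gamma>)) \<le> 1 / a * real m powr a" for m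
    using a by (simp add: field_simps)
  then show ?thesis using False a unfolding a_def
    by (intro exI[of _ "1 / (1 - \<gamma>)"]) (auto simp: log_corr_def)
qed

lemma tail_powr_le:
  assumes "b > 1" "m > 0"
  shows "summable (\<lambda>k. real (Suc k) powr (-b))"
    and "(\<Sum>k. real (Suc (k + m)) powr (-b)) \<le> 1 / (b - 1) * real m powr (1 - b)"
proof -
  show sm: "summable (\<lambda>k. real (Suc k) powr (-b))"
    using summable_Suc_iff[of "\<lambda>k. real k powr (-b)"] assms by (simp add: summable_real_powr_iff)
  define a where "a = b - 1"
  have a: "a > 0" unfolding a_def using assms by simp
  have step: "a * real (Suc n) powr (-b) \<le> real n powr (-a) - real (Suc n) powr (-a)" if n0: "n > 0" for n
  proof -
    obtain z where z: "z > real n" "z < real n + 1" "(real n + 1) powr (-a) - real n powr (-a) = (-a) * z powr (-a - 1)"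
      using powr_step_mvt[of "real n" "-a"] n0 by auto
    have "(real n + 1) powr (-a - 1) \<le> z powr (-a - 1)"
      using z a n0 by (intro powr_mono2') auto
    then have "a * (real n + 1) powr (-a - 1) \<le> a * z powr (-a - 1)" using a by (intro mult_left_mono) auto
    then have "a * (real n + 1) powr (-a - 1) \<le> real n powr (-a) - (real n + 1) powr (-a)"
      using z(3) by linarith
    then show ?thesis by (simp add: a_def add.commute)
  qed
  have fin: "a * (\<Sum>k<n. real (Suc (k + m)) powr (-b)) \<le> real m powr (-a) - real (n + m) powr (-a)" for n
  proof (induction n)
    case (Suc n)
    then show ?case using step[of "n + m"] assms by (simp add: distrib_left)
  qed simp
  have "(\<Sum>k<n. real (Suc (k + m)) powr (-b)) \<le> 1 / a * real m powr (-a)" for n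
  proof -
    have "a * (\<Sum>k<n. real (Suc (k + m)) powr (-b)) \<le> real m powr (-a)"
      using fin[of n] by (rule order_trans) simp
    then show ?thesis using a by (simp add: field_simps)
  qed
  moreover have "summable (\<lambda>k. real (Suc (k + m)) powr (-b))"
    using summable_ignore_initial_segment[OF sm, of m] by simp
  ultimately have "(\<Sum>k. real (Suc (k + m)) powr (-b)) \<le> 1 / a * real m powr (-a)"
    by (intro suminf_le_const) auto
  then show "(\<Sum>k. real (Suc (k + m)) powr (-b)) \<le> 1 / (b - 1) * real m powr (1 - b)"
    by (simp add: a_def)
qed

text \<open>As \<open>k\<close> grows, \<open>min (k / y) 1\<close> increases by at most
  \<open>1 / y\<close> per step and is constant from \<open>y\<close> on, so summation by parts
  leaves \<open>1 / y\<close> times a partial sum of \<open>k powr (- b)\<close>, critical at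
  \<open>b = 1\<close>.\<close>

lemma truncated_mean_bound:
  fixes Z :: "'b \<Rightarrow> nat"
  assumes T: "\<And>k. measure (measure_pmf p) {x. Z x > k} \<le> C * real (Suc k) powr (-b)" and C: "C > 0"
    and b: "0 < b" "b \<le> 1"
  shows "\<exists>K>0. \<forall>y\<ge>1. measure_pmf.expectation p (\<lambda>x. min (real (Z x) / y) 1) \<le> K * y powr (-b) * log_corr b y"
proof -
  obtain D where D: "D > 0" "\<And>m. m \<ge> 1 \<Longrightarrow> (\<Sum>k<m. real (Suc k) powr (-b)) \<le> D * real m powr (1 - b) * log_corr b (real m)"
    using sum_powr_le[of b] b by auto
  have "measure_pmf.expectation p (\<lambda>x. min (real (Z x) / y) 1) \<le> 4 * C * D * y powr (-b) * log_corr b y"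
    if y: "y \<ge> 1" for y
  proof -
    define m where "m = nat \<lceil>y\<rceil>"
    have m: "real m \<ge> y" "real m \<le> 2 * y" "m \<ge> 1"
      unfolding m_def using y ceiling_correct[of y] by (auto simp: of_nat_nat) linarith
    let ?F = "\<lambda>k::nat. min (real k / y) 1"
    let ?T = "\<lambda>k. C * real (Suc k) powr (-b)"
    have dF: "?F (Suc k) - ?F k \<le> 1 / y" for k using y by (simp add: min_def field_simps)
    have dF0: "?F (Suc k) - ?F k = 0" if "k \<ge> m" for k
      using that m y by (simp add: min_def field_simps)
    have fin: "(\<Sum>k. (?F (Suc k) - ?F k) * ?T k) = (\<Sum>k<m. (?F (Suc k) - ?F k) * ?T k)"
      by (rule suminf_finite) (use dF0 in auto)
    have "measure_pmf.expectation p (\<lambda>x. ?F (Z x)) \<le> (\<Sum>k. (?F (Suc k) - ?F k) * ?T k)"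
    proof (rule expectation_abel(2))
      show "summable (\<lambda>k. (?F (Suc k) - ?F k) * ?T k)"
        by (rule summable_finite[of "{..<m}"]) (use dF0 in auto)
      show "?F k \<le> ?F (Suc k)" for k using y by (intro min.mono divide_right_mono) auto
    qed (use T in auto)
    also have "\<dots> \<le> (\<Sum>k<m. 1 / y * ?T k)"
      unfolding fin using C by (intro sum_mono mult_right_mono dF) auto
    also have "\<dots> = C / y * (\<Sum>k<m. real (Suc k) powr (-b))" by (simp add: sum_distrib_left)
    also have "\<dots> \<le> C / y * (D * real m powr (1 - b) * log_corr b (real m))"
      using C y by (intro mult_left_mono D m) auto
    also have "\<dots> \<le> C / y * (D * (2 * y powr (1 - b)) * (2 * log_corr b y))"
    proof (intro mult_left_mono mult_mono)
      have "real m powr (1 - b) \<le> (2 * y) powr (1 - b)" using m b y by (intro powr_mono2) auto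
      also have "\<dots> = 2 powr (1 - b) * y powr (1 - b)" using y by (simp add: powr_mult)
      also have "\<dots> \<le> 2 powr 1 * y powr (1 - b)" using b by (intro mult_right_mono powr_mono) auto
      finally show "real m powr (1 - b) \<le> 2 * y powr (1 - b)" by simp
      show "log_corr b (real m) \<le> 2 * log_corr b y" using m y by (intro log_corr_double) auto
      show "0 \<le> log_corr b (real m)" using log_corr_ge_1[of "real m" b] m y by linarith
    qed (use C D y in auto)
    also have "\<dots> = 4 * C * D * (y powr (1 - b) / y) * log_corr b y" by simp
    also have "y powr (1 - b) / y = y powr (-b)" using y by (simp add: powr_diff powr_minus field_simps)
    finally show ?thesis .
  qed
  then show ?thesis using C D by (intro exI[of _ "4 * C * D"]) auto
qed

text \<open>The increments of \<open>huber (k / y)\<close> are at most of order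
  \<open>k / y^2\<close> below \<open>y\<close> and at most \<open>1 / y\<close> above. The first
  range gives \<open>y^(-2)\<close> times a partial sum of \<open>k powr (1 - b)\<close>, critical
  at \<open>b = 2\<close>; the second gives \<open>1 / y\<close> times a tail sum of
  \<open>k powr (- b)\<close>.\<close>

lemma huber_moment_bound:
  fixes Z :: "'b \<Rightarrow> nat"
  assumes T: "\<And>k. measure (measure_pmf p) {x. Z x > k} \<le> C * real (Suc k) powr (-b)" and C: "C > 0"
    and b: "1 < b" "b \<le> 2"
  shows "\<exists>K>0. \<forall>y\<ge>1. measure_pmf.expectation p (\<lambda>x. huber (real (Z x) / y)) \<le> K * y powr (-b) * log_corr (b - 1) y"
proof -
  obtain D where D: "D > 0" "\<And>m. m \<ge> 1 \<Longrightarrow> (\<Sum>k<m. real (Suc k) powr (-(b - 1))) \<le> D * real m powr (1 - (b - 1)) * log_corr (b - 1) (real m)"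
    using sum_powr_le[of "b - 1"] b by auto
  define K where "K = 8 * C * D + C / (b - 1)"
  have "measure_pmf.expectation p (\<lambda>x. huber (real (Z x) / y)) \<le> K * y powr (-b) * log_corr (b - 1) y"
    if y: "y \<ge> 1" for y
  proof -
    define m where "m = nat \<lceil>y\<rceil>"
    have m: "real m \<ge> y" "real m \<le> 2 * y" "m \<ge> 1"
      unfolding m_def using y ceiling_correct[of y] by (auto simp: of_nat_nat) linarith
    let ?F = "\<lambda>k::nat. huber (real k / y)"
    let ?T = "\<lambda>k. C * real (Suc k) powr (-b)"
    let ?d = "\<lambda>k. ?F (Suc k) - ?F k"
    have F_mono: "?F k \<le> ?F (Suc k)" for k using y by (intro huber_mono) (auto simp: divide_right_mono)
    have d1: "?d k * ?T k \<le> 2 * C / y\<^sup>2 * real (Suc k) powr (-(b - 1))" if "k < m" for k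
    proof -
      have "real k \<le> y" using that unfolding m_def by linarith
      then have "real k / y \<le> 1" "0 \<le> real k / y" using y by auto
      then have "?F k = (real k / y)\<^sup>2" by (intro huber_small) auto
      then have "?d k \<le> (real (Suc k) / y)\<^sup>2 - (real k / y)\<^sup>2" using huber_le_square[of "real (Suc k) / y"] by simp
      also have "\<dots> = (2 * real k + 1) / y\<^sup>2" using y by (simp add: power2_eq_square field_simps)
      also have "\<dots> \<le> 2 * real (Suc k) / y\<^sup>2" by (intro divide_right_mono) auto
      finally have "?d k * ?T k \<le> 2 * real (Suc k) / y\<^sup>2 * ?T k" using C by (intro mult_right_mono) auto
      also have "\<dots> = 2 * C / y\<^sup>2 * (real (Suc k) * real (Suc k) powr (-b))" by simp
      also have "real (Suc k) * real (Suc k) powr (-b) = real (Suc k) powr (-(b - 1))"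
        using powr_add[of "real (Suc k)" 1 "-b"] by simp
      finally show ?thesis .
    qed
    have d2: "?d k \<le> 1 / y" if "k \<ge> m" for k
    proof -
      have "real k / y \<ge> 1" using that m y by (simp add: field_simps)
      moreover from this have "\<bar>real k / y\<bar> = real k / y" by (intro abs_of_nonneg) auto
      ultimately have "?F k = real k / y" using huber_large[of "real k / y"] by metis
      moreover have "?F (Suc k) \<le> real (Suc k) / y" using y by (simp add: huber_def min.coboundedI2)
      ultimately show ?thesis using y by (simp add: add_divide_distrib)
    qed
    have sT: "summable ?T" using tail_powr_le(1)[of b 1] b by (intro summable_mult) auto
    have sm: "summable (\<lambda>k. ?d k * ?T k)"
    proof (rule summable_comparison_test_ev)
      show "\<forall>\<^sub>F k in sequentially. norm (?d k * ?T k) \<le> 1 / y * ?T k"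
        using eventually_ge_at_top[of m]
      proof eventually_elim
        case (elim k)
        have "norm (?d k * ?T k) = ?d k * ?T k" using F_mono[of k] C by simp
        also have "\<dots> \<le> 1 / y * ?T k" using d2[OF elim] C by (intro mult_right_mono) auto
        finally show ?case .
      qed
      show "summable (\<lambda>k. 1 / y * ?T k)" by (rule summable_mult[OF sT])
    qed
    have "measure_pmf.expectation p (\<lambda>x. ?F (Z x)) \<le> (\<Sum>k. ?d k * ?T k)"
      by (rule expectation_abel(2)[OF _ F_mono T sm]) (simp add: huber_def)
    also have "\<dots> = (\<Sum>k. ?d (k + m) * ?T (k + m)) + (\<Sum>k<m. ?d k * ?T k)"
      by (rule suminf_split_initial_segment[OF sm])
    also have "(\<Sum>k<m. ?d k * ?T k) \<le> (\<Sum>k<m. 2 * C / y\<^sup>2 * real (Suc k) powr (-(b - 1)))"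
      by (intro sum_mono d1) auto
    also have "\<dots> = 2 * C / y\<^sup>2 * (\<Sum>k<m. real (Suc k) powr (-(b - 1)))" by (simp add: sum_distrib_left)
    also have "\<dots> \<le> 2 * C / y\<^sup>2 * (D * real m powr (1 - (b - 1)) * log_corr (b - 1) (real m))"
      using C y by (intro mult_left_mono D m) auto
    also have "\<dots> \<le> 2 * C / y\<^sup>2 * (D * (2 * y powr (2 - b)) * (2 * log_corr (b - 1) y))"
    proof (intro mult_left_mono mult_mono)
      have "real m powr (1 - (b - 1)) \<le> (2 * y) powr (1 - (b - 1))" using m b y by (intro powr_mono2) auto
      also have "\<dots> = 2 powr (2 - b) * y powr (2 - b)" using y by (simp add: powr_mult)
      also have "\<dots> \<le> 2 powr 1 * y powr (2 - b)" using b by (intro mult_right_mono powr_mono) auto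
      finally show "real m powr (1 - (b - 1)) \<le> 2 * y powr (2 - b)" by simp
      show "log_corr (b - 1) (real m) \<le> 2 * log_corr (b - 1) y" using m y by (intro log_corr_double) auto
      show "0 \<le> log_corr (b - 1) (real m)" using log_corr_ge_1[of "real m" "b - 1"] m y by linarith
    qed (use C D y in auto)
    also have "\<dots> = 8 * C * D * (y powr (2 - b) / y\<^sup>2) * log_corr (b - 1) y" by simp
    also have "y powr (2 - b) / y\<^sup>2 = y powr (-b)"
      using y powr_diff[of y "2 - b" 2] by (simp add: powr_numeral)
    finally have part1: "measure_pmf.expectation p (\<lambda>x. ?F (Z x)) \<le>
        (\<Sum>k. ?d (k + m) * ?T (k + m)) + 8 * C * D * y powr (-b) * log_corr (b - 1) y" by simp
    have sTm: "summable (\<lambda>k. ?T (k + m))" by (rule summable_ignore_initial_segment[OF sT])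
    have sTm': "summable (\<lambda>k. real (Suc (k + m)) powr (-b))"
      using summable_ignore_initial_segment[OF tail_powr_le(1)[of b 1], of m] b by simp
    have "(\<Sum>k. ?d (k + m) * ?T (k + m)) \<le> (\<Sum>k. C / y * real (Suc (k + m)) powr (-b))"
    proof (rule suminf_le)
      show "?d (k + m) * ?T (k + m) \<le> C / y * real (Suc (k + m)) powr (-b)" for k
        using mult_right_mono[OF d2[of "k + m"], of "?T (k + m)"] C by simp
      show "summable (\<lambda>k. ?d (k + m) * ?T (k + m))"
        using summable_ignore_initial_segment[OF sm, of m] .
    qed (intro summable_mult sTm')
    also have "\<dots> = C / y * (\<Sum>k. real (Suc (k + m)) powr (-b))" by (rule suminf_mult[OF sTm'])
    also have "\<dots> \<le> C / y * (1 / (b - 1) * real m powr (1 - b))"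
      using C y m b by (intro mult_left_mono tail_powr_le) auto
    also have "\<dots> \<le> C / y * (1 / (b - 1) * y powr (1 - b))"
      using C y m b by (intro mult_left_mono powr_mono2') auto
    also have "\<dots> = C / (b - 1) * (y powr (1 - b) / y)" by simp
    also have "y powr (1 - b) / y = y powr (-b)" using y by (simp add: powr_diff powr_minus field_simps)
    also have "C / (b - 1) * y powr (-b) * 1 \<le> C / (b - 1) * y powr (-b) * log_corr (b - 1) y"
      using C b by (intro mult_left_mono log_corr_ge_1 y) auto
    finally show ?thesis using part1 y unfolding K_def by (simp add: distrib_right)
  qed
  moreover have "K > 0" unfolding K_def using C D b by (simp add: add_pos_pos)
  ultimately show ?thesis by blast
qed

section \<open>Regularly varying point masses\<close>

text \<open>Potter bounds in both directions together with ratio one for neighbouring atoms: the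
  working form of regular variation with index \<open>-\<alpha>\<close>. Exact power laws and laws
  with a slowly varying factor are treated alike through it.\<close>

definition regular_mass :: "(nat \<Rightarrow> real) \<Rightarrow> real \<Rightarrow> bool" where
  "regular_mass r \<alpha> \<longleftrightarrow>
     (\<forall>\<^sub>F t in sequentially. r t > 0) \<and>
     (\<lambda>t. r (Suc t) / r t) \<longlonglongrightarrow> 1 \<and>
     (\<forall>\<delta>>0. \<exists>C>0. \<exists>T>0. \<forall>s\<ge>T. \<forall>t\<ge>s.
        r t \<le> C * (real t / real s) powr (\<delta> - \<alpha>) * r s \<and>
        r s \<le> C * (real t / real s) powr (\<alpha> + \<delta>) * r t)"

lemma regular_mass_pos: "regular_mass r \<alpha> \<Longrightarrow> \<forall>\<^sub>F t in sequentially. r t > 0"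
  by (simp add: regular_mass_def)

lemma regular_massE:
  assumes "regular_mass r \<alpha>" "\<delta> > 0"
  obtains C T where "C > 0" "T > 0"
    "\<And>s t. T \<le> s \<Longrightarrow> s \<le> t \<Longrightarrow> r t \<le> C * (real t / real s) powr (\<delta> - \<alpha>) * r s"
    "\<And>s t. T \<le> s \<Longrightarrow> s \<le> t \<Longrightarrow> r s \<le> C * (real t / real s) powr (\<alpha> + \<delta>) * r t"
    "\<And>t. T \<le> t \<Longrightarrow> r t > 0"
proof -
  obtain C T where 1: "C > 0" "T > 0" "\<And>s t. T \<le> s \<Longrightarrow> s \<le> t \<Longrightarrow>
        r t \<le> C * (real t / real s) powr (\<delta> - \<alpha>) * r s \<and>
        r s \<le> C * (real t / real s) powr (\<alpha> + \<delta>) * r t"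
    using assms unfolding regular_mass_def by meson
  obtain T' where 2: "\<And>t. t \<ge> T' \<Longrightarrow> r t > 0"
    using regular_mass_pos[OF assms(1)] by (auto simp: eventually_sequentially)
  show ?thesis by (rule that[of C "max T T'"]) (use 1 2 in auto)
qed

lemma regular_mass_window:
  assumes r: "regular_mass r \<alpha>" and \<alpha>: "\<alpha> > 0" and \<eta>: "\<eta> > 0"
  shows "\<exists>C>0. \<forall>\<^sub>F t in sequentially. \<forall>k. real k \<ge> \<eta> * real t \<longrightarrow> r k \<le> C * r t"
proof -
  \<comment> \<open>Taking \<open>\<delta> = \<alpha>\<close> turns the first Potter exponent into
    zero, so atoms beyond \<open>t\<close> are at most a constant times \<open>r t\<close>.\<close>
  obtain C T where C: "C > 0" and T: "T > 0"
    and up: "\<And>s t. T \<le> s \<Longrightarrow> s \<le> t \<Longrightarrow> r t \<le> C * (real t / real s) powr (\<alpha> - \<alpha>) * r s"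
    and dn: "\<And>s t. T \<le> s \<Longrightarrow> s \<le> t \<Longrightarrow> r s \<le> C * (real t / real s) powr (\<alpha> + \<alpha>) * r t"
    and pos: "\<And>t. T \<le> t \<Longrightarrow> r t > 0"
    by (rule regular_massE[OF r \<alpha>]) blast
  define C' where "C' = C + C * (1 / \<eta>) powr (\<alpha> + \<alpha>)"
  have "r k \<le> C' * r t" if t: "real t \<ge> real T / \<eta>" "t \<ge> T" and k: "real k \<ge> \<eta> * real t" for t k
  proof -
    have "real T \<le> \<eta> * real t" using t \<eta> by (simp add: field_simps)
    then have kT: "k \<ge> T" using k by linarith
    have r0: "r t > 0" by (rule pos[OF t(2)])
    show ?thesis
    proof (cases "k \<ge> t")
      case True
      have "r k \<le> C * r t" using up[OF t(2) True] T t True by (auto split: if_splits)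
      also have "\<dots> \<le> C' * r t" unfolding C'_def using C r0 by (intro mult_right_mono) auto
      finally show ?thesis .
    next
      case False
      have "real t / real k \<le> 1 / \<eta>" using k \<eta> kT T by (simp add: field_simps)
      then have "(real t / real k) powr (\<alpha> + \<alpha>) \<le> (1 / \<eta>) powr (\<alpha> + \<alpha>)"
        using \<alpha> by (intro powr_mono2) auto
      then have "C * (real t / real k) powr (\<alpha> + \<alpha>) * r t \<le> C * (1 / \<eta>) powr (\<alpha> + \<alpha>) * r t"
        using C r0 by (intro mult_right_mono mult_left_mono) auto
      moreover have "r k \<le> C * (real t / real k) powr (\<alpha> + \<alpha>) * r t" using dn[OF kT] False by simp
      moreover have "C * r t > 0" using C r0 by simp
      ultimately show ?thesis unfolding C'_def by (simp add: distrib_right)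
    qed
  qed
  moreover have "\<forall>\<^sub>F t in sequentially. real t \<ge> real T / \<eta> \<and> t \<ge> T"
    using eventually_ge_at_top[of T] eventually_ge_at_top[of "nat \<lceil>real T / \<eta>\<rceil>"]
    by eventually_elim linarith
  ultimately have "\<forall>\<^sub>F t in sequentially. \<forall>k. real k \<ge> \<eta> * real t \<longrightarrow> r k \<le> C' * r t"
    by (auto elim!: eventually_mono)
  moreover have "C' > 0" unfolding C'_def using C by (simp add: add_pos_nonneg)
  ultimately show ?thesis by blast
qed

lemma regular_mass_lower:
  assumes r: "regular_mass r \<alpha>" and d: "\<delta> > 0"
  shows "\<exists>c>0. \<forall>\<^sub>F t in sequentially. r t \<ge> c * real t powr (- (\<alpha> + \<delta>))"
proof -
  obtain C T where C: "C > 0" and T: "T > 0"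
    and dn: "\<And>s t. T \<le> s \<Longrightarrow> s \<le> t \<Longrightarrow> r s \<le> C * (real t / real s) powr (\<alpha> + \<delta>) * r t"
    and pos: "\<And>t. T \<le> t \<Longrightarrow> r t > 0"
    by (rule regular_massE[OF r d]) blast
  define c where "c = r T * real T powr (\<alpha> + \<delta>) / C"
  have "c * real t powr (- (\<alpha> + \<delta>)) \<le> r t" if t: "t \<ge> T" for t
  proof -
    have "r T \<le> C * (real t powr (\<alpha> + \<delta>) / real T powr (\<alpha> + \<delta>)) * r t"
      using dn[of T t] t by (simp add: powr_divide)
    then show ?thesis unfolding c_def powr_minus_divide using C T t by (simp add: field_simps)
  qed
  moreover have "c > 0" unfolding c_def using C T pos[of T] by simp
  ultimately show ?thesis by (auto simp: eventually_sequentially)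
qed

lemma regular_mass_upper:
  assumes r: "regular_mass r \<alpha>" and d: "\<delta> > 0"
  shows "\<exists>C>0. \<forall>\<^sub>F t in sequentially. r t \<le> C * real t powr (\<delta> - \<alpha>)"
proof -
  obtain C T where C: "C > 0" and T: "T > 0"
    and up: "\<And>s t. T \<le> s \<Longrightarrow> s \<le> t \<Longrightarrow> r t \<le> C * (real t / real s) powr (\<delta> - \<alpha>) * r s"
    and pos: "\<And>t. T \<le> t \<Longrightarrow> r t > 0"
    by (rule regular_massE[OF r d]) blast
  define c where "c = C * real T powr (\<alpha> - \<delta>) * r T"
  have "r t \<le> c * real t powr (\<delta> - \<alpha>)" if t: "t \<ge> T" for t
  proof -
    have "r t \<le> C * (real t powr (\<delta> - \<alpha>) / real T powr (\<delta> - \<alpha>)) * r T"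
      using up[of T t] t by (simp add: powr_divide)
    also have "\<dots> = c * real t powr (\<delta> - \<alpha>)"
      using powr_minus_divide[of "real T" "\<delta> - \<alpha>"] unfolding c_def by simp
    finally show ?thesis .
  qed
  moreover have "c > 0" unfolding c_def using C T pos[of T] by simp
  ultimately show ?thesis by (auto simp: eventually_sequentially)
qed

lemma regular_mass_shift_nat:
  assumes "regular_mass r \<alpha>"
  shows "(\<lambda>t. r (t + k) / r t) \<longlonglongrightarrow> 1"
proof (induction k)
  case 0
  have "\<forall>\<^sub>F t in sequentially. 1 = r (t + 0) / r t"
    using regular_mass_pos[OF assms] by eventually_elim simp
  then show ?case by (rule Lim_transform_eventually[OF tendsto_const])
next
  case (Suc k)
  have "(\<lambda>t. r (Suc t) / r t) \<longlonglongrightarrow> 1" using assms by (simp add: regular_mass_def)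
  from LIMSEQ_ignore_initial_segment[OF this, of k]
  have 1: "(\<lambda>t. r (Suc (t + k)) / r (t + k) * (r (t + k) / r t)) \<longlonglongrightarrow> 1 * 1"
    by (intro tendsto_mult Suc.IH)
  have "\<forall>\<^sub>F t in sequentially. r (t + k) > 0"
    using regular_mass_pos[OF assms] by (rule eventually_all_ge_at_top[THEN eventually_mono]) simp
  then have "\<forall>\<^sub>F t in sequentially. r (Suc (t + k)) / r (t + k) * (r (t + k) / r t) = r (t + Suc k) / r t"
    by eventually_elim simp
  from Lim_transform_eventually[OF 1 this] show ?case by simp
qed

lemma regular_mass_shift:
  assumes r: "regular_mass r \<alpha>"
  shows "(\<lambda>t. r (nat (int t - k)) / r t) \<longlonglongrightarrow> 1"
proof (cases "k \<le> 0")
  case True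
  have "(\<lambda>t. r (t + nat (- k)) / r t) \<longlonglongrightarrow> 1" by (rule regular_mass_shift_nat[OF r])
  moreover have "nat (int t - k) = t + nat (- k)" for t using True by simp
  ultimately show ?thesis by simp
next
  case False
  let ?m = "nat k"
  have "(\<lambda>t. inverse (r (t + ?m) / r t)) \<longlonglongrightarrow> inverse 1"
    by (intro tendsto_inverse regular_mass_shift_nat[OF r]) auto
  then have "(\<lambda>t. r (nat (int (t + ?m) - k)) / r (t + ?m)) \<longlonglongrightarrow> 1"
    using False by simp
  then show ?thesis by (rule LIMSEQ_offset)
qed

section \<open>Convolutions of laws with regularly varying atoms\<close>

lemma expectation_shift_swap:
  fixes p q :: "int pmf" and h :: "int \<Rightarrow> real"
  assumes h: "\<And>k. 0 \<le> h k" "\<And>k. h k \<le> 1"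
  shows "measure_pmf.expectation p (\<lambda>k. pmf q (t - k) * h k) =
    measure_pmf.expectation q (\<lambda>j. pmf p (t - j) * h (t - j))"
proof -
  have b: "\<bar>pmf q' j * h k\<bar> \<le> 1" for q' j k
    using h[of k] pmf_le_1[of q' j] mult_le_one[of "pmf q' j" "h k"] by simp
  have "ennreal (measure_pmf.expectation p (\<lambda>k. pmf q (t - k) * h k)) = (\<integral>\<^sup>+k. ennreal (pmf q (t - k) * h k) \<partial>p)"
    using b h by (intro nn_integral_eq_integral[symmetric] integrable_pmf_bounded) auto
  also have "\<dots> = (\<integral>\<^sup>+k. ennreal (pmf p k) * ennreal (pmf q (t - k) * h k) \<partial>count_space UNIV)"
    by (rule nn_integral_measure_pmf)
  \<comment> \<open>The substitution \<open>k = t - j\<close> on the counting measure, after which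
    \<open>p\<close> and \<open>q\<close> exchange their roles.\<close>
  also have "\<dots> = (\<integral>\<^sup>+j. ennreal (pmf p (t - j)) * ennreal (pmf q (t - (t - j)) * h (t - j)) \<partial>count_space UNIV)"
    by (rule nn_integral_bij_count_space[symmetric]) (auto intro!: bij_betw_byWitness[where f' = "\<lambda>j. t - j"])
  also have "\<dots> = (\<integral>\<^sup>+j. ennreal (pmf q j) * ennreal (pmf p (t - j) * h (t - j)) \<partial>count_space UNIV)"
    using h by (intro nn_integral_cong) (simp flip: ennreal_mult add: mult_ac)
  also have "\<dots> = (\<integral>\<^sup>+j. ennreal (pmf p (t - j) * h (t - j)) \<partial>q)"
    by (rule nn_integral_measure_pmf[symmetric])
  also have "\<dots> = ennreal (measure_pmf.expectation q (\<lambda>j. pmf p (t - j) * h (t - j)))"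
    using b h by (intro nn_integral_eq_integral integrable_pmf_bounded) auto
  finally show ?thesis using h by (subst (asm) ennreal_inj) (auto intro!: integral_nonneg_AE)
qed

text \<open>The cut-off \<open>I\<close> keeps the argument of \<open>g\<close> above \<open>t/2\<close>, where \<open>g\<close> is comparable to \<open>r t\<close>.\<close>

lemma half_convolution_asymp:
  fixes f g :: "int pmf"
  assumes r: "regular_mass r \<alpha>" and \<alpha>: "\<alpha> > 0"
    and g: "(\<lambda>t. pmf g (int t) / r t) \<longlonglongrightarrow> B"
    and I: "\<And>t k. I t k \<Longrightarrow> 2 * k \<le> int t" "\<And>k. \<forall>\<^sub>F t in sequentially. I t k"
  shows "(\<lambda>t. measure_pmf.expectation f (\<lambda>k. pmf g (int t - k) * of_bool (I t k)) / r t) \<longlonglongrightarrow> B"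
proof -
  obtain C where C: "C > 0" "\<forall>\<^sub>F t in sequentially. \<forall>k. real k \<ge> 1/2 * real t \<longrightarrow> r k \<le> C * r t"
    using regular_mass_window[OF r \<alpha>, of "1/2"] by auto
  obtain D where D: "D > 0" "\<And>t. \<bar>pmf g (int t) / r t\<bar> \<le> D"
    using convergent_imp_Bseq[OF convergentI[OF g]] unfolding Bseq_def by auto
  have pos2: "\<forall>\<^sub>F t in sequentially. \<forall>k. real k \<ge> 1/2 * real t \<longrightarrow> r k > 0"
  proof -
    obtain T where "\<And>t. t \<ge> T \<Longrightarrow> r t > 0"
      using regular_mass_pos[OF r] by (auto simp: eventually_sequentially)
    then have "\<forall>t\<ge>2 * T. \<forall>k. real k \<ge> 1/2 * real t \<longrightarrow> r k > 0" by force
    then show ?thesis by (auto simp: eventually_sequentially)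
  qed
  have "\<forall>\<^sub>F t in sequentially. (\<forall>k. real k \<ge> 1/2 * real t \<longrightarrow> r k \<le> C * r t) \<and>
      (\<forall>k. real k \<ge> 1/2 * real t \<longrightarrow> r k > 0)"
    using C(2) pos2 by eventually_elim blast
  then obtain T where T: "\<And>t k. t \<ge> T \<Longrightarrow> real k \<ge> 1/2 * real t \<Longrightarrow> r k \<le> C * r t \<and> r k > 0"
    by (auto simp: eventually_sequentially)
  let ?h = "\<lambda>t k. pmf g (int t - k) * of_bool (I t k) / r t"
  have bound: "\<bar>?h t k\<bar> \<le> D * C" if t: "t \<ge> T" for t k
  proof (cases "I t k")
    case True
    then have k: "2 * k \<le> int t" by (rule I(1))
    define m where "m = nat (int t - k)"
    have im: "int t - k = int m" unfolding m_def using k by simp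
    have m: "real m \<ge> 1/2 * real t" using k im by linarith
    have rm: "r m \<le> C * r t" "r m > 0" using T[OF t m] by auto
    have rt: "r t > 0" using T[OF t, of t] by auto
    have "pmf g (int m) \<le> D * r m" using D(2)[of m] rm by (simp add: field_simps)
    also have "\<dots> \<le> D * (C * r t)" using D rm by (intro mult_left_mono) auto
    finally have "pmf g (int m) / r t \<le> D * C" using rt by (simp add: field_simps)
    then show ?thesis using True rt im by simp
  next
    case False
    then show ?thesis using C D by simp
  qed
  have lim: "(\<lambda>t. ?h t k) \<longlonglongrightarrow> B" for k
  proof -
    have "filterlim (\<lambda>t. nat (int t - k)) at_top sequentially"
    proof (subst filterlim_at_top, intro allI)
      fix Z :: nat
      show "\<forall>\<^sub>F t in sequentially. Z \<le> nat (int t - k)"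
        using eventually_ge_at_top[of "nat (int Z + \<bar>k\<bar>)"] by eventually_elim linarith
    qed
    from filterlim_compose[OF g this]
    have "(\<lambda>t. pmf g (int (nat (int t - k))) / r (nat (int t - k)) * (r (nat (int t - k)) / r t)) \<longlonglongrightarrow> B * 1"
      by (intro tendsto_mult regular_mass_shift[OF r])
    moreover have "\<forall>\<^sub>F t in sequentially.
        pmf g (int (nat (int t - k))) / r (nat (int t - k)) * (r (nat (int t - k)) / r t) = ?h t k"
      using I(2)[of k] eventually_ge_at_top[of T]
    proof eventually_elim
      case (elim t)
      have k: "2 * k \<le> int t" by (rule I(1)[OF elim(1)])
      have "r (nat (int t - k)) > 0" using T[OF elim(2), of "nat (int t - k)"] k by linarith
      then show ?case using elim k by simp
    qed
    ultimately show ?thesis using Lim_transform_eventually by force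
  qed
  \<comment> \<open>The shift by \<open>T\<close> makes the bound valid at every index, as dominated
    convergence asks; \<open>LIMSEQ_offset\<close> undoes it.\<close>
  have "(\<lambda>t. measure_pmf.expectation f (?h (t + T))) \<longlonglongrightarrow> measure_pmf.expectation f (\<lambda>_. B)"
  proof (rule integral_dominated_convergence[where w = "\<lambda>_. D * C"])
    show "AE k in f. norm (?h (t + T) k) \<le> D * C" for t
      by (rule AE_I2) (unfold real_norm_def, rule bound, simp)
    show "AE k in f. (\<lambda>t. ?h (t + T) k) \<longlonglongrightarrow> B"
      by (rule AE_I2) (rule LIMSEQ_ignore_initial_segment[OF lim])
  qed auto
  then have "(\<lambda>t. measure_pmf.expectation f (?h (t + T))) \<longlonglongrightarrow> B"
    by simp
  then have "(\<lambda>t. measure_pmf.expectation f (?h t)) \<longlonglongrightarrow> B"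
    by (rule LIMSEQ_offset)
  then show ?thesis by simp
qed

text \<open>If \<open>n + 1\<close> steps sum to \<open>t\<close>, either the added step is at most
  \<open>t / 2\<close>, and the other \<open>n\<close> steps supply the large value and contribute
  \<open>n\<close>; or the added step exceeds \<open>t / 2\<close>, is itself the large value and
  contributes \<open>1\<close>. The tie \<open>2 * k = t\<close> belongs to the first case.\<close>

lemma walk_asymp:
  assumes r: "regular_mass (\<lambda>t. pmf p (int t)) \<alpha>" and \<alpha>: "\<alpha> > 0"
  shows "(\<lambda>t. pmf (walk p n) (int t) / pmf p (int t)) \<longlonglongrightarrow> real n"
proof (induction n)
  case 0
  have "\<forall>\<^sub>F t in sequentially. 0 = pmf (walk p 0) (int t) / pmf p (int t)"
    using eventually_gt_at_top[of 0] by eventually_elim (simp add: walk_0)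
  from Lim_transform_eventually[OF tendsto_const this] show ?case by simp
next
  case (Suc n)
  let ?w = "walk p n" and ?r = "\<lambda>t. pmf p (int t)"
  have 1: "(\<lambda>t. ?r t / ?r t) \<longlonglongrightarrow> 1" using regular_mass_shift_nat[OF r, of 0] by simp
  have ev: "\<forall>\<^sub>F t in sequentially. 2 * k < int t" for k :: int
    using eventually_gt_at_top[of "nat (2 * \<bar>k\<bar>)"] by eventually_elim linarith
  have ev': "\<forall>\<^sub>F t in sequentially. 2 * k \<le> int t" for k :: int
    by (rule eventually_mono[OF ev[of k]]) simp
  have A: "(\<lambda>t. measure_pmf.expectation p (\<lambda>k. pmf ?w (int t - k) * of_bool (2 * k \<le> int t)) / ?r t) \<longlonglongrightarrow> real n"
    using half_convolution_asymp[OF r \<alpha> Suc.IH, where I = "\<lambda>t k. 2 * k \<le> int t"] ev' by blast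
  have B: "(\<lambda>t. measure_pmf.expectation ?w (\<lambda>k. pmf p (int t - k) * of_bool (2 * k < int t)) / ?r t) \<longlonglongrightarrow> 1"
    using half_convolution_asymp[OF r \<alpha> 1, where I = "\<lambda>t k. 2 * k < int t"] ev less_imp_le by blast
  have "pmf (walk p (Suc n)) (int t) =
      measure_pmf.expectation p (\<lambda>k. pmf ?w (int t - k) * of_bool (2 * k \<le> int t)) +
      measure_pmf.expectation ?w (\<lambda>k. pmf p (int t - k) * of_bool (2 * k < int t))" for t
  proof -
    have b: "\<bar>pmf ?w j * of_bool P\<bar> \<le> 1" for j P by (simp add: pmf_le_1)
    have "pmf (walk p (Suc n)) (int t) = measure_pmf.expectation p (\<lambda>k.
        pmf ?w (int t - k) * of_bool (2 * k \<le> int t) + pmf ?w (int t - k) * of_bool (2 * k > int t))"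
      unfolding pmf_walk_Suc by (intro Bochner_Integration.integral_cong) auto
    also have "\<dots> = measure_pmf.expectation p (\<lambda>k. pmf ?w (int t - k) * of_bool (2 * k \<le> int t)) +
       measure_pmf.expectation p (\<lambda>k. pmf ?w (int t - k) * of_bool (2 * k > int t))"
      by (intro Bochner_Integration.integral_add integrable_pmf_bounded[OF b])
    also have "measure_pmf.expectation p (\<lambda>k. pmf ?w (int t - k) * of_bool (2 * k > int t)) =
      measure_pmf.expectation ?w (\<lambda>k. pmf p (int t - k) * of_bool (2 * (int t - k) > int t))"
      by (rule expectation_shift_swap) auto
    also have "(\<lambda>k. pmf p (int t - k) * of_bool (2 * (int t - k) > int t)) =
        (\<lambda>k. pmf p (int t - k) * of_bool (2 * k < int t))"
      by (intro ext arg_cong2[where f = "(*)"] arg_cong[where f = of_bool]) auto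
    finally show ?thesis .
  qed
  then have "(\<lambda>t. pmf (walk p (Suc n)) (int t) / ?r t) =
     (\<lambda>t. measure_pmf.expectation p (\<lambda>k. pmf ?w (int t - k) * of_bool (2 * k \<le> int t)) / ?r t +
      measure_pmf.expectation ?w (\<lambda>k. pmf p (int t - k) * of_bool (2 * k < int t)) / ?r t)"
    by (simp add: add_divide_distrib)
  then show ?case using tendsto_add[OF A B] by (simp add: add.commute)
qed

text \<open>\<open>w\<close> is split into its minimum with \<open>C' * n * r\<close> and an excess.
  The first part divided by \<open>r\<close> is dominated by \<open>C' * n\<close>, which is
  integrable since \<open>\<nu>\<close> has a mean; the excess is at most \<open>R\<close>.\<close>

lemma random_walk_ratio_limit:
  assumes \<nu>: "integrable (measure_pmf \<nu>) real"
    and r: "\<And>t. r t \<ge> 0" "\<forall>\<^sub>F t in sequentially. r t > 0"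
    and w: "\<And>n t. 0 \<le> w n t" "\<And>n t. w n t \<le> 1" "\<And>n. (\<lambda>t. w n t / r t) \<longlonglongrightarrow> real n"
    and bound: "\<forall>\<^sub>F t in sequentially. \<forall>n. w n t \<le> C * real n * r t + R n t"
    and R: "\<And>n t. 0 \<le> R n t" "\<And>t. integrable (measure_pmf \<nu>) (\<lambda>n. R n t)"
      "(\<lambda>t. measure_pmf.expectation \<nu> (\<lambda>n. R n t) / r t) \<longlonglongrightarrow> 0"
  shows "(\<lambda>t. measure_pmf.expectation \<nu> (\<lambda>n. w n t) / r t) \<longlonglongrightarrow> measure_pmf.expectation \<nu> real"
proof -
  \<comment> \<open>At least one, so that the cut at \<open>C' * n\<close> does not alter the limit
    \<open>n\<close>.\<close>
  define C' where "C' = max C 1"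
  define v where "v t n = min (w n t) (C' * real n * r t) / r t" for t n
  have C': "C' \<ge> 1" "C \<le> C'" by (auto simp: C'_def)
  have vlim: "(\<lambda>t. v t n) \<longlonglongrightarrow> real n" for n
  proof -
    have "(\<lambda>t. min (w n t / r t) (C' * real n)) \<longlonglongrightarrow> min (real n) (C' * real n)"
      by (intro tendsto_min w tendsto_const)
    moreover have "min (real n) (C' * real n) = real n" using mult_right_mono[OF C'(1), of "real n"] by simp
    moreover have "\<forall>\<^sub>F t in sequentially. min (w n t / r t) (C' * real n) = v t n"
      using r(2) by eventually_elim (simp add: v_def min_def field_simps)
    ultimately show ?thesis using Lim_transform_eventually[of _ "min (real n) (C' * real n)"] by force
  qed
  have v0: "0 \<le> v t n" for t n unfolding v_def using w r C' by simp
  have vb: "v t n \<le> C' * real n" for t n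
    using r(1)[of t] C' unfolding v_def by (cases "r t = 0") (auto simp: divide_le_eq)
  have vint: "integrable (measure_pmf \<nu>) (v t)" for t
    by (rule Bochner_Integration.integrable_bound[where f = "\<lambda>n. C' * real n"])
       (use \<nu> v0 vb C' in auto)
  have wint: "integrable (measure_pmf \<nu>) (\<lambda>n. w n t)" for t
    by (rule integrable_pmf_bounded[where B = 1]) (use w in auto)
  have V: "(\<lambda>t. measure_pmf.expectation \<nu> (v t)) \<longlonglongrightarrow> measure_pmf.expectation \<nu> real"
    by (rule integral_dominated_convergence[where w = "\<lambda>n. C' * real n"]) (use \<nu> vlim v0 vb in auto)
  have D: "(\<lambda>t. measure_pmf.expectation \<nu> (\<lambda>n. w n t) / r t - measure_pmf.expectation \<nu> (v t)) \<longlonglongrightarrow> 0"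
  proof (rule tendsto_sandwich[OF _ _ tendsto_const R(3)])
    have eq: "measure_pmf.expectation \<nu> (\<lambda>n. w n t) / r t - measure_pmf.expectation \<nu> (v t) =
       measure_pmf.expectation \<nu> (\<lambda>n. w n t / r t - v t n)" for t
      using wint vint by (simp add: Bochner_Integration.integral_diff)
    have "w n t / r t - v t n \<ge> 0" for n t
      unfolding v_def using r(1)[of t] by (simp add: divide_right_mono)
    then show "\<forall>\<^sub>F t in sequentially. 0 \<le> measure_pmf.expectation \<nu> (\<lambda>n. w n t) / r t - measure_pmf.expectation \<nu> (v t)"
      unfolding eq by (intro always_eventually allI integral_nonneg_AE) auto
    show "\<forall>\<^sub>F t in sequentially. measure_pmf.expectation \<nu> (\<lambda>n. w n t) / r t - measure_pmf.expectation \<nu> (v t)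
        \<le> measure_pmf.expectation \<nu> (\<lambda>n. R n t) / r t"
      using bound r(2)
    proof eventually_elim
      case (elim t)
      have pt: "w n t / r t - v t n \<le> R n t / r t" for n
      proof -
        have "w n t \<le> C * real n * r t + R n t" using elim by blast
        also have "C * real n * r t \<le> C' * real n * r t" using C' elim by (intro mult_right_mono) auto
        finally have "w n t - min (w n t) (C' * real n * r t) \<le> R n t" using R(1)[of n t] by linarith
        then show ?thesis unfolding v_def using elim by (simp add: divide_right_mono flip: diff_divide_distrib)
      qed
      have "measure_pmf.expectation \<nu> (\<lambda>n. w n t / r t - v t n) \<le> measure_pmf.expectation \<nu> (\<lambda>n. R n t / r t)"
        by (intro integral_mono pt) (use wint vint R in auto)
      then show ?case unfolding eq by simp
    qed
  qed
  show ?thesis using tendsto_add[OF D V] by simp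
qed

section \<open>Reduction to probability mass functions\<close>

lemma countable_prob_space_pmf:
  fixes D :: "'b::countable measure"
  assumes "prob_space D" "sets D = UNIV"
  shows "\<exists>q. measure_pmf q = D"
proof -
  interpret D: prob_space D by fact
  let ?Z = "{x. measure D {x} = 0}"
  have "(\<Union>x\<in>?Z. {x}) \<in> null_sets D"
    by (rule null_sets_UN') (auto simp: assms(2) D.emeasure_eq_measure)
  then have "AE x in D. measure D {x} \<noteq> 0"
    by (rule AE_I') auto
  then have "measure_pmf (Abs_pmf D) = D" using assms by (intro Abs_pmf_inverse) auto
  then show ?thesis by blast
qed

context random_sum
begin

lemma measurable_X: "i \<ge> 1 \<Longrightarrow> X i \<in> measurable M (count_space UNIV)"
  using indep_X unfolding indep_vars_def by auto

lemma measurable_real_X [measurable]: "i \<ge> 1 \<Longrightarrow> (\<lambda>\<omega>. real_of_int (X i \<omega>)) \<in> borel_measurable M"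
  using measurable_X[of i] by simp

lemma step_pmf: "\<exists>p. measure_pmf p = distr M (count_space UNIV) (X 1)"
  by (rule countable_prob_space_pmf) (auto intro!: prob_space_distr measurable_X)

lemma count_pmf: "\<exists>q. measure_pmf q = distr M (count_space UNIV) N"
  by (rule countable_prob_space_pmf) (auto intro: prob_space_distr measurable_N)

text \<open>The sum is formed in the reals and brought back to the integers by \<open>floor\<close>,
  a measurable map and hence harmless for independence.\<close>

lemma indep_next_partial_sum:
  "indep_var (count_space UNIV) (X (Suc n)) (count_space UNIV) (\<lambda>\<omega>. \<Sum>i=1..n. X i \<omega>)"
proof -
  have "indep_vars (\<lambda>_. count_space UNIV) X (insert (Suc n) {1..n})"
    by (rule indep_vars_subset[OF indep_X]) auto
  then have "indep_vars (\<lambda>_. borel) (\<lambda>i \<omega>. real_of_int (X i \<omega>)) (insert (Suc n) {1..n})"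
    by (rule indep_vars_compose2) auto
  then have "indep_var borel (\<lambda>\<omega>. real_of_int (X (Suc n) \<omega>)) borel (\<lambda>\<omega>. \<Sum>i=1..n. real_of_int (X i \<omega>))"
    by (intro indep_vars_sum) auto
  from indep_var_compose[OF this measurable_real_floor measurable_real_floor]
  show ?thesis by (simp add: comp_def flip: of_int_sum)
qed

lemma distr_partial_sum:
  assumes p: "measure_pmf p = distr M (count_space UNIV) (X 1)"
  shows "distr M (count_space UNIV) (\<lambda>\<omega>. \<Sum>i=1..n. X i \<omega>) = measure_pmf (walk p n)"
proof (induction n)
  case 0
  show ?case
  proof (rule measure_eqI)
    fix A :: "int set"
    show "emeasure (distr M (count_space UNIV) (\<lambda>\<omega>. \<Sum>i=1..0. X i \<omega>)) A = emeasure (measure_pmf (walk p 0)) A"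
      by (subst emeasure_distr) (auto simp: walk_0 emeasure_space_1 indicator_def vimage_def)
  qed auto
next
  case (Suc n)
  let ?S = "\<lambda>n \<omega>. \<Sum>i=1..n. X i \<omega>" and ?C = "count_space UNIV :: int measure"
  have ms: "?S n \<in> measurable M ?C" for n
  proof -
    have "(\<lambda>\<omega>. \<lfloor>\<Sum>i=1..n. real_of_int (X i \<omega>)\<rfloor>) \<in> measurable M ?C"
      by (rule measurable_compose[OF _ measurable_real_floor]) auto
    then show ?thesis by (simp flip: of_int_sum)
  qed
  have XS: "X (Suc n) \<in> measurable M ?C" by (rule measurable_X) simp
  have dist: "distr M (?C \<Otimes>\<^sub>M ?C) (\<lambda>\<omega>. (X (Suc n) \<omega>, ?S n \<omega>)) = measure_pmf p \<Otimes>\<^sub>M measure_pmf (walk p n)"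
    using indep_next_partial_sum[of n] ident_X[of "Suc n"] unfolding indep_var_distribution_eq p Suc.IH by simp
  have mpair: "(\<lambda>\<omega>. (X (Suc n) \<omega>, ?S n \<omega>)) \<in> measurable M (?C \<Otimes>\<^sub>M ?C)"
    by (rule measurable_Pair[OF XS ms])
  show ?case
  proof (rule measure_eqI)
    fix A :: "int set"
    let ?Z = "{ab. fst ab + snd ab \<in> A}"
    have Z: "?Z \<in> sets (?C \<Otimes>\<^sub>M ?C)"
      by (subst pair_measure_countable) auto
    have Z': "?Z \<in> sets (measure_pmf p \<Otimes>\<^sub>M measure_pmf (walk p n))"
      using Z by (metis dist sets_distr)
    have "emeasure (distr M ?C (?S (Suc n))) A = emeasure M (?S (Suc n) -` A \<inter> space M)"
      by (rule emeasure_distr[OF ms]) auto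
    also have "?S (Suc n) -` A \<inter> space M = (\<lambda>\<omega>. (X (Suc n) \<omega>, ?S n \<omega>)) -` ?Z \<inter> space M"
      by (auto simp: add.commute)
    also have "emeasure M \<dots> = emeasure (distr M (?C \<Otimes>\<^sub>M ?C) (\<lambda>\<omega>. (X (Suc n) \<omega>, ?S n \<omega>))) ?Z"
      by (rule emeasure_distr[OF mpair Z, symmetric])
    also have "\<dots> = (\<integral>\<^sup>+a. emeasure (walk p n) (Pair a -` ?Z) \<partial>p)"
      unfolding dist by (rule sigma_finite_measure.emeasure_pair_measure_alt[OF _ Z']) unfold_locales
    also have "\<dots> = emeasure (walk p (Suc n)) A"
      using walk_add[of p 1 n] unfolding walk_1 by (simp add: vimage_def)
    finally show "emeasure (distr M ?C (?S (Suc n))) A = emeasure (measure_pmf (walk p (Suc n))) A" .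
  qed auto
qed

lemma prob_random_sum:
  assumes p: "measure_pmf p = distr M (count_space UNIV) (X 1)"
    and q: "measure_pmf q = distr M (count_space UNIV) N"
  shows "\<P>(\<omega> in M. random_sum_value X N \<omega> = t) = measure_pmf.expectation q (\<lambda>n. pmf (walk p n) t)"
proof -
  let ?A = "\<lambda>n. {\<omega>\<in>space M. N \<omega> = n}" and ?B = "\<lambda>n. {\<omega>\<in>space M. (\<Sum>i=1..n. X i \<omega>) = t}"
  have A: "?A n \<in> sets M" for n
    using measurable_sets[OF measurable_N, of "{n}"] by (simp add: vimage_def Int_def conj_commute)
  have pA: "emeasure M (?A n) = ennreal (pmf q n)" for n
  proof -
    have "ennreal (pmf q n) = emeasure (distr M (count_space UNIV) N) {n}"
      unfolding q[symmetric] by (simp add: emeasure_pmf_single)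
    also have "\<dots> = emeasure M (?A n)"
      by (subst emeasure_distr[OF measurable_N]) (auto intro!: arg_cong[where f = "emeasure M"])
    finally show ?thesis by simp
  qed
  have ms: "(\<lambda>\<omega>. \<Sum>i=1..n. X i \<omega>) \<in> measurable M (count_space UNIV)" for n
    using indep_next_partial_sum[of n] by (auto dest: indep_var_rv2)
  have pB: "emeasure M (?B n) = ennreal (pmf (walk p n) t)" for n
  proof -
    have "ennreal (pmf (walk p n) t) = emeasure (distr M (count_space UNIV) (\<lambda>\<omega>. \<Sum>i=1..n. X i \<omega>)) {t}"
      unfolding distr_partial_sum[OF p] by (simp add: emeasure_pmf_single)
    also have "\<dots> = emeasure M (?B n)"
      by (subst emeasure_distr[OF ms]) (auto intro!: arg_cong[where f = "emeasure M"])
    finally show ?thesis by simp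
  qed
  \<comment> \<open>The event that the first \<open>n\<close> steps sum to \<open>t\<close> belongs
    to the sigma-algebra of the whole sequence, so the joint independence of \<open>N\<close> and
    the sequence applies for each fixed \<open>n\<close>.\<close>
  have AB: "prob (?A n \<inter> ?B n) = prob (?A n) * prob (?B n)" for n
  proof (rule indep_setD[OF indep_N_X])
    have "N -` {n} \<inter> space M \<in> sets (vimage_algebra (space M) N (count_space UNIV))"
      by (rule in_vimage_algebra) auto
    then show "?A n \<in> sets (vimage_algebra (space M) N (count_space UNIV))"
      by (simp add: vimage_def Int_def conj_commute)
    let ?P = "\<Pi>\<^sub>M i\<in>{1..}. count_space UNIV :: int measure" and ?f = "\<lambda>\<omega>. \<lambda>i\<in>{1..}. X i \<omega>"
    have "(\<lambda>g. real_of_int (\<Sum>i=1..n. g i)) \<in> borel_measurable ?P"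
      unfolding of_int_sum
    proof (intro borel_measurable_sum)
      fix i assume "i \<in> {1..n}"
      then have "(\<lambda>g. g i) \<in> measurable ?P (count_space UNIV)"
        by (intro measurable_component_singleton) auto
      then show "(\<lambda>g. real_of_int (g i)) \<in> borel_measurable ?P" by simp
    qed
    from measurable_sets[OF this, of "{real_of_int t}"]
    have "{g\<in>space ?P. (\<Sum>i=1..n. g i) = t} \<in> sets ?P"
      by (simp add: vimage_def Int_def conj_commute del: of_int_sum)
    then have "?f -` {g\<in>space ?P. (\<Sum>i=1..n. g i) = t} \<inter> space M \<in> sets (vimage_algebra (space M) ?f ?P)"
      by (rule in_vimage_algebra)
    also have "?f -` {g\<in>space ?P. (\<Sum>i=1..n. g i) = t} \<inter> space M = {\<omega>\<in>space M. (\<Sum>i=1..n. ?f \<omega> i) = t}"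
      by (auto simp: space_PiM simp del: restrict_apply)
    also have "\<dots> = ?B n"
    proof -
      have "(\<Sum>i=1..n. ?f \<omega> i) = (\<Sum>i=1..n. X i \<omega>)" for \<omega> by (rule sum.cong) auto
      then show ?thesis by (simp only:)
    qed
    finally show "?B n \<in> sets (vimage_algebra (space M) ?f ?P)" .
  qed
  have "emeasure M {\<omega>\<in>space M. random_sum_value X N \<omega> = t} = emeasure M (\<Union>n. ?A n \<inter> ?B n)"
    by (intro arg_cong[where f = "emeasure M"]) (auto simp: random_sum_value_def)
  also have "\<dots> = (\<Sum>n. emeasure M (?A n \<inter> ?B n))"
  proof (rule suminf_emeasure[symmetric])
    have "?B n \<in> sets M" for n
      using measurable_sets[OF ms, of "{t}"] by (simp add: vimage_def Int_def conj_commute)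
    then show "range (\<lambda>n. ?A n \<inter> ?B n) \<subseteq> sets M" using A by auto
  qed (auto simp: disjoint_family_on_def)
  also have "\<dots> = (\<Sum>n. ennreal (pmf q n) * ennreal (pmf (walk p n) t))"
    unfolding pA[symmetric] pB[symmetric] emeasure_eq_measure AB by (simp only: ennreal_mult measure_nonneg)
  also have "\<dots> = (\<integral>\<^sup>+n. ennreal (pmf (walk p n) t) \<partial>q)"
    by (simp add: nn_integral_measure_pmf nn_integral_count_space_nat)
  also have "\<dots> = ennreal (measure_pmf.expectation q (\<lambda>n. pmf (walk p n) t))"
    by (intro nn_integral_eq_integral integrable_pmf_bounded[where B = 1]) (auto simp: pmf_le_1)
  finally show ?thesis by (simp add: emeasure_eq_measure integral_nonneg_AE)
qed

end

section \<open>Slowly varying functions\<close>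

text \<open>
  If uniformity failed along \<open>x\<^sub>n + u\<^sub>n\<close>, then the shifts that are good for \<open>x\<^sub>n\<close> and those that are
  good for \<open>x\<^sub>n + u\<^sub>n\<close> would eventually fill most of \<open>[0, 2]\<close> and \<open>[0, 1]\<close>; for measure reasons
  they have a point in common after translation, which contradicts the choice of \<open>u\<^sub>n\<close>.
\<close>

lemma uniform_convergence_additive:
  fixes h :: "real \<Rightarrow> real"
  assumes meas [measurable]: "h \<in> borel_measurable borel"
    and lim: "\<And>u. ((\<lambda>x. h (x + u) - h x) \<longlongrightarrow> 0) at_top" and e: "\<epsilon> > 0"
  shows "\<exists>x0. \<forall>x\<ge>x0. \<forall>u\<in>{0..1}. \<bar>h (x + u) - h x\<bar> \<le> \<epsilon>"
proof (rule ccontr)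
  assume "\<not> ?thesis"
  then have "\<forall>n::nat. \<exists>x u. x \<ge> real n \<and> u \<in> {0..1} \<and> \<bar>h (x + u) - h x\<bar> > \<epsilon>"
    by (metis not_le)
  then obtain x u where x: "\<And>n::nat. x n \<ge> real n" and u: "\<And>n. u n \<in> {0..1}"
    and big: "\<And>n. \<bar>h (x n + u n) - h (x n)\<bar> > \<epsilon>" by metis
  define A where "A n = {v\<in>{0..2}. \<forall>m\<ge>n. \<bar>h (x m + v) - h (x m)\<bar> \<le> \<epsilon> / 2}" for n
  define B where "B n = {w\<in>{0..1}. \<forall>m\<ge>n. \<bar>h (x m + u m + w) - h (x m + u m)\<bar> \<le> \<epsilon> / 2}" for n
  have sets: "A n \<in> sets lborel" "B n \<in> sets lborel" for n
    unfolding A_def B_def by measurable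
  have inc: "incseq A" "incseq B" unfolding A_def B_def incseq_def by auto
  have xlim: "filterlim x at_top sequentially"
    by (rule filterlim_at_top_mono[OF filterlim_real_sequentially]) (use x in auto)
  have xulim: "filterlim (\<lambda>n. x n + u n) at_top sequentially"
    by (rule filterlim_at_top_mono[OF xlim]) (use u in auto)
  have ev: "\<exists>n. \<forall>m\<ge>n. \<bar>h (y m + v) - h (y m)\<bar> \<le> \<epsilon> / 2" if y: "filterlim y at_top sequentially" for y v
  proof -
    have "(\<lambda>n. h (y n + v) - h (y n)) \<longlonglongrightarrow> 0" by (rule filterlim_compose[OF lim y])
    then have "\<forall>\<^sub>F n in sequentially. dist (h (y n + v) - h (y n)) 0 < \<epsilon> / 2"
      using e by (intro tendstoD) auto
    then have "\<forall>\<^sub>F n in sequentially. \<bar>h (y n + v) - h (y n)\<bar> \<le> \<epsilon> / 2"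
      by eventually_elim (simp add: dist_real_def)
    then show ?thesis by (simp add: eventually_sequentially)
  qed
  have UA: "(\<Union>n. A n) = {0..2}" unfolding A_def using ev[OF xlim] by auto
  have UB: "(\<Union>n. B n) = {0..1}" unfolding B_def using ev[OF xulim] by auto
  have "(\<lambda>n. emeasure lborel (A n)) \<longlonglongrightarrow> emeasure lborel (\<Union>n. A n)"
    by (rule Lim_emeasure_incseq) (use sets inc in auto)
  then have "(\<lambda>n. emeasure lborel (A n)) \<longlonglongrightarrow> ennreal 2" unfolding UA by simp
  \<comment> \<open>The thresholds satisfy \<open>7/4 + 1/2 > 2\<close>, while \<open>A n\<close>
    and the translate of \<open>B n\<close> by \<open>u n\<close> both lie in \<open>[0, 2]\<close>;
    hence these two sets must meet.\<close>
  then have evA: "\<forall>\<^sub>F n in sequentially. emeasure lborel (A n) > ennreal (7/4)"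
    by (rule order_tendstoD) (simp add: ennreal_less_iff)
  have "(\<lambda>n. emeasure lborel (B n)) \<longlonglongrightarrow> emeasure lborel (\<Union>n. B n)"
    by (rule Lim_emeasure_incseq) (use sets inc in auto)
  then have "(\<lambda>n. emeasure lborel (B n)) \<longlonglongrightarrow> ennreal 1" unfolding UB by simp
  then have evB: "\<forall>\<^sub>F n in sequentially. emeasure lborel (B n) > ennreal (1/2)"
    by (rule order_tendstoD) (simp only: ennreal_less_iff; simp)
  have "\<exists>n. emeasure lborel (A n) > ennreal (7/4) \<and> emeasure lborel (B n) > ennreal (1/2)"
    by (rule eventually_happens'[OF sequentially_bot eventually_conj[OF evA evB]])
  then obtain n where nA: "emeasure lborel (A n) > ennreal (7/4)" and nB: "emeasure lborel (B n) > ennreal (1/2)"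
    by blast
  define B' where "B' = {v. v - u n \<in> B n}"
  have B'm: "B' \<in> sets borel"
  proof -
    have "(\<lambda>v. v - u n) -` B n \<inter> space borel \<in> sets borel"
      by (rule measurable_sets[where A = borel]) (use sets in auto)
    then show ?thesis by (simp add: B'_def vimage_def)
  qed
  have "emeasure lborel B' = emeasure (distr lborel borel ((+) (u n))) B'"
    using lborel_distr_plus[of "u n"] by (metis)
  also have "\<dots> = emeasure lborel ((+) (u n) -` B' \<inter> space lborel)"
    by (rule emeasure_distr) (use B'm in auto)
  also have "(+) (u n) -` B' \<inter> space lborel = B n" by (auto simp: B'_def)
  finally have B'e: "emeasure lborel B' > ennreal (1/2)" using nB by simp
  have sub: "A n \<union> B' \<subseteq> {0..2}" using u[of n] by (auto simp: A_def B'_def B_def)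
  have "A n \<inter> B' \<noteq> {}"
  proof
    assume dj: "A n \<inter> B' = {}"
    have "ennreal (7/4 + 1/2) = ennreal (7/4) + ennreal (1/2)" by (rule ennreal_plus) auto
    also have "\<dots> \<le> emeasure lborel (A n) + emeasure lborel B'"
      using nA B'e by (intro add_mono less_imp_le)
    also have "\<dots> = emeasure lborel (A n \<union> B')"
      using dj sets B'm by (intro plus_emeasure) auto
    also have "\<dots> \<le> emeasure lborel {0..2::real}" using sub by (intro emeasure_mono) auto
    also have "\<dots> = ennreal 2" by simp
    finally show False by (subst (asm) ennreal_le_iff) auto
  qed
  then obtain v where v: "v \<in> A n" "v - u n \<in> B n" by (auto simp: B'_def)
  have "\<bar>h (x n + v) - h (x n)\<bar> \<le> \<epsilon> / 2" using v(1) by (auto simp: A_def)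
  moreover have "\<bar>h (x n + u n + (v - u n)) - h (x n + u n)\<bar> \<le> \<epsilon> / 2"
    using v(2) unfolding B_def by blast
  then have "\<bar>h (x n + v) - h (x n + u n)\<bar> \<le> \<epsilon> / 2" by simp
  ultimately show False using big[of n] by linarith
qed

text \<open>In the variables \<open>ln x\<close> and \<open>ln L\<close>, slow variation becomes
  convergence to zero of additive increments. This is uniform over shifts in \<open>[0, 1]\<close>,
  that is, over factors between \<open>1\<close> and \<open>e\<close>.\<close>

lemma slowly_varying_log:
  assumes "slowly_varying L" and e: "\<epsilon> > 0"
  shows "\<exists>x0>0. (\<forall>x\<ge>x0. L x > 0) \<and>
    (\<forall>x\<ge>x0. \<forall>y\<in>{x..exp 1 * x}. \<bar>ln (L y) - ln (L x)\<bar> \<le> \<epsilon>)"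
proof -
  have Lm [measurable]: "L \<in> borel_measurable borel" and pos: "\<forall>\<^sub>F x in at_top. L x > 0"
    and rat: "\<And>c. c > 0 \<Longrightarrow> ((\<lambda>x. L (c * x) / L x) \<longlongrightarrow> 1) at_top"
    using assms by (auto simp: slowly_varying_def)
  define h where "h u = ln (L (exp u))" for u
  have hm [measurable]: "h \<in> borel_measurable borel" unfolding h_def by measurable
  have "((\<lambda>x. h (x + u) - h x) \<longlongrightarrow> 0) at_top" for u
  proof -
    have "((\<lambda>x. L (exp u * exp x) / L (exp x)) \<longlongrightarrow> 1) at_top"
      by (rule filterlim_compose[OF rat exp_at_top]) simp
    then have l: "((\<lambda>x. ln (L (exp u * exp x) / L (exp x))) \<longlongrightarrow> ln 1) at_top"
      by (rule tendsto_ln) simp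
    have p1: "\<forall>\<^sub>F x in at_top. L (exp x) > 0"
      by (rule eventually_compose_filterlim[OF pos exp_at_top])
    have "filterlim (\<lambda>x. exp u * exp x) at_top at_top"
      by (rule filterlim_tendsto_pos_mult_at_top[OF tendsto_const _ exp_at_top]) simp
    from eventually_compose_filterlim[OF pos this] p1
    have "\<forall>\<^sub>F x in at_top. ln (L (exp u * exp x) / L (exp x)) = h (x + u) - h x"
      by eventually_elim (simp add: h_def ln_div exp_add mult.commute)
    from Lim_transform_eventually[OF l this] show ?thesis by simp
  qed
  from uniform_convergence_additive[OF hm this e]
  obtain x0 where x0: "\<And>x u. x \<ge> x0 \<Longrightarrow> u \<in> {0..1} \<Longrightarrow> \<bar>h (x + u) - h x\<bar> \<le> \<epsilon>"
    by blast
  obtain x1 where x1: "\<And>x. x \<ge> x1 \<Longrightarrow> L x > 0" using pos by (auto simp: eventually_at_top_linorder)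
  have "\<bar>ln (L y) - ln (L x)\<bar> \<le> \<epsilon>" if x: "x \<ge> max (exp x0) x1" and y: "y \<in> {x..exp 1 * x}" for x y
  proof -
    have xp: "x > 0" using x exp_gt_zero[of x0] by linarith
    have yp: "y > 0" using xp y by auto
    have "ln y \<le> ln (exp 1 * x)" using y yp xp by (subst ln_le_cancel_iff) auto
    then have 1: "ln y - ln x \<le> 1" using xp by (simp add: ln_mult)
    have 2: "ln y - ln x \<ge> 0" using y yp xp by simp
    have "x0 \<le> ln x" using x xp by (simp add: ln_ge_iff)
    then have "\<bar>h (ln x + (ln y - ln x)) - h (ln x)\<bar> \<le> \<epsilon>" using 1 2 by (intro x0) auto
    then show ?thesis using xp yp by (simp add: h_def)
  qed
  moreover have "max (exp x0) x1 > 0" by (simp add: less_max_iff_disj)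
  ultimately show ?thesis using x1 by (intro exI[of _ "max (exp x0) x1"]) auto
qed

text \<open>\<open>ln L\<close> changes by at most \<open>\<epsilon>\<close> over each factor
  \<open>e\<close>, and at most \<open>ln (y / x) + 1\<close> such factors lead from
  \<open>x\<close> to \<open>y\<close>; the incomplete last one produces the constant
  \<open>exp \<epsilon>\<close>.\<close>

lemma slowly_varying_potter:
  assumes L: "slowly_varying L" and e: "\<epsilon> > 0"
  shows "\<exists>x0>0. (\<forall>x\<ge>x0. L x > 0) \<and>
    (\<forall>x\<ge>x0. \<forall>y\<ge>x. L y \<le> exp \<epsilon> * (y / x) powr \<epsilon> * L x \<and> L x \<le> exp \<epsilon> * (y / x) powr \<epsilon> * L y)"
proof -
  obtain x0 where x0: "x0 > 0" and pos: "\<And>x. x \<ge> x0 \<Longrightarrow> L x > 0"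
    and st: "\<And>x y. x \<ge> x0 \<Longrightarrow> y \<in> {x..exp 1 * x} \<Longrightarrow> \<bar>ln (L y) - ln (L x)\<bar> \<le> \<epsilon>"
    using slowly_varying_log[OF L e] by blast
  have steps: "\<bar>ln (L y) - ln (L x)\<bar> \<le> \<epsilon> * real (Suc n)"
    if "x \<ge> x0" "x \<le> y" "y \<le> exp 1 ^ Suc n * x" for x y n
    using that
  proof (induction n arbitrary: y)
    case 0
    then show ?case using st[of x y] by simp
  next
    case (Suc n)
    show ?case
    proof (cases "y \<le> exp 1 ^ Suc n * x")
      case True
      from Suc.IH[OF Suc.prems(1,2) True] show ?thesis using e by (simp add: algebra_simps)
    next
      case False
      \<comment> \<open>Division by \<open>e\<close> removes one factor, and
        \<open>z \<ge> x\<close> because \<open>y\<close> exceeds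
        \<open>e^(n+1) * x\<close>.\<close>
      define z where "z = y / exp 1"
      have "(1::real) \<le> exp 1 ^ Suc n" by (rule one_le_power) simp
      then have "1 * x \<le> exp 1 ^ Suc n * x" using Suc.prems x0 by (intro mult_right_mono) auto
      have y: "y \<le> exp 1 * (exp 1 ^ Suc n * x)" using Suc.prems(3) by (simp add: mult_ac)
      have zu: "z \<le> exp 1 ^ Suc n * x" unfolding z_def using y by (simp add: field_simps)
      have "x \<le> exp 1 ^ n * x" using Suc.prems x0 by (simp add: mult_le_cancel_right1)
      moreover have "exp 1 ^ n * x \<le> z"
        unfolding z_def using False by (simp add: field_simps)
      ultimately have zl: "x \<le> z" by linarith
      have "\<bar>ln (L z) - ln (L x)\<bar> \<le> \<epsilon> * real (Suc n)" by (rule Suc.IH[OF Suc.prems(1) zl zu])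
      moreover have "\<bar>ln (L y) - ln (L z)\<bar> \<le> \<epsilon>"
      proof (rule st)
        have "z * 1 \<le> z * exp 1" using zl Suc.prems x0 by (intro mult_left_mono) auto
        then show "y \<in> {z..exp 1 * z}" by (simp add: z_def)
      qed (use zl Suc.prems in auto)
      ultimately show ?thesis by (simp add: algebra_simps)
    qed
  qed
  have main: "\<bar>ln (L y) - ln (L x)\<bar> \<le> \<epsilon> * ln (y / x) + \<epsilon>" if xy: "x \<ge> x0" "x \<le> y" for x y
  proof -
    define n where "n = nat \<lfloor>ln (y / x)\<rfloor>"
    have xp: "x > 0" using xy x0 by linarith
    have l0: "ln (y / x) \<ge> 0" using xp xy by simp
    have n1: "real n \<le> ln (y / x)" unfolding n_def using l0 by simp
    have n2: "ln (y / x) \<le> real (Suc n)" unfolding n_def using l0 by simp linarith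
    have "y / x = exp (ln (y / x))" using xp xy by simp
    also have "\<dots> \<le> exp (real (Suc n))" using n2 by simp
    also have "\<dots> = exp 1 ^ Suc n" by (simp only: exp_of_nat_mult[symmetric] mult_1_right)
    finally have "y \<le> exp 1 ^ Suc n * x" using xp by (simp only: pos_divide_le_eq)
    from steps[OF xy this] have "\<bar>ln (L y) - ln (L x)\<bar> \<le> \<epsilon> * real (Suc n)" .
    also have "\<dots> \<le> \<epsilon> * (ln (y / x) + 1)" using n1 e by (intro mult_left_mono) auto
    finally show ?thesis by (simp add: distrib_left)
  qed
  have "L y \<le> exp \<epsilon> * (y / x) powr \<epsilon> * L x \<and> L x \<le> exp \<epsilon> * (y / x) powr \<epsilon> * L y"
    if xy: "x \<ge> x0" "x \<le> y" for x y
  proof -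
    have xp: "x > 0" "y > 0" using xy x0 by auto
    have Lp: "L x > 0" "L y > 0" using pos xy by auto
    have "exp (\<epsilon> * ln (y / x) + \<epsilon>) = exp \<epsilon> * (y / x) powr \<epsilon>" using xp by (simp add: powr_def exp_add)
    moreover have "L y = exp (ln (L y) - ln (L x)) * L x" "L x = exp (ln (L x) - ln (L y)) * L y"
      using Lp by (simp_all add: exp_diff)
    moreover have "exp (ln (L y) - ln (L x)) * L x \<le> exp (\<epsilon> * ln (y / x) + \<epsilon>) * L x"
      "exp (ln (L x) - ln (L y)) * L y \<le> exp (\<epsilon> * ln (y / x) + \<epsilon>) * L y"
      using main[OF xy] Lp by (auto intro!: mult_right_mono)
    ultimately show ?thesis by simp
  qed
  then show ?thesis using x0 pos by blast
qed

lemma regular_mass_slowly_varying: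
  assumes L: "slowly_varying L" and r: "\<And>t. t \<ge> 1 \<Longrightarrow> r t = real t powr (- \<alpha>) * L (real t)"
  shows "regular_mass r \<alpha>"
  unfolding regular_mass_def
proof (intro conjI allI impI)
  have Lpos: "\<forall>\<^sub>F t in sequentially. L (real t) > 0"
    by (rule eventually_compose_filterlim[OF _ filterlim_real_sequentially])
       (use L in \<open>simp add: slowly_varying_def\<close>)
  show "\<forall>\<^sub>F t in sequentially. r t > 0"
    using Lpos eventually_ge_at_top[of 1] by eventually_elim (simp add: r)
  \<comment> \<open>The factor \<open>(t + 1) / t\<close> changes with \<open>t\<close>, whereas the
    definition of slow variation fixes the factor; the uniform bound on \<open>[t, e * t]\<close>
    bridges this.\<close>
  have "(\<lambda>t. ln (L (real (Suc t))) - ln (L (real t))) \<longlonglongrightarrow> 0"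
  proof (rule tendstoI)
    fix e :: real assume e: "e > 0"
    then obtain x0 where x0: "x0 > 0"
      and st: "\<And>x y. x \<ge> x0 \<Longrightarrow> y \<in> {x..exp 1 * x} \<Longrightarrow> \<bar>ln (L y) - ln (L x)\<bar> \<le> e / 2"
      using slowly_varying_log[OF L, of "e / 2"] by auto
    have "\<forall>\<^sub>F t in sequentially. real t \<ge> x0"
      using filterlim_real_sequentially by (simp add: filterlim_at_top)
    then show "\<forall>\<^sub>F t in sequentially. dist (ln (L (real (Suc t))) - ln (L (real t))) 0 < e"
      using eventually_ge_at_top[of 1]
    proof eventually_elim
      case (elim t)
      have "2 * real t \<le> exp 1 * real t" using exp_ge_add_one_self[of 1] by (intro mult_right_mono) auto
      moreover have "real (Suc t) \<le> 2 * real t" using elim by simp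
      ultimately have "real (Suc t) \<le> exp 1 * real t" by linarith
      then have "real (Suc t) \<in> {real t..exp 1 * real t}" using elim by auto
      from st[OF elim(1) this] show ?case using e by (simp add: dist_real_def)
    qed
  qed
  then have "(\<lambda>t. exp (ln (L (real (Suc t))) - ln (L (real t)))) \<longlonglongrightarrow> exp 0" by (rule tendsto_exp)
  moreover have "(\<lambda>t::nat. (real (Suc t) / real t) powr (- \<alpha>)) \<longlonglongrightarrow> 1 powr (- \<alpha>)"
    by (rule tendsto_powr) (real_asymp, auto)
  ultimately have lim1: "(\<lambda>t. (real (Suc t) / real t) powr (- \<alpha>) * exp (ln (L (real (Suc t))) - ln (L (real t)))) \<longlonglongrightarrow> 1 powr (- \<alpha>) * exp 0"
    by (intro tendsto_mult)
  have "\<forall>\<^sub>F t in sequentially. L (real (Suc t)) > 0"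
    using Lpos by (subst eventually_sequentially_Suc)
  with Lpos eventually_ge_at_top[of 1]
  have "\<forall>\<^sub>F t in sequentially. (real (Suc t) / real t) powr (- \<alpha>) * exp (ln (L (real (Suc t))) - ln (L (real t))) = r (Suc t) / r t"
    by eventually_elim (simp add: r powr_divide exp_diff)
  from Lim_transform_eventually[OF lim1 this] show "(\<lambda>t. r (Suc t) / r t) \<longlonglongrightarrow> 1"
    by simp
  fix \<delta> :: real assume d: "\<delta> > 0"
  obtain x0 where x0: "x0 > 0"
    and P: "\<And>x y. x \<ge> x0 \<Longrightarrow> y \<ge> x \<Longrightarrow> L y \<le> exp \<delta> * (y / x) powr \<delta> * L x \<and> L x \<le> exp \<delta> * (y / x) powr \<delta> * L y"
    using slowly_varying_potter[OF L d] by blast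
  have "r t \<le> exp \<delta> * (real t / real s) powr (\<delta> - \<alpha>) * r s \<and> r s \<le> exp \<delta> * (real t / real s) powr (\<alpha> + \<delta>) * r t"
    if s: "s \<ge> nat \<lceil>x0\<rceil> + 1" and t: "t \<ge> s" for s t
  proof -
    have s0: "real s \<ge> x0" "s \<ge> 1" using s by linarith+
    note P = P[OF s0(1), of "real t"]
    let ?q = "real t / real s"
    have q: "real t powr (- \<alpha>) = ?q powr (- \<alpha>) * real s powr (- \<alpha>)"
      using s0 t by (simp add: powr_divide)
    have q': "real s powr (- \<alpha>) = ?q powr \<alpha> * real t powr (- \<alpha>)"
      using s0 t by (simp add: powr_divide powr_minus_divide)
    have "r t \<le> real t powr (- \<alpha>) * (exp \<delta> * ?q powr \<delta> * L (real s))"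
      using P t s0 by (simp add: r mult_left_mono)
    also have "\<dots> = exp \<delta> * (?q powr \<delta> * ?q powr (- \<alpha>)) * (real s powr (- \<alpha>) * L (real s))"
      unfolding q by (simp only: mult_ac)
    also have "\<dots> = exp \<delta> * ?q powr (\<delta> - \<alpha>) * r s"
      using s0 by (simp add: r flip: powr_add)
    finally have 1: "r t \<le> exp \<delta> * ?q powr (\<delta> - \<alpha>) * r s" .
    have "r s \<le> real s powr (- \<alpha>) * (exp \<delta> * ?q powr \<delta> * L (real t))"
      using P t s0 by (simp add: r mult_left_mono)
    also have "\<dots> = exp \<delta> * (?q powr \<alpha> * ?q powr \<delta>) * (real t powr (- \<alpha>) * L (real t))"
      unfolding q' by (simp only: mult_ac)
    also have "\<dots> = exp \<delta> * ?q powr (\<alpha> + \<delta>) * r t"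
      using s0 t by (simp add: r flip: powr_add)
    finally show ?thesis using 1 by blast
  qed
  then show "\<exists>C>0. \<exists>T>0. \<forall>s\<ge>T. \<forall>t\<ge>s. r t \<le> C * (real t / real s) powr (\<delta> - \<alpha>) * r s \<and>
        r s \<le> C * (real t / real s) powr (\<alpha> + \<delta>) * r t"
    by (intro exI[of _ "exp \<delta>"] conjI exI[of _ "nat \<lceil>x0\<rceil> + 1"]) auto
qed

section \<open>Exact power laws\<close>

lemma powr_asymp_bounds:
  assumes a: "a > 0" and lim: "r \<sim>[at_top] (\<lambda>t::nat. a * real t powr (- \<alpha>))"
  shows "\<forall>\<^sub>F t in sequentially. a / 2 * real t powr (- \<alpha>) \<le> r t \<and> r t \<le> 2 * a * real t powr (- \<alpha>)"
proof -
  have "(\<lambda>t. r t / (a * real t powr (- \<alpha>))) \<longlonglongrightarrow> 1"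
    by (rule asymp_equivD_strong[OF lim], rule eventually_mono[OF eventually_gt_at_top[of 0]]) (use a in auto)
  then have "\<forall>\<^sub>F t in sequentially. r t / (a * real t powr (- \<alpha>)) < 2"
    "\<forall>\<^sub>F t in sequentially. r t / (a * real t powr (- \<alpha>)) > 1 / 2"
    by (rule order_tendstoD, simp)+
  then show ?thesis using eventually_gt_at_top[of 0]
    by eventually_elim (use a in \<open>auto simp: field_simps\<close>)
qed

lemma regular_mass_powr:
  assumes a: "a > 0" and lim: "r \<sim>[at_top] (\<lambda>t::nat. a * real t powr (- \<alpha>))"
  shows "regular_mass r \<alpha>"
  unfolding regular_mass_def
proof (intro conjI allI impI)
  obtain T0 where T0: "\<And>t. t \<ge> T0 \<Longrightarrow> a / 2 * real t powr (- \<alpha>) \<le> r t \<and> r t \<le> 2 * a * real t powr (- \<alpha>)"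
    using powr_asymp_bounds[OF a lim] by (auto simp: eventually_sequentially)
  show "\<forall>\<^sub>F t in sequentially. r t > 0"
    using eventually_ge_at_top[of T0] eventually_gt_at_top[of 0]
  proof eventually_elim
    case (elim t)
    have "0 < a / 2 * real t powr (- \<alpha>)" using a elim by simp
    then show ?case using T0[OF elim(1)] by linarith
  qed
  have l: "(\<lambda>t. r t / (a * real t powr (- \<alpha>))) \<longlonglongrightarrow> 1"
    by (rule asymp_equivD_strong[OF lim], rule eventually_mono[OF eventually_gt_at_top[of 0]]) (use a in auto)
  have lim1: "(\<lambda>t. (r (Suc t) / (a * real (Suc t) powr (- \<alpha>))) / (r t / (a * real t powr (- \<alpha>))) * (real (Suc t) / real t) powr (- \<alpha>))
     \<longlonglongrightarrow> 1 / 1 * 1 powr (- \<alpha>)"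
  proof (intro tendsto_mult tendsto_divide l LIMSEQ_Suc[OF l] tendsto_powr)
    show "(\<lambda>t::nat. real (Suc t) / real t) \<longlonglongrightarrow> 1" by real_asymp
  qed auto
  have "\<forall>\<^sub>F t in sequentially. (r (Suc t) / (a * real (Suc t) powr (- \<alpha>))) / (r t / (a * real t powr (- \<alpha>))) * (real (Suc t) / real t) powr (- \<alpha>)
     = r (Suc t) / r t"
    using eventually_gt_at_top[of 0] by eventually_elim (use a in \<open>simp add: powr_divide\<close>)
  from Lim_transform_eventually[OF lim1 this] show "(\<lambda>t. r (Suc t) / r t) \<longlonglongrightarrow> 1" by simp
  fix \<delta> :: real assume d: "\<delta> > 0"
  \<comment> \<open>\<open>4\<close> is the quotient of the bounds \<open>2 * a\<close> and
    \<open>a / 2\<close>; the extra \<open>\<delta>\<close> merely raises the exponent of a number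
    that is at least one.\<close>
  have "r t \<le> 4 * (real t / real s) powr (\<delta> - \<alpha>) * r s \<and> r s \<le> 4 * (real t / real s) powr (\<alpha> + \<delta>) * r t"
    if s: "s \<ge> Suc T0" and t: "t \<ge> s" for s t
  proof -
    let ?q = "real t / real s"
    have q1: "?q \<ge> 1" using s t by simp
    have B: "a / 2 * real s powr (- \<alpha>) \<le> r s" "r s \<le> 2 * a * real s powr (- \<alpha>)"
      "a / 2 * real t powr (- \<alpha>) \<le> r t" "r t \<le> 2 * a * real t powr (- \<alpha>)"
      using T0[of s] T0[of t] s t by auto
    have nn: "0 \<le> a * real s powr (- \<alpha>)" "0 \<le> a * real t powr (- \<alpha>)" using a by auto
    have rs: "r s \<ge> 0" "r t \<ge> 0" using B(1,3) nn by auto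
    have q: "real t powr (- \<alpha>) = ?q powr (- \<alpha>) * real s powr (- \<alpha>)"
      using s t by (simp add: powr_divide)
    have q': "real s powr (- \<alpha>) = ?q powr \<alpha> * real t powr (- \<alpha>)"
      using s t by (simp add: powr_divide powr_minus_divide)
    have "r t \<le> 4 * ?q powr (- \<alpha>) * (a / 2 * real s powr (- \<alpha>))" using B(4) unfolding q by (simp add: mult_ac)
    also have "\<dots> \<le> 4 * ?q powr (\<delta> - \<alpha>) * r s"
      using q1 d B(1) rs nn by (intro mult_mono powr_mono) auto
    finally have 1: "r t \<le> 4 * ?q powr (\<delta> - \<alpha>) * r s" .
    have "r s \<le> 4 * ?q powr \<alpha> * (a / 2 * real t powr (- \<alpha>))" using B(2) unfolding q' by (simp add: mult_ac)
    also have "\<dots> \<le> 4 * ?q powr (\<alpha> + \<delta>) * r t"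
      using q1 d B(3) rs nn by (intro mult_mono powr_mono) auto
    finally show ?thesis using 1 by blast
  qed
  then show "\<exists>C>0. \<exists>T>0. \<forall>s\<ge>T. \<forall>t\<ge>s. r t \<le> C * (real t / real s) powr (\<delta> - \<alpha>) * r s \<and>
        r s \<le> C * (real t / real s) powr (\<alpha> + \<delta>) * r t"
    by (intro exI[of _ 4] conjI exI[of _ "Suc T0"]) auto
qed

section \<open>Domination by the one-step probability\<close>

lemma powr_divide_minus: "x \<ge> 0 \<Longrightarrow> y \<ge> 0 \<Longrightarrow> (x / y) powr (- e) = x powr (- e) * y powr e" for x y :: real
  by (simp only: powr_divide powr_minus_divide) simp

lemma walk_deviation:
  fixes p :: "int pmf"
  assumes mgf: "mgf_bound p (\<lambda>x. real_of_int x - \<mu>) y q" and y: "y > 0" and q: "q > 0"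
    and nq: "real n * q \<le> 1" and n: "n > 0"
    and M: "\<And>k. real_of_int k - \<mu> > y \<Longrightarrow> pmf p k \<le> M" "M \<ge> 0"
    and c: "\<And>s. pmf (walk p (n div 2)) s \<le> c"
  shows "pmf (walk p n) t \<le> real n * M + 2 * exp 1 * c * (real n * q) powr ((real_of_int t - real n * \<mu>) / (2 * y))"
proof (rule walk_local_deviation[OF _ mgf y q nq n M c])
  fix xs :: "int list" assume "length xs = n" "sum_list xs = t"
  then show "(\<Sum>x\<leftarrow>xs. real_of_int x - \<mu>) = real_of_int t - real n * \<mu>"
    by (induction xs arbitrary: n t) (auto simp: algebra_simps)
qed

text \<open>At \<open>n = 1\<close> the half path is empty and its atom may be one, which the
  summand \<open>1\<close> covers; for \<open>n \<ge> 2\<close> the half has at least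
  \<open>n / 3\<close> steps.\<close>

lemma concentration_half:
  assumes D: "\<And>n t. n > 0 \<Longrightarrow> pmf (walk p n) t \<le> D * real n powr (- e)" and e: "e \<ge> 0" and D0: "D > 0" and n: "n > 0"
  shows "pmf (walk p (n div 2)) t \<le> (1 + D * 3 powr e) * real n powr (- e)"
proof (cases "n = 1")
  case True
  have "pmf (walk p (n div 2)) t \<le> 1" by (rule pmf_le_1)
  also have "1 \<le> 1 + D * 3 powr e" using D0 by simp
  finally show ?thesis using True by simp
next
  case False
  then have n2: "n \<ge> 2" using n by simp
  have "pmf (walk p (n div 2)) t \<le> D * real (n div 2) powr (- e)" using n2 by (intro D) auto
  also have "\<dots> \<le> D * (real n / 3) powr (- e)"
  proof (intro mult_left_mono powr_mono2')
    have "n \<le> 3 * (n div 2)" using n2 by linarith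
    then show "real n / 3 \<le> real (n div 2)" by linarith
  qed (use e D0 n in auto)
  also have "(real n / 3) powr (- e) = real n powr (- e) * 3 powr e"
    by (rule powr_divide_minus) auto
  also have "D * (real n powr (- e) * 3 powr e) \<le> (1 + D * 3 powr e) * real n powr (- e)"
    by (simp add: algebra_simps)
  finally show ?thesis .
qed

lemma window_int:
  assumes "\<forall>k. real k \<ge> \<eta> * real t \<longrightarrow> pmf p (int k) \<le> C * pmf p (int t)" "real_of_int k \<ge> \<eta> * real t" "\<eta> > 0"
  shows "pmf p k \<le> C * pmf p (int t)"
proof -
  have "0 \<le> \<eta> * real t" using assms by simp
  then have "real_of_int k \<ge> 0" using assms(2) by linarith
  then have "k = int (nat k)" by simp
  then show ?thesis using assms by (metis of_int_of_nat_eq)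
qed

lemma walk_0_pos: "t > 0 \<Longrightarrow> pmf (walk p 0) (int t) = 0"
  by (simp add: walk_0)

text \<open>With \<open>y = u / (2 * K)\<close> the exponent \<open>u / (2 * y)\<close> equals
  \<open>K\<close> for all \<open>n\<close> and \<open>t\<close>. Atoms above this level are at most
  a constant times \<open>pmf p (int t)\<close>, because the level is at least a fixed fraction of
  \<open>t\<close>. The bound \<open>q\<close> stays free, to be chosen in each range of the
  index.\<close>

lemma walk_deviation_regular:
  fixes p :: "int pmf"
  assumes \<alpha>: "\<alpha> > 0" and r: "regular_mass (\<lambda>t. pmf p (int t)) \<alpha>" and K: "K > 0"
    and conc: "D > 0" "\<And>n t. n > 0 \<Longrightarrow> pmf (walk p n) t \<le> D * real n powr (- e)" and e: "e \<ge> 0"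
  shows "\<exists>C>0. \<forall>\<^sub>F t in sequentially. \<forall>n>0. \<forall>q>0. real t - real n * \<mu> \<ge> real t / 2 \<longrightarrow>
    mgf_bound p (\<lambda>x. real_of_int x - \<mu>) ((real t - real n * \<mu>) / (2 * K)) q \<longrightarrow> real n * q \<le> 1 \<longrightarrow>
    pmf (walk p n) (int t) \<le> C * (real n * pmf p (int t) + real n powr (- e) * (real n * q) powr K)"
proof -
  \<comment> \<open>\<open>u \<ge> t / 2\<close> gives
    \<open>y \<ge> t / (4 * K) = 2 * \<eta> * t\<close>; one half of this absorbs
    \<open>|\<mu>|\<close>, since the truncation concerns centred steps.\<close>
  define \<eta> where "\<eta> = 1 / (8 * K)"
  have \<eta>: "\<eta> > 0" unfolding \<eta>_def using K by simp
  obtain C1 where C1: "C1 > 0" "\<forall>\<^sub>F t in sequentially. \<forall>k. real k \<ge> \<eta> * real t \<longrightarrow> pmf p (int k) \<le> C1 * pmf p (int t)"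
    using regular_mass_window[OF r \<alpha> \<eta>] by auto
  define D' where "D' = 1 + D * 3 powr e"
  have D': "D' > 0" unfolding D'_def using conc(1) by (simp add: add_pos_nonneg)
  define C where "C = max C1 (2 * exp 1 * D')"
  have ev: "\<forall>\<^sub>F t in sequentially. \<eta> * real t \<ge> \<bar>\<mu>\<bar>" using \<eta> by real_asymp
  have "\<forall>\<^sub>F t in sequentially. \<forall>n>0. \<forall>q>0. real t - real n * \<mu> \<ge> real t / 2 \<longrightarrow>
    mgf_bound p (\<lambda>x. real_of_int x - \<mu>) ((real t - real n * \<mu>) / (2 * K)) q \<longrightarrow> real n * q \<le> 1 \<longrightarrow>
    pmf (walk p n) (int t) \<le> C * (real n * pmf p (int t) + real n powr (- e) * (real n * q) powr K)"
    using C1(2) ev eventually_gt_at_top[of 0]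
  proof eventually_elim
    case (elim t)
    show ?case
    proof (intro allI impI)
      fix n :: nat and q :: real
      define u where "u = real t - real n * \<mu>"
      assume n: "n > 0" and q: "q > 0" and nq: "real n * q \<le> 1"
        and "real t - real n * \<mu> \<ge> real t / 2"
        and mgf: "mgf_bound p (\<lambda>x. real_of_int x - \<mu>) ((real t - real n * \<mu>) / (2 * K)) q"
      then have u: "u \<ge> real t / 2" "u > 0" using elim by (auto simp: u_def)
      define y where "y = u / (2 * K)"
      have y: "y \<ge> 2 * (\<eta> * real t)" "y > 0" unfolding y_def \<eta>_def using u K by (auto simp: field_simps)
      have "pmf (walk p n) (int t) \<le> real n * (C1 * pmf p (int t)) +
          2 * exp 1 * (D' * real n powr (- e)) * (real n * q) powr ((real_of_int (int t) - real n * \<mu>) / (2 * y))"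
      proof (rule walk_deviation[OF _ y(2) q nq n])
        show "mgf_bound p (\<lambda>x. real_of_int x - \<mu>) y q" using mgf unfolding y_def u_def .
        show "pmf p k \<le> C1 * pmf p (int t)" if "real_of_int k - \<mu> > y" for k
          by (rule window_int[OF elim(1) _ \<eta>]) (use that y(1) elim(2) in linarith)
        show "pmf (walk p (n div 2)) s \<le> D' * real n powr (- e)" for s
          unfolding D'_def by (rule concentration_half[OF conc(2) e conc(1) n])
      qed (use C1 in auto)
      also have "(real_of_int (int t) - real n * \<mu>) / (2 * y) = K"
        unfolding of_int_of_nat_eq u_def[symmetric] y_def using u(2) K by simp
      also have "real n * (C1 * pmf p (int t)) + 2 * exp 1 * (D' * real n powr (- e)) * (real n * q) powr K =
          C1 * (real n * pmf p (int t)) + 2 * exp 1 * D' * (real n powr (- e) * (real n * q) powr K)"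
        by simp
      also have "\<dots> \<le> C * (real n * pmf p (int t)) + C * (real n powr (- e) * (real n * q) powr K)"
        unfolding C_def by (intro add_mono mult_right_mono) auto
      finally show "pmf (walk p n) (int t) \<le> C * (real n * pmf p (int t) + real n powr (- e) * (real n * q) powr K)"
        by (simp add: distrib_left)
    qed
  qed
  moreover have "C > 0" unfolding C_def using C1 by (simp add: less_max_iff_disj)
  ultimately show ?thesis by blast
qed

text \<open>The sizes of \<open>n\<close> split at \<open>1 / q\<close>, of order
  \<open>t powr b\<close>. Below, \<open>K = 1 + 1 / b\<close> makes the powers of \<open>n\<close>
  in \<open>n powr (- (1 / b)) * (n * q) powr K\<close> collapse to \<open>n\<close>, and
  \<open>q powr K\<close> has the order \<open>t powr (- (1 + b))\<close> of the atom. Above,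
  concentration alone is a multiple of \<open>n * n powr (- K)\<close>, at most a multiple of
  \<open>n * q powr K\<close>.\<close>

lemma stable_domination:
  fixes p :: "int pmf" and b :: real
  assumes b: "b > 0"
    and r: "regular_mass (\<lambda>t. pmf p (int t)) (1 + b)"
    and low: "c0 > 0" "\<forall>\<^sub>F t in sequentially. c0 * real t powr (- (1 + b)) \<le> pmf p (int t)"
    and mgf: "Q > 0" "\<And>y. y \<ge> 1 \<Longrightarrow> mgf_bound p real_of_int y (Q * y powr (- b))"
    and conc: "D > 0" "\<And>n t. n > 0 \<Longrightarrow> pmf (walk p n) t \<le> D * real n powr (- (1 / b))"
  shows "\<exists>C. \<forall>\<^sub>F t in sequentially. \<forall>n. pmf (walk p n) (int t) \<le> C * real n * pmf p (int t)"
proof -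
  define K where "K = 1 + 1 / b"
  have K: "K > 0" "K > 1" and bK: "b * K = 1 + b" unfolding K_def using b by (auto simp: field_simps)
  obtain C1 where C1: "C1 > 0" "\<forall>\<^sub>F t in sequentially. \<forall>n>0. \<forall>q>0. real t - real n * 0 \<ge> real t / 2 \<longrightarrow>
    mgf_bound p (\<lambda>x. real_of_int x - 0) ((real t - real n * 0) / (2 * K)) q \<longrightarrow> real n * q \<le> 1 \<longrightarrow>
    pmf (walk p n) (int t) \<le> C1 * (real n * pmf p (int t) + real n powr (- (1 / b)) * (real n * q) powr K)"
    using walk_deviation_regular[OF _ r K(1) conc, of 0] b by auto
  define A where "A = Q powr K * (2 * K) powr (1 + b)"
  have A: "A > 0" unfolding A_def using mgf(1) K by simp
  define C where "C = C1 * (1 + A / c0) + D * A / c0"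
  have ev1: "\<forall>\<^sub>F t in sequentially. real t / (2 * K) \<ge> 1" using K by real_asymp
  have "\<forall>\<^sub>F t in sequentially. \<forall>n. pmf (walk p n) (int t) \<le> C * real n * pmf p (int t)"
    using C1(2) low(2) ev1 eventually_gt_at_top[of 0]
  proof eventually_elim
    case (elim t)
    define q where "q = Q * (real t / (2 * K)) powr (- b)"
    have q0: "q > 0" unfolding q_def using mgf(1) elim K by simp
    have "A * real t powr (- (1 + b)) \<le> A * (pmf p (int t) / c0)"
      using elim low(1) A by (intro mult_left_mono) (auto simp: field_simps)
    moreover have qK: "q powr K = A * real t powr (- (1 + b))"
    proof -
      have "q powr K = Q powr K * (real t / (2 * K)) powr (- (b * K))"
        unfolding q_def by (simp add: powr_mult powr_powr)
      also have "(real t / (2 * K)) powr (- (b * K)) = real t powr (- (1 + b)) * (2 * K) powr (1 + b)"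
        unfolding bK using K by (intro powr_divide_minus) auto
      finally show ?thesis unfolding A_def by simp
    qed
    ultimately have qKr: "q powr K \<le> A / c0 * pmf p (int t)" by simp
    show ?case
    proof
      fix n
      show "pmf (walk p n) (int t) \<le> C * real n * pmf p (int t)"
      proof (cases "n = 0")
        case True
        then show ?thesis using elim by (simp add: walk_0_pos)
      next
        case False
        then have n: "n > 0" by simp
        have CC: "C1 * (1 + A / c0) \<le> C" "D * A / c0 \<le> C"
          unfolding C_def using C1 A low(1) conc(1) by auto
        show ?thesis
        proof (cases "real n * q \<le> 1")
          case True
          have "pmf (walk p n) (int t) \<le> C1 * (real n * pmf p (int t) + real n powr (- (1 / b)) * (real n * q) powr K)"
            using elim(1) n q0 True mgf(2)[OF elim(3)] by (simp add: q_def)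
          also have "real n powr (- (1 / b)) * (real n * q) powr K = (real n powr (- (1 / b)) * real n powr K) * q powr K"
            by (simp add: powr_mult)
          also have "real n powr (- (1 / b)) * real n powr K = real n"
            using n unfolding K_def by (simp flip: powr_add)
          also have "C1 * (real n * pmf p (int t) + real n * q powr K) \<le>
              C1 * (real n * pmf p (int t) + real n * (A / c0 * pmf p (int t)))"
            using C1 qKr by (intro mult_left_mono add_left_mono) auto
          also have "\<dots> = C1 * (1 + A / c0) * (real n * pmf p (int t))" by (simp add: algebra_simps)
          also have "\<dots> \<le> C * (real n * pmf p (int t))" by (intro mult_right_mono CC) auto
          finally show ?thesis by simp
        next
          case False
          have "real n powr (- K) \<le> (1 / q) powr (- K)"
          proof (rule powr_mono2')
            show "1 / q \<le> real n" using False by (subst pos_divide_le_eq[OF q0]) linarith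
          qed (use K q0 in auto)
          also have "\<dots> = q powr K" using q0 by (simp add: powr_divide powr_minus_divide)
          finally have nK: "real n powr (- K) \<le> A / c0 * pmf p (int t)" using qKr by linarith
          have "pmf (walk p n) (int t) \<le> D * real n powr (- (1 / b))" by (rule conc(2)[OF n])
          also have "real n powr (- (1 / b)) = real n * real n powr (- K)"
            unfolding K_def using n powr_add[of "real n" 1 "- (1 + 1 / b)"] by simp
          also have "D * (real n * real n powr (- K)) \<le> D * (real n * (A / c0 * pmf p (int t)))"
            using nK conc(1) by (intro mult_left_mono) auto
          also have "\<dots> = D * A / c0 * (real n * pmf p (int t))" by simp
          also have "\<dots> \<le> C * (real n * pmf p (int t))" by (intro mult_right_mono CC) auto
          finally show ?thesis by simp
        qed
      qed
    qed
  qed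
  then show ?thesis by blast
qed

text \<open>With \<open>n\<close> at most of order \<open>u\<close>, as under a drift,
  \<open>n * q\<close> is at most a constant times \<open>u powr (- d)\<close>. A large
  \<open>K\<close> then brings the Chernoff term below any fixed power of \<open>t\<close>, and
  trivial concentration with exponent \<open>0\<close> suffices.\<close>

lemma drift_domination:
  fixes p :: "int pmf" and d :: real
  assumes \<alpha>: "\<alpha> > 0" and r: "regular_mass (\<lambda>t. pmf p (int t)) \<alpha>" and d: "d > 0" and B: "B > 0"
    and mgf: "Q > 0" "\<And>y. y \<ge> 1 \<Longrightarrow> mgf_bound p (\<lambda>x. real_of_int x - \<mu>) y (Q * y powr (- (1 + d)))"
  shows "\<exists>C. \<forall>\<^sub>F t in sequentially. \<forall>n.
    real t - real n * \<mu> \<ge> real t / 2 \<and> real n \<le> B * (real t - real n * \<mu>) \<longrightarrow>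
    pmf (walk p n) (int t) \<le> C * real n * pmf p (int t)"
proof -
  \<comment> \<open>Chosen so that \<open>(t powr (- d)) powr K = t powr (- (\<alpha> + 1))\<close>,
    one power beyond the index; the lower Potter bound places this under a multiple of the
    atom.\<close>
  define K where "K = (\<alpha> + 1) / d"
  have K: "K > 0" unfolding K_def using \<alpha> d by simp
  have triv: "pmf (walk p n) t \<le> 1 * real n powr (- 0)" if "n > 0" for n t
    using that by (simp add: pmf_le_1)
  obtain C1 where C1: "C1 > 0" "\<forall>\<^sub>F t in sequentially. \<forall>n>0. \<forall>q>0. real t - real n * \<mu> \<ge> real t / 2 \<longrightarrow>
    mgf_bound p (\<lambda>x. real_of_int x - \<mu>) ((real t - real n * \<mu>) / (2 * K)) q \<longrightarrow> real n * q \<le> 1 \<longrightarrow>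
    pmf (walk p n) (int t) \<le> C1 * (real n * pmf p (int t) + real n powr (- 0) * (real n * q) powr K)"
    using walk_deviation_regular[OF \<alpha> r K zero_less_one triv, of \<mu>] by auto
  obtain c0 where c0: "c0 > 0" "\<forall>\<^sub>F t in sequentially. c0 * real t powr (- (\<alpha> + 1)) \<le> pmf p (int t)"
    using regular_mass_lower[OF r, of 1] by auto
  define B' where "B' = B * Q * (2 * K) powr (1 + d)"
  have B': "B' > 0" unfolding B'_def using B mgf(1) K by simp
  define A where "A = B' powr K * 2 powr (\<alpha> + 1)"
  have A: "A > 0" unfolding A_def using B' by simp
  have ev1: "\<forall>\<^sub>F t in sequentially. real t / (4 * K) \<ge> 1" using K by real_asymp
  have ev2: "\<forall>\<^sub>F t in sequentially. B' * (real t / 2) powr (- d) \<le> 1" using B' d by real_asymp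
  have "\<forall>\<^sub>F t in sequentially. \<forall>n.
    real t - real n * \<mu> \<ge> real t / 2 \<and> real n \<le> B * (real t - real n * \<mu>) \<longrightarrow>
    pmf (walk p n) (int t) \<le> C1 * (1 + A / c0) * real n * pmf p (int t)"
    using C1(2) c0(2) ev1 ev2 eventually_gt_at_top[of 0]
  proof eventually_elim
    case (elim t)
    show ?case
    proof (intro allI impI)
      fix n assume H: "real t - real n * \<mu> \<ge> real t / 2 \<and> real n \<le> B * (real t - real n * \<mu>)"
      define u where "u = real t - real n * \<mu>"
      have t0: "real t > 0" using elim by simp
      have u: "u \<ge> real t / 2" "u > 0" "real n \<le> B * u" using H t0 unfolding u_def by auto
      define y where "y = u / (2 * K)"
      have y: "y \<ge> real t / (4 * K)" unfolding y_def using u K by (simp add: field_simps)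
      have y1: "y \<ge> 1" using y elim(3) by linarith
      let ?q = "Q * y powr (- (1 + d))"
      show "pmf (walk p n) (int t) \<le> C1 * (1 + A / c0) * real n * pmf p (int t)"
      proof (cases "n = 0")
        case True
        then show ?thesis using elim by (simp add: walk_0_pos)
      next
        case False
        then have n: "n > 0" by simp
        have ypow: "y powr (- (1 + d)) = u powr (- (1 + d)) * (2 * K) powr (1 + d)"
          unfolding y_def using u K by (intro powr_divide_minus) auto
        have "real n * ?q \<le> B * u * ?q" using u mgf(1) by (intro mult_right_mono) auto
        also have "\<dots> = B' * (u * u powr (- (1 + d)))"
          unfolding B'_def ypow by simp
        also have "u * u powr (- (1 + d)) = u powr (- d)"
          using u powr_add[of u 1 "- (1 + d)"] by simp
        also have "B' * u powr (- d) \<le> B' * (real t / 2) powr (- d)"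
          using u t0 d B' by (intro mult_left_mono powr_mono2') auto
        finally have nq: "real n * ?q \<le> B' * (real t / 2) powr (- d)" .
        have "real n * ?q \<le> 1" using nq elim(4) by linarith
        moreover have "?q > 0" using mgf(1) y1 by simp
        ultimately have "pmf (walk p n) (int t) \<le> C1 * (real n * pmf p (int t) + (real n * ?q) powr K)"
          using elim(1) n H mgf(2)[OF y1] by (simp add: y_def u_def)
        also have "(real n * ?q) powr K \<le> (B' * (real t / 2) powr (- d)) powr K"
          using nq mgf(1) K by (intro powr_mono2) auto
        also have "\<dots> = B' powr K * (real t / 2) powr (- (\<alpha> + 1))"
          using B' d by (simp add: powr_mult powr_powr K_def)
        also have "(real t / 2) powr (- (\<alpha> + 1)) = real t powr (- (\<alpha> + 1)) * 2 powr (\<alpha> + 1)"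
          using t0 by (intro powr_divide_minus) auto
        also have "B' powr K * (real t powr (- (\<alpha> + 1)) * 2 powr (\<alpha> + 1)) = A * real t powr (- (\<alpha> + 1))"
          unfolding A_def by simp
        also have "\<dots> \<le> A * (pmf p (int t) / c0)"
          using elim(2) c0(1) A by (intro mult_left_mono) (auto simp: field_simps)
        also have "A * (pmf p (int t) / c0) \<le> real n * (A * (pmf p (int t) / c0))"
          using mult_right_mono[of 1 "real n" "A * (pmf p (int t) / c0)"] n A c0(1) by simp
        finally show ?thesis using C1(1) by (simp add: algebra_simps)
      qed
    qed
  qed
  then show ?thesis by blast
qed

section \<open>Positive drift\<close>

text \<open>The ratio form keeps its meaning when the mean of \<open>\<nu>\<close> is zero;
  \<open>random_walk_asymp_equiv\<close> translates it into asymptotic equivalence.\<close>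

definition random_walk_asymp :: "int pmf \<Rightarrow> nat pmf \<Rightarrow> bool" where
  "random_walk_asymp p \<nu> \<longleftrightarrow>
     (\<lambda>t. measure_pmf.expectation \<nu> (\<lambda>n. pmf (walk p n) (int t)) / pmf p (int t))
       \<longlonglongrightarrow> measure_pmf.expectation \<nu> real"

lemma random_walk_asympI:
  assumes \<nu>: "integrable (measure_pmf \<nu>) real"
    and r: "regular_mass (\<lambda>t. pmf p (int t)) \<alpha>" and \<alpha>: "\<alpha> > 0"
    and bound: "\<forall>\<^sub>F t in sequentially. \<forall>n. pmf (walk p n) (int t) \<le> C * real n * pmf p (int t) + R n t"
    and R: "\<And>n t. 0 \<le> R n t" "\<And>t. integrable (measure_pmf \<nu>) (\<lambda>n. R n t)"
      "(\<lambda>t. measure_pmf.expectation \<nu> (\<lambda>n. R n t) / pmf p (int t)) \<longlonglongrightarrow> 0"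
  shows "random_walk_asymp p \<nu>"
  unfolding random_walk_asymp_def
  by (rule random_walk_ratio_limit[OF \<nu> _ regular_mass_pos[OF r] _ _ walk_asymp[OF r \<alpha>] bound R])
     (auto simp: pmf_le_1)

lemma random_walk_asymp_dominated:
  assumes "integrable (measure_pmf \<nu>) real"
    and "regular_mass (\<lambda>t. pmf p (int t)) \<alpha>" "\<alpha> > 0"
    and "\<forall>\<^sub>F t in sequentially. \<forall>n. pmf (walk p n) (int t) \<le> C * real n * pmf p (int t)"
  shows "random_walk_asymp p \<nu>"
  by (rule random_walk_asympI[where R = "\<lambda>_ _. 0", OF assms(1-3)]) (use assms(4) in auto)

text \<open>Maximum principle: off the origin the truncated Green function is an average of its values one step earlier.\<close>

lemma green_le_green_origin:
  "(\<Sum>n\<le>m. pmf (walk p n) t) \<le> (\<Sum>n\<le>m. pmf (walk p n) 0)"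
proof (induction m arbitrary: t)
  case 0
  then show ?case by (simp add: walk_0)
next
  case (Suc m)
  show ?case
  proof (cases "t = 0")
    case False
    have "(\<Sum>n\<le>Suc m. pmf (walk p n) t) = (\<Sum>n\<le>m. pmf (walk p (Suc n)) t)"
      using False by (subst sum.atMost_Suc_shift) (simp add: walk_0)
    also have "\<dots> = measure_pmf.expectation p (\<lambda>k. \<Sum>n\<le>m. pmf (walk p n) (t - k))"
      unfolding pmf_walk_Suc
      by (intro Bochner_Integration.integral_sum[symmetric] integrable_pmf_bounded[where B = 1]) (simp add: pmf_le_1)
    also have "\<dots> \<le> (\<Sum>n\<le>m. pmf (walk p n) 0)"
      by (rule expectation_le_const[OF _ Suc.IH]) (simp add: sum_nonneg)
    also have "\<dots> \<le> (\<Sum>n\<le>Suc m. pmf (walk p n) 0)" by simp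
    finally show ?thesis .
  qed simp
qed

section \<open>Return probabilities under positive drift\<close>

lemma replicate_exists_bound:
  "emeasure (replicate_pmf n p) {xs. \<exists>x\<in>set xs. x \<in> B} \<le> ennreal (real n * measure (measure_pmf p) B)"
proof (induction n)
  case 0
  then show ?case by simp
next
  case (Suc n)
  let ?R = "replicate_pmf n p"
  have "emeasure (replicate_pmf (Suc n) p) {xs. \<exists>x\<in>set xs. x \<in> B} =
      (\<integral>\<^sup>+x. emeasure ?R {xs. x # xs \<in> {xs. \<exists>x\<in>set xs. x \<in> B}} \<partial>p)"
    by (rule emeasure_replicate_Suc)
  also have "\<dots> \<le> (\<integral>\<^sup>+x. indicator B x + ennreal (real n * measure (measure_pmf p) B) \<partial>p)"
  proof (rule nn_integral_mono)
    fix x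
    show "emeasure ?R {xs. x # xs \<in> {xs. \<exists>x\<in>set xs. x \<in> B}} \<le> indicator B x + ennreal (real n * measure (measure_pmf p) B)"
    proof (cases "x \<in> B")
      case True
      have "emeasure ?R {xs. x # xs \<in> {xs. \<exists>x\<in>set xs. x \<in> B}} \<le> 1" by (rule measure_pmf.emeasure_le_1)
      also have "1 \<le> 1 + ennreal (real n * measure (measure_pmf p) B)" by simp
      finally show ?thesis using True by simp
    next
      case False
      then show ?thesis using Suc.IH by simp
    qed
  qed
  also have "\<dots> = emeasure p B + ennreal (real n * measure (measure_pmf p) B)"
    by (subst nn_integral_add) auto
  also have "\<dots> = ennreal (real (Suc n) * measure (measure_pmf p) B)"
    by (simp add: measure_pmf.emeasure_eq_measure algebra_simps flip: ennreal_plus)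
  finally show ?case .
qed

text \<open>For the reflected centred step \<open>\<mu> - X\<close> a return to the origin means a
  sum of \<open>n * \<mu>\<close>, so one half reaches \<open>n * \<mu> / 2\<close>. Individual
  atoms on the left are not controlled, hence a large step is charged its whole probability, at most
  \<open>q\<close> by Markov. One factor \<open>n * q\<close> times the concentration of the other
  half is what the summation over \<open>n\<close> asks for.\<close>

lemma return_probability_bound:
  fixes p :: "int pmf"
  assumes X: "integrable (measure_pmf p) real_of_int" "measure_pmf.expectation p real_of_int = \<mu>" and \<mu>: "\<mu> > 0"
    and q: "q > 0" "measure_pmf.expectation p (\<lambda>x. huber ((real_of_int x - \<mu>) / (real n * \<mu> / 2))) \<le> q"
    and n: "n > 0" and c: "\<And>s. pmf (walk p (n div 2)) s \<le> c"
  shows "pmf (walk p n) 0 \<le> 8 * c * (real n * q)"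
proof (cases "real n * q \<le> 1")
  case False
  have c0: "c \<ge> 0" by (rule order_trans[OF pmf_nonneg c])
  have "pmf (walk p n) 0 \<le> c" by (rule walk_bound_mono[OF _ c]) simp
  also have "c \<le> c * (8 * (real n * q))" using False c0 mult_left_mono[of 1 "8 * (real n * q)" c] by simp
  finally show ?thesis by (simp add: mult_ac)
next
  case True
  define f where "f x = \<mu> - real_of_int x" for x
  define y where "y = real n * \<mu> / 2"
  have y: "y > 0" unfolding y_def using n \<mu> by simp
  let ?m = "n div 2" let ?k = "n - n div 2"
  have n_eq: "n = ?m + ?k" by simp
  have c0: "c \<ge> 0" by (rule order_trans[OF pmf_nonneg c])
  have c': "pmf (walk p ?k) s \<le> c" for s by (rule walk_bound_mono[OF _ c]) linarith
  have fi: "integrable (measure_pmf p) f" unfolding f_def using X by simp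
  have f0: "measure_pmf.expectation p f = 0"
    unfolding f_def using X by (subst Bochner_Integration.integral_diff) auto
  have hub: "measure_pmf.expectation p (\<lambda>x. huber (f x / y)) \<le> q"
  proof -
    have "huber (f x / y) = huber ((real_of_int x - \<mu>) / (real n * \<mu> / 2))" for x
    proof -
      have "f x / y = - ((real_of_int x - \<mu>) / (real n * \<mu> / 2))"
        unfolding f_def y_def minus_divide_left by simp
      then show ?thesis by (simp only: huber_def power2_minus abs_minus_cancel)
    qed
    then show ?thesis using q(2) by simp
  qed
  have mgf: "mgf_bound p f y q"
    by (rule mgf_bound_mono[OF mgf_bound_centred[OF fi f0 y] hub])
  have Pf: "measure (measure_pmf p) {x. f x > y} \<le> q"
  proof -
    have "measure (measure_pmf p) {x. f x > y} = measure_pmf.expectation p (indicator {x. f x > y})" by simp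
    also have "\<dots> \<le> measure_pmf.expectation p (\<lambda>x. huber (f x / y))"
    proof (rule integral_mono)
      show "indicator {x. f x > y} x \<le> huber (f x / y)" for x
        using y huber_ge_one[of "f x / y"] by (auto simp: indicator_def)
    qed (auto intro!: integrable_huber[OF fi] integrable_pmf_bounded[where B = 1])
    finally show ?thesis using hub by linarith
  qed
  have part: "measure (replicate_pmf m p) {xs. (\<Sum>x\<leftarrow>xs. f x) \<ge> y} \<le> 4 * (real n * q)" if m: "m \<le> n" for m
  proof -
    let ?R = "replicate_pmf m p"
    have "measure ?R {xs. (\<Sum>x\<leftarrow>xs. f x) \<ge> y} \<le> measure ?R ({xs. \<exists>x\<in>set xs. x \<in> {x. f x > y}} \<union>
        {xs. (\<Sum>x\<leftarrow>xs. f x) \<ge> y \<and> (\<forall>x\<in>set xs. f x \<le> y)})"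
      by (intro measure_pmf.finite_measure_mono) force+
    also have "\<dots> \<le> measure ?R {xs. \<exists>x\<in>set xs. x \<in> {x. f x > y}} +
        measure ?R {xs. (\<Sum>x\<leftarrow>xs. f x) \<ge> y \<and> (\<forall>x\<in>set xs. f x \<le> y)}"
      by (intro measure_subadditive) auto
    also have "measure ?R {xs. \<exists>x\<in>set xs. x \<in> {x. f x > y}} \<le> real m * measure (measure_pmf p) {x. f x > y}"
      using replicate_exists_bound[of m p "{x. f x > y}"] by (simp add: measure_pmf.emeasure_eq_measure)
    also have "\<dots> \<le> real n * q" using m Pf q by (intro mult_mono) auto
    \<comment> \<open>Level and truncation coincide, so the Chernoff exponent is
      \<open>y / y = 1\<close>; \<open>exp 1 \<le> 3\<close> and the large steps add up to
      \<open>4\<close> per half.\<close>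
    also have "measure ?R {xs. (\<Sum>x\<leftarrow>xs. f x) \<ge> y \<and> (\<forall>x\<in>set xs. f x \<le> y)} \<le> exp 1 * (real n * q) powr (y / y)"
      by (rule truncated_chernoff[OF mgf y q(1) m True n])
    also have "\<dots> \<le> 3 * (real n * q)" using y q n exp_le by (simp add: mult_right_mono)
    finally show ?thesis by (simp add: mult.commute)
  qed
  have "pmf (walk p n) 0 = measure (replicate_pmf n p) {xs. sum_list xs = 0 \<and> (\<forall>x\<in>set xs. True)}"
    using emeasure_walk[of n p 0] by (simp add: measure_pmf.emeasure_eq_measure)
  also have "\<dots> \<le> c * (measure (replicate_pmf ?m p) {xs. (\<Sum>x\<leftarrow>xs. f x) \<ge> real n * \<mu> / 2 \<and> (\<forall>x\<in>set xs. True)}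
         + measure (replicate_pmf ?k p) {xs. (\<Sum>x\<leftarrow>xs. f x) \<ge> real n * \<mu> / 2 \<and> (\<forall>x\<in>set xs. True)})"
  proof (subst n_eq, rule walk_halving)
    fix xs :: "int list" assume "length xs = ?m + ?k" "sum_list xs = 0"
    moreover have "(\<Sum>x\<leftarrow>xs. f x) = real (length xs) * \<mu> - real_of_int (sum_list xs)" for xs
      by (induction xs) (auto simp: f_def algebra_simps)
    ultimately show "(\<Sum>x\<leftarrow>xs. f x) = real n * \<mu>" by simp
  qed (use c c' in auto)
  also have "\<dots> \<le> c * (4 * (real n * q) + 4 * (real n * q))"
    using part[of ?m] part[of ?k] c0 by (intro mult_left_mono add_mono) (auto simp: y_def)
  finally show ?thesis by (simp add: mult_ac)
qed

text \<open>Concentration \<open>n powr (- g)\<close> and the factor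
  \<open>n * n powr (- (1 + d))\<close> give return probabilities of order
  \<open>n powr (- (g + d))\<close>, whence the condition \<open>g + d > 1\<close>. By the maximum
  principle the origin bounds all other points.\<close>

lemma green_bounded:
  fixes p :: "int pmf"
  assumes X: "integrable (measure_pmf p) real_of_int" "measure_pmf.expectation p real_of_int = \<mu>" and \<mu>: "\<mu> > 0"
    and Q: "Q > 0" "\<And>y. y \<ge> 1 \<Longrightarrow> measure_pmf.expectation p (\<lambda>x. huber ((real_of_int x - \<mu>) / y)) \<le> Q * y powr (- (1 + d))"
    and conc: "D > 0" "\<And>n t. n > 0 \<Longrightarrow> pmf (walk p n) t \<le> D * real n powr (- g)"
    and g: "g \<ge> 0" "g + d > 1"
  shows "\<exists>U. \<forall>m t. (\<Sum>n\<le>m. pmf (walk p n) t) \<le> U"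
proof -
  define K where "K = 8 * (1 + D * 3 powr g) * Q * (\<mu> / 2) powr (- (1 + d))"
  have ev: "\<forall>\<^sub>F n in sequentially. norm (pmf (walk p n) 0) \<le> K * real n powr (- (g + d))"
  proof -
    have "\<forall>\<^sub>F n in sequentially. real n * \<mu> / 2 \<ge> 1" using \<mu> by real_asymp
    then show ?thesis using eventually_gt_at_top[of 0]
    proof eventually_elim
      case (elim n)
      let ?y = "real n * \<mu> / 2"
      have q0: "Q * ?y powr (- (1 + d)) > 0" using Q(1) elim \<mu> by (intro mult_pos_pos powr_gt_zero[THEN iffD2]) auto
      have "pmf (walk p n) 0 \<le> 8 * ((1 + D * 3 powr g) * real n powr (- g)) * (real n * (Q * ?y powr (- (1 + d))))"
        by (rule return_probability_bound[OF X \<mu> q0 Q(2)[OF elim(1)] elim(2)])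
           (rule concentration_half[OF conc(2) g(1) conc(1) elim(2)])
      also have "?y powr (- (1 + d)) = real n powr (- (1 + d)) * (\<mu> / 2) powr (- (1 + d))"
        using powr_mult[of "real n" "\<mu> / 2" "- (1 + d)"] by simp
      also have "8 * ((1 + D * 3 powr g) * real n powr (- g)) * (real n * (Q * \<dots>)) =
          K * (real n powr (- g) * (real n * real n powr (- (1 + d))))"
        unfolding K_def by simp
      also have "real n powr (- g) * (real n * real n powr (- (1 + d))) = real n powr (- (g + d))"
        using elim powr_add[of "real n" 1 "- (1 + d)"] powr_add[of "real n" "- g" "- d"] by simp
      finally show ?case by simp
    qed
  qed
  have "summable (\<lambda>n. K * real n powr (- (g + d)))"
    using g(2) by (intro summable_mult) (simp add: summable_real_powr_iff)
  from summable_comparison_test_ev[OF ev this] have sm: "summable (\<lambda>n. pmf (walk p n) 0)" .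
  have "(\<Sum>n\<le>m. pmf (walk p n) t) \<le> (\<Sum>n. pmf (walk p n) 0)" for m t
    by (rule order_trans[OF green_le_green_origin sum_le_suminf[OF sm]]) auto
  then show ?thesis by blast
qed

lemma expectation_le_partial_sums:
  fixes \<nu> :: "nat pmf"
  assumes g: "\<And>n. 0 \<le> g n" "\<And>n. g n \<le> 1" and le: "\<And>n. pmf \<nu> n * g n \<le> c * h n"
    and h: "\<And>n. 0 \<le> h n" "\<And>m. (\<Sum>n\<le>m. h n) \<le> U" and c: "c \<ge> 0"
  shows "measure_pmf.expectation \<nu> g \<le> c * U"
proof -
  have U0: "U \<ge> 0" using h(1)[of 0] h(2)[of 0] by simp
  have hU: "(\<Sum>n<m. h n) \<le> U" for m
    by (rule order_trans[OF sum_mono2 h(2)[of m]]) (use h(1) in auto)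
  have sm: "summable h" by (rule summableI_nonneg_bounded[OF h(1) hU])
  have "ennreal (measure_pmf.expectation \<nu> g) = (\<integral>\<^sup>+n. ennreal (g n) \<partial>\<nu>)"
    using g by (intro nn_integral_eq_integral[symmetric] integrable_pmf_bounded[where B = 1]) auto
  also have "\<dots> = (\<Sum>n. ennreal (pmf \<nu> n) * ennreal (g n))"
    by (simp add: nn_integral_measure_pmf nn_integral_count_space_nat)
  also have "\<dots> \<le> (\<Sum>n. ennreal (c * h n))"
    using le g by (intro suminf_le) (auto simp flip: ennreal_mult intro!: ennreal_leI)
  also have "\<dots> = ennreal (\<Sum>n. c * h n)"
    using c h(1) by (intro suminf_ennreal2 summable_mult sm) auto
  also have "(\<Sum>n. c * h n) = c * (\<Sum>n. h n)" by (rule suminf_mult[OF sm])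
  also have "ennreal \<dots> \<le> ennreal (c * U)"
    using c by (intro ennreal_leI mult_left_mono suminf_le_const[OF sm hU])
  finally show ?thesis using c U0 by (subst (asm) ennreal_le_iff) auto
qed

lemma positive_drift_asymp:
  fixes p :: "int pmf" and \<nu> :: "nat pmf"
  assumes \<nu>: "integrable (measure_pmf \<nu>) real"
    and \<alpha>: "\<alpha> > 0" and r: "regular_mass (\<lambda>t. pmf p (int t)) \<alpha>" and d: "d > 0" and \<mu>: "\<mu> > 0"
    and mgf: "Q > 0" "\<And>y. y \<ge> 1 \<Longrightarrow> mgf_bound p (\<lambda>x. real_of_int x - \<mu>) y (Q * y powr (- (1 + d)))"
    and U: "\<And>m t. (\<Sum>n\<le>m. pmf (walk p n) t) \<le> U"
    and D: "(\<lambda>n. pmf \<nu> n) \<in> o(\<lambda>n. pmf p (int n))"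
  shows "random_walk_asymp p \<nu>"
proof -
  \<comment> \<open>Below \<open>n = \<eta> * t\<close> one has
    \<open>n * \<mu> \<le> t / 2\<close>, so \<open>u = t - n * \<mu>\<close> satisfies both
    \<open>u \<ge> t / 2\<close> and \<open>n \<le> u / \<mu>\<close>.\<close>
  define \<eta> where "\<eta> = 1 / (2 * \<mu>)"
  have \<eta>: "\<eta> > 0" unfolding \<eta>_def using \<mu> by simp
  obtain C where C: "\<forall>\<^sub>F t in sequentially. \<forall>n.
    real t - real n * \<mu> \<ge> real t / 2 \<and> real n \<le> 1 / \<mu> * (real t - real n * \<mu>) \<longrightarrow>
    pmf (walk p n) (int t) \<le> C * real n * pmf p (int t)"
    using drift_domination[OF \<alpha> r d _ mgf, of "1 / \<mu>"] \<mu> by auto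
  obtain C1 where C1: "C1 > 0" "\<forall>\<^sub>F t in sequentially. \<forall>k. real k \<ge> \<eta> * real t \<longrightarrow> pmf p (int k) \<le> C1 * pmf p (int t)"
    using regular_mass_window[OF r \<alpha> \<eta>] by auto
  define R where "R n t = pmf (walk p n) (int t) * of_bool (real n \<ge> \<eta> * real t)" for n t
  have R01: "0 \<le> R n t" "R n t \<le> 1" for n t unfolding R_def by (auto simp: pmf_le_1)
  have U0: "U \<ge> 0" by (rule order_trans[OF _ U[of 0 0]]) simp
  show ?thesis
  proof (rule random_walk_asympI[OF \<nu> r \<alpha>, where C = "max C 0" and R = R])
    show "\<forall>\<^sub>F t in sequentially. \<forall>n. pmf (walk p n) (int t) \<le> max C 0 * real n * pmf p (int t) + R n t"
      using C
    proof eventually_elim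
      case (elim t)
      show ?case
      proof
        fix n
        show "pmf (walk p n) (int t) \<le> max C 0 * real n * pmf p (int t) + R n t"
        proof (cases "real n \<ge> \<eta> * real t")
          case True
          have "0 \<le> max C 0 * real n * pmf p (int t)" by simp
          then show ?thesis using True unfolding R_def by simp
        next
          case False
          have "real n * \<mu> \<le> \<eta> * real t * \<mu>" using False \<mu> by (intro mult_right_mono) auto
          also have "\<eta> * real t * \<mu> = real t / 2" unfolding \<eta>_def using \<mu> by simp
          finally have h: "real n * \<mu> \<le> real t / 2" .
          then have "real n * \<mu> \<le> real t - real n * \<mu>" by linarith
          then have "real n \<le> 1 / \<mu> * (real t - real n * \<mu>)" using \<mu> by (simp add: field_simps)
          with h elim have "pmf (walk p n) (int t) \<le> C * real n * pmf p (int t)" by auto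
          also have "\<dots> \<le> max C 0 * real n * pmf p (int t)" by (intro mult_right_mono) auto
          finally show ?thesis using R01(1)[of n t] by linarith
        qed
      qed
    qed
    show "integrable (measure_pmf \<nu>) (\<lambda>n. R n t)" for t
      by (rule integrable_pmf_bounded[where B = 1]) (use R01 in auto)
    show "(\<lambda>t. measure_pmf.expectation \<nu> (\<lambda>n. R n t) / pmf p (int t)) \<longlonglongrightarrow> 0"
    proof (rule tendstoI)
      fix e :: real assume e: "e > 0"
      \<comment> \<open>The added \<open>1\<close> keeps the divisor positive when \<open>U\<close>
        is zero.\<close>
      define e' where "e' = e / (2 * (C1 * U + 1))"
      have CU: "C1 * U + 1 > 0" using C1 U0 by (simp add: add_nonneg_pos)
      have e': "e' > 0" unfolding e'_def using e CU by simp
      have "\<forall>\<^sub>F n in sequentially. norm (pmf \<nu> n) \<le> e' * norm (pmf p (int n))"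
        using landau_o.smallD[OF D e'] .
      then obtain n0 where n0: "\<And>n. n \<ge> n0 \<Longrightarrow> pmf \<nu> n \<le> e' * pmf p (int n)"
        by (auto simp: eventually_sequentially)
      have ev: "\<forall>\<^sub>F t in sequentially. \<eta> * real t \<ge> real n0" using \<eta> by real_asymp
      show "\<forall>\<^sub>F t in sequentially. dist (measure_pmf.expectation \<nu> (\<lambda>n. R n t) / pmf p (int t)) 0 < e"
        using C1(2) ev regular_mass_pos[OF r]
      proof eventually_elim
        case (elim t)
        have "measure_pmf.expectation \<nu> (\<lambda>n. R n t) \<le> (e' * (C1 * pmf p (int t))) * U"
        proof (rule expectation_le_partial_sums[OF R01])
          fix n
          show "pmf \<nu> n * R n t \<le> e' * (C1 * pmf p (int t)) * pmf (walk p n) (int t)"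
          proof (cases "real n \<ge> \<eta> * real t")
            case True
            have "n \<ge> n0" using True elim(2) by linarith
            then have "pmf \<nu> n \<le> e' * pmf p (int n)" by (rule n0)
            also have "\<dots> \<le> e' * (C1 * pmf p (int t))" using elim(1) True e' by (intro mult_left_mono) auto
            finally show ?thesis using True unfolding R_def by (auto intro!: mult_right_mono)
          next
            case False
            then show ?thesis unfolding R_def using e' C1 by simp
          qed
        qed (use U e' C1 in auto)
        then have "measure_pmf.expectation \<nu> (\<lambda>n. R n t) / pmf p (int t) \<le> e' * (C1 * U)"
          using elim(3) by (simp add: divide_le_eq mult_ac)
        also have "\<dots> \<le> e' * (C1 * U + 1)" using e' by (intro mult_left_mono) auto
        also have "\<dots> = e / 2" unfolding e'_def using CU by (simp add: field_simps)
        also have "\<dots> < e" using e by simp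
        finally show ?case using R01 by (simp add: dist_real_def integral_nonneg_AE)
      qed
    qed
  qed (use R01 in auto)
qed

section \<open>Zero drift with remainder terms\<close>

text \<open>\<open>\<kappa>\<close> is the power of the logarithm gained in concentration,
  \<open>\<kappa>'\<close> the one asked of the moment: \<open>0\<close> and \<open>2\<close> at the
  index two, \<open>1/2\<close> and \<open>1\<close> at the index three. The threshold
  \<open>t powr b * ln t powr (- (1 + \<epsilon>))\<close> lies slightly below the critical size
  \<open>t powr b\<close>, so that \<open>n * q\<close> stays small up to it in spite of the
  logarithm in \<open>q\<close>. Beyond it, concentration and the moment of \<open>\<nu>\<close>
  together must outweigh the logarithms.\<close>

lemma log_corrected_asymp:
  fixes p :: "int pmf" and \<nu> :: "nat pmf" and b :: real
  assumes \<nu>: "integrable (measure_pmf \<nu>) real" and b: "b > 0"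
    and r: "regular_mass (\<lambda>t. pmf p (int t)) (1 + b)"
    and low: "c0 > 0" "\<forall>\<^sub>F t in sequentially. c0 * real t powr (- (1 + b)) \<le> pmf p (int t)"
    and mgf: "Q > 0" "\<And>y. y \<ge> 1 \<Longrightarrow> mgf_bound p real_of_int y (Q * y powr (- b) * (1 + ln y))"
    and conc: "D > 0" "\<And>n t. n > 1 \<Longrightarrow> pmf (walk p n) t \<le> D * real n powr (- (1 / b)) * ln (real n) powr (- \<kappa>)"
    and \<kappa>: "\<kappa> \<ge> 0" "\<kappa> + \<kappa>' = 1 + 1 / b" and \<tau>: "\<tau> > 0"
    and mom: "integrable (measure_pmf \<nu>) (\<lambda>n. real n * ln (real n) powr (\<kappa>' + \<tau>))"
  shows "random_walk_asymp p \<nu>"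
proof -
  define e1 where "e1 = 1 + 1 / b"
  have e1: "e1 > 1" "b * e1 = 1 + b" using b unfolding e1_def by (auto simp: field_simps)
  \<comment> \<open>\<open>\<epsilon> * e1 = \<tau> / 2\<close> spends one half of the surplus
    \<open>\<tau>\<close> on lowering the threshold and leaves
    \<open>ln t powr (- (\<tau> / 2))\<close> in the remainder.\<close>
  define \<epsilon> where "\<epsilon> = \<tau> / (2 * e1)"
  have \<epsilon>: "\<epsilon> > 0" "\<epsilon> * e1 = \<tau> / 2" unfolding \<epsilon>_def using \<tau> e1 by auto
  \<comment> \<open>\<open>\<epsilon> * (K - e1) = e1\<close> makes the logarithms in
    \<open>h t powr (K - e1)\<close> cancel the factor \<open>ln t powr K\<close> that stems from
    \<open>q\<close>.\<close>
  define K where "K = e1 + e1 / \<epsilon>"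
  have K: "K > 1" "K > 0" "K \<ge> e1" "\<epsilon> * (K - e1) = e1"
  proof -
    have "e1 / \<epsilon> > 0" using e1 \<epsilon> by simp
    then show "K > 1" "K > 0" "K \<ge> e1" unfolding K_def using e1 by linarith+
    show "\<epsilon> * (K - e1) = e1" unfolding K_def using \<epsilon>(1) by simp
  qed
  \<comment> \<open>For the range below the threshold the logarithmic gain is dropped, by
    \<open>ln n \<ge> ln 2\<close>; the summand \<open>1\<close> covers
    \<open>n = 1\<close>.\<close>
  define D1 where "D1 = 1 + D * ln 2 powr (- \<kappa>)"
  have D1: "D1 > 0" unfolding D1_def using conc(1) by (simp add: add_pos_nonneg)
  have conc': "pmf (walk p n) t \<le> D1 * real n powr (- (1 / b))" if n: "n > 0" for n t
  proof (cases "n = 1")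
    case True
    have "pmf (walk p n) t \<le> 1" by (rule pmf_le_1)
    also have "1 \<le> D1" unfolding D1_def using conc(1) by simp
    finally show ?thesis using True by simp
  next
    case False
    then have n1: "n > 1" using n by simp
    have "pmf (walk p n) t \<le> D * real n powr (- (1 / b)) * ln (real n) powr (- \<kappa>)" by (rule conc(2)[OF n1])
    also have "\<dots> \<le> D * real n powr (- (1 / b)) * ln 2 powr (- \<kappa>)"
      using conc(1) n1 \<kappa>(1) by (intro mult_left_mono powr_mono2') auto
    also have "\<dots> \<le> D1 * real n powr (- (1 / b))"
      unfolding D1_def by (simp add: algebra_simps)
    finally show ?thesis .
  qed
  obtain C1 where C1: "C1 > 0" "\<forall>\<^sub>F t in sequentially. \<forall>n>0. \<forall>q>0. real t - real n * 0 \<ge> real t / 2 \<longrightarrow>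
    mgf_bound p (\<lambda>x. real_of_int x - 0) ((real t - real n * 0) / (2 * K)) q \<longrightarrow> real n * q \<le> 1 \<longrightarrow>
    pmf (walk p n) (int t) \<le> C1 * (real n * pmf p (int t) + real n powr (- (1 / b)) * (real n * q) powr K)"
    using walk_deviation_regular[OF _ r K(2) D1 conc', of 0] b by auto
  define A where "A = 2 * Q * (2 * K) powr b"
  have A: "A > 0" unfolding A_def using mgf(1) K by simp
  have AK: "A powr K > 0" using A by simp
  define C3 where "C3 = D * (b / 2) powr (- (e1 + \<tau>))"
  have C3: "C3 > 0" unfolding C3_def using conc(1) b by simp
  define R where "R n t = C3 * real t powr (- (1 + b)) * ln (real t) powr (- (\<tau> / 2)) * (real n * ln (real n) powr (\<kappa>' + \<tau>))"
    for n t :: nat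
  have R0: "R n t \<ge> 0" for n t unfolding R_def using C3 by simp
  define h where "h t = real t powr b * ln (real t) powr (- (1 + \<epsilon>))" for t :: nat
  have evh: "\<forall>\<^sub>F t in sequentially. h t \<ge> real t powr (b / 2)" unfolding h_def using b \<epsilon> by real_asymp
  have evh2: "\<forall>\<^sub>F t in sequentially. real t powr (b / 2) > 2" using b by real_asymp
  have evA: "\<forall>\<^sub>F t in sequentially. A * ln (real t) powr (- \<epsilon>) \<le> 1" using \<epsilon> by real_asymp
  have evy: "\<forall>\<^sub>F t in sequentially. real t / (2 * K) \<ge> 1" using K(2) by real_asymp
  have evl: "\<forall>\<^sub>F t in sequentially. ln (real t) \<ge> 1" by real_asymp
  show ?thesis
  proof (rule random_walk_asympI[OF \<nu> r, where C = "C1 * (1 + A powr K / c0)" and R = R])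
    show "\<forall>\<^sub>F t in sequentially. \<forall>n. pmf (walk p n) (int t) \<le> (C1 * (1 + A powr K / c0)) * real n * pmf p (int t) + R n t"
      using C1(2) low(2) evh evh2 evA evy evl eventually_gt_at_top[of 0]
    proof eventually_elim
      case (elim t)
      let ?y = "real t / (2 * K)" and ?L = "ln (real t)"
      have t0: "real t > 0" using elim by simp
      have y0: "?y > 0" using elim(6) by linarith
      have L1: "?L \<ge> 1" by fact
      have h0: "h t > 0" using elim(3,4) by linarith
      have rt: "real t powr (- (1 + b)) \<le> pmf p (int t) / c0" using elim low(1) by (simp add: field_simps)
      show ?case
      proof
        fix n
        show "pmf (walk p n) (int t) \<le> (C1 * (1 + A powr K / c0)) * real n * pmf p (int t) + R n t"
        proof (cases "n = 0")
          case True
          then show ?thesis using elim R0[of n t] by (simp add: walk_0_pos)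
        next
          case False
          then have n: "n > 0" by simp
          show ?thesis
          proof (cases "real n \<le> h t")
            case True
            let ?q = "A * ?L * real t powr (- b)"
            have L0: "?L > 0" using L1 by linarith
            have q0: "?q > 0" by (intro mult_pos_pos A L0 powr_gt_zero[THEN iffD2]) (use t0 in simp)
            have mq: "mgf_bound p (\<lambda>x. real_of_int x - 0) ?y ?q"
            proof -
              have "?y \<le> real t" using K(1) t0 by (simp add: divide_le_eq)
              then have "ln ?y \<le> ?L" using t0 y0 by (subst ln_le_cancel_iff) auto
              then have "1 + ln ?y \<le> 2 * ?L" using L1 by argo
              then have "Q * ?y powr (- b) * (1 + ln ?y) \<le> Q * ?y powr (- b) * (2 * ?L)"
                using mgf(1) by (intro mult_left_mono) auto
              also have "?y powr (- b) = real t powr (- b) * (2 * K) powr b"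
                using K(2) by (intro powr_divide_minus) auto
              also have "Q * (real t powr (- b) * (2 * K) powr b) * (2 * ?L) = ?q" unfolding A_def by simp
              finally show ?thesis using mgf_bound_mono[OF mgf(2)[OF elim(6)]]
                using K(2) by (simp add: powr_divide_minus)
            qed
            have nq: "real n * ?q \<le> 1"
            proof -
              have "real n * ?q \<le> h t * ?q" using True q0 by (intro mult_right_mono) auto
              also have "\<dots> = A * (real t powr b * real t powr (- b)) * (?L * ?L powr (- (1 + \<epsilon>)))"
                unfolding h_def by simp
              also have "real t powr b * real t powr (- b) = 1" using t0 by (simp flip: powr_add)
              also have "?L * ?L powr (- (1 + \<epsilon>)) = ?L powr (- \<epsilon>)"
                using L1 powr_add[of ?L 1 "- (1 + \<epsilon>)"] by simp
              finally show ?thesis using elim(5) by simp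
            qed
            have "pmf (walk p n) (int t) \<le> C1 * (real n * pmf p (int t) + real n powr (- (1 / b)) * (real n * ?q) powr K)"
              using elim(1) n q0 nq mq by simp
            also have "real n powr (- (1 / b)) * (real n * ?q) powr K \<le> A powr K * real n * real t powr (- (1 + b))"
            proof -
              have "(real n * ?q) powr K = A powr K * real n powr K * ?L powr K * real t powr (- (b * K))"
                using A L1 t0 by (simp add: powr_mult powr_powr)
              then have "real n powr (- (1 / b)) * (real n * ?q) powr K =
                  A powr K * (real n powr (- (1 / b)) * real n powr K) * ?L powr K * real t powr (- (b * K))"
                by simp
              also have "real n powr (- (1 / b)) * real n powr K = real n * real n powr (K - e1)"
                using n powr_add[of "real n" 1 "K - e1"] by (simp add: e1_def flip: powr_add)
              also have "A powr K * (real n * real n powr (K - e1)) * ?L powr K * real t powr (- (b * K)) \<le>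
                  A powr K * (real n * h t powr (K - e1)) * ?L powr K * real t powr (- (b * K))"
                using True K by (intro mult_right_mono mult_left_mono powr_mono2) auto
              also have "h t powr (K - e1) = real t powr (b * (K - e1)) * ?L powr (- (1 + \<epsilon>) * (K - e1))"
                unfolding h_def by (simp only: powr_mult powr_powr)
              also have "- (1 + \<epsilon>) * (K - e1) = - K"
                using K(4) by (simp add: algebra_simps)
              also have "A powr K * (real n * (real t powr (b * (K - e1)) * ?L powr (- K))) * ?L powr K * real t powr (- (b * K))
                 = A powr K * real n * (?L powr (- K) * ?L powr K) * (real t powr (b * (K - e1)) * real t powr (- (b * K)))"
                by (simp only: mult_ac)
              also have "?L powr (- K) * ?L powr K = 1" using L1 by (simp flip: powr_add)
              also have "real t powr (b * (K - e1)) * real t powr (- (b * K)) = real t powr (- (1 + b))"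
                using e1(2) by (simp add: right_diff_distrib flip: powr_add)
              finally show ?thesis by simp
            qed
            also have "A powr K * real n * real t powr (- (1 + b)) \<le> A powr K * real n * (pmf p (int t) / c0)"
              using AK rt by (intro mult_left_mono) auto
            finally have "pmf (walk p n) (int t) \<le> C1 * (real n * pmf p (int t) + A powr K * real n * (pmf p (int t) / c0))"
              using C1(1) by simp
            also have "\<dots> = C1 * (1 + A powr K / c0) * real n * pmf p (int t)" by (simp add: algebra_simps)
            finally show ?thesis using R0[of n t] by linarith
          next
            case False
            then have nh: "real n \<ge> h t" by simp
            have n2: "real n > 2" using nh elim(3,4) by linarith
            have n1: "n > 1" using n2 by simp
            have ln_n: "b / 2 * ?L \<le> ln (real n)"
            proof -
              have "b / 2 * ?L = ln (real t powr (b / 2))" using t0 by (simp add: ln_powr)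
              also have "\<dots> \<le> ln (real n)" using nh elim(3) t0 n by (subst ln_le_cancel_iff) auto
              finally show ?thesis .
            qed
            have bL: "b / 2 * ?L > 0" using b L1 by simp
            have l0: "ln (real n) > 0" using n2 by simp
            have "pmf (walk p n) (int t) \<le> D * real n powr (- (1 / b)) * ln (real n) powr (- \<kappa>)" by (rule conc(2)[OF n1])
            also have "real n powr (- (1 / b)) = real n * real n powr (- e1)"
              using n powr_add[of "real n" 1 "- e1"] by (simp add: e1_def)
            \<comment> \<open>The moment weight is split off; what is left,
              \<open>n powr (- e1) * ln n powr (- (e1 + \<tau>))\<close>, decreases in
              \<open>n\<close> and can be estimated at the threshold.\<close>
            also have "ln (real n) powr (- \<kappa>) = ln (real n) powr (\<kappa>' + \<tau>) * ln (real n) powr (- (e1 + \<tau>))"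
            proof -
              have "- \<kappa> = (\<kappa>' + \<tau>) + - (e1 + \<tau>)" using \<kappa>(2) unfolding e1_def by linarith
              then show ?thesis by (simp only: powr_add)
            qed
            also have "D * (real n * real n powr (- e1)) * (ln (real n) powr (\<kappa>' + \<tau>) * ln (real n) powr (- (e1 + \<tau>)))
              = D * (real n * ln (real n) powr (\<kappa>' + \<tau>)) * (real n powr (- e1) * ln (real n) powr (- (e1 + \<tau>)))"
              by (simp only: mult_ac)
            also have "\<dots> \<le> D * (real n * ln (real n) powr (\<kappa>' + \<tau>)) * (h t powr (- e1) * (b / 2 * ?L) powr (- (e1 + \<tau>)))"
              using conc(1) nh h0 ln_n bL e1 \<tau> by (intro mult_left_mono mult_mono powr_mono2') auto
            also have "h t powr (- e1) = real t powr (- (1 + b)) * ?L powr ((1 + \<epsilon>) * e1)"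
            proof -
              have "b * - e1 = - (1 + b)" using e1(2) by simp
              moreover have "- (1 + \<epsilon>) * - e1 = (1 + \<epsilon>) * e1" by (rule minus_mult_minus)
              ultimately show ?thesis unfolding h_def by (simp only: powr_mult powr_powr)
            qed
            also have "(b / 2 * ?L) powr (- (e1 + \<tau>)) = (b / 2) powr (- (e1 + \<tau>)) * ?L powr (- (e1 + \<tau>))"
              by (rule powr_mult)
            also have "D * (real n * ln (real n) powr (\<kappa>' + \<tau>)) * (real t powr (- (1 + b)) * ?L powr ((1 + \<epsilon>) * e1) * ((b / 2) powr (- (e1 + \<tau>)) * ?L powr (- (e1 + \<tau>))))
              = C3 * real t powr (- (1 + b)) * (?L powr ((1 + \<epsilon>) * e1) * ?L powr (- (e1 + \<tau>))) * (real n * ln (real n) powr (\<kappa>' + \<tau>))"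
              unfolding C3_def by (simp only: mult_ac)
            also have "?L powr ((1 + \<epsilon>) * e1) * ?L powr (- (e1 + \<tau>)) = ?L powr (- (\<tau> / 2))"
            proof -
              have "(1 + \<epsilon>) * e1 + - (e1 + \<tau>) = - (\<tau> / 2)" using \<epsilon>(2) by (simp add: distrib_right)
              then show ?thesis by (simp only: powr_add[symmetric])
            qed
            finally have "pmf (walk p n) (int t) \<le> R n t" unfolding R_def .
            moreover have "0 \<le> (C1 * (1 + A powr K / c0)) * real n * pmf p (int t)" using C1 AK low(1) by simp
            ultimately show ?thesis by linarith
          qed
        qed
      qed
    qed
    show "integrable (measure_pmf \<nu>) (\<lambda>n. R n t)" for t
      unfolding R_def by (intro integrable_mult_right mom)
    define E where "E = measure_pmf.expectation \<nu> (\<lambda>n. real n * ln (real n) powr (\<kappa>' + \<tau>))"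
    have ER: "measure_pmf.expectation \<nu> (\<lambda>n. R n t) = C3 * real t powr (- (1 + b)) * ln (real t) powr (- (\<tau> / 2)) * E" for t
      unfolding R_def E_def by simp
    have E0: "E \<ge> 0" unfolding E_def by (intro integral_nonneg_AE) auto
    show "(\<lambda>t. measure_pmf.expectation \<nu> (\<lambda>n. R n t) / pmf p (int t)) \<longlonglongrightarrow> 0"
    proof (rule tendsto_sandwich[OF _ _ tendsto_const])
      show "\<forall>\<^sub>F t in sequentially. 0 \<le> measure_pmf.expectation \<nu> (\<lambda>n. R n t) / pmf p (int t)"
        by (intro always_eventually allI divide_nonneg_nonneg integral_nonneg_AE) (use R0 in auto)
      show "\<forall>\<^sub>F t in sequentially. measure_pmf.expectation \<nu> (\<lambda>n. R n t) / pmf p (int t) \<le> C3 * E / c0 * ln (real t) powr (- (\<tau> / 2))"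
        using low(2) regular_mass_pos[OF r]
      proof eventually_elim
        case (elim t)
        have "measure_pmf.expectation \<nu> (\<lambda>n. R n t) = (C3 * ln (real t) powr (- (\<tau> / 2)) * E) * real t powr (- (1 + b))"
          unfolding ER by simp
        also have "\<dots> \<le> (C3 * ln (real t) powr (- (\<tau> / 2)) * E) * (pmf p (int t) / c0)"
          using elim low(1) C3 E0 by (intro mult_left_mono) (auto simp: field_simps)
        finally show ?case using elim by (simp add: field_simps)
      qed
      have "(\<lambda>t::nat. ln (real t) powr (- (\<tau> / 2))) \<longlonglongrightarrow> 0" using \<tau> by real_asymp
      from tendsto_mult_right_zero[OF this] show "(\<lambda>t::nat. C3 * E / c0 * ln (real t) powr (- (\<tau> / 2))) \<longlonglongrightarrow> 0" .
    qed
  qed (use R0 b in auto)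
qed

text \<open>The rounded-up root of \<open>n\<close> exceeds \<open>j\<close> exactly when
  \<open>n > j^2\<close>, so summation by parts leads to \<open>t^(-k)\<close> times a sum of
  \<open>j^(k-1)\<close> against the tail of \<open>\<nu>\<close> at \<open>j^2\<close>, over
  \<open>j < t\<close>. By the tail hypothesis and Potter the summand is a small multiple of
  \<open>j powr (k - \<alpha> - 1) * t powr (\<alpha> + 1) * r t\<close>; since
  \<open>k > \<alpha> + 1\<close> this is largest at \<open>j = t\<close>, and the total is a small
  multiple of \<open>t * r t\<close>.\<close>

lemma truncated_power_moment:
  fixes \<nu> :: "nat pmf" and r :: "nat \<Rightarrow> real" and k :: nat
  assumes r: "regular_mass r \<alpha>" and k: "real k > \<alpha> + 1" and \<alpha>: "\<alpha> > 0"
    and tail: "(\<lambda>t. measure (measure_pmf \<nu>) {n. real n > (real t)\<^sup>2}) \<in> o(\<lambda>t. real t * r t)"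
  shows "(\<lambda>t. measure_pmf.expectation \<nu> (\<lambda>n. (real (min (nat \<lceil>sqrt (real n)\<rceil>) t) / real t) ^ k) / (real t * r t)) \<longlonglongrightarrow> 0"
proof -
  define Z where "Z n = nat \<lceil>sqrt (real n)\<rceil>" for n
  define P where "P j = measure (measure_pmf \<nu>) {n. real n > (real j)\<^sup>2}" for j :: nat
  have P01: "0 \<le> P j" "P j \<le> 1" for j unfolding P_def by (auto simp: measure_pmf.prob_le_1)
  have Zgt: "Z n > j \<longleftrightarrow> real n > (real j)\<^sup>2" for n j
  proof -
    have "Z n > j \<longleftrightarrow> sqrt (real n) > real j" unfolding Z_def by linarith
    also have "\<dots> \<longleftrightarrow> real n > (real j)\<^sup>2"
      using real_less_rsqrt[of "real j" "real n"] real_sqrt_less_iff[of "(real j)\<^sup>2" "real n"] by auto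
    finally show ?thesis .
  qed
  have k1: "k \<ge> 1" using k \<alpha> by (cases k) auto
  define F where "F t j = (real (min j t) / real t) ^ k" for t j :: nat
  have step: "(F t (Suc j) - F t j) * P j \<le> real k * 2 ^ (k - 1) / real t ^ k * (real j ^ (k - 1) + 1) * P j" if "t > 0" "j < t" for t j
  proof (rule mult_right_mono)
    have "real (Suc j) ^ k - real j ^ k \<le> real k * real (Suc j) ^ (k - 1)"
    proof -
      have "real (Suc j) ^ k - real j ^ k = (real (Suc j) - real j) * (\<Sum>i<k. real j ^ (k - Suc i) * real (Suc j) ^ i)"
        by (rule power_diff_sumr2)
      also have "\<dots> = (\<Sum>i<k. real j ^ (k - Suc i) * real (Suc j) ^ i)" by simp
      also have "\<dots> \<le> (\<Sum>i<k. real (Suc j) ^ (k - 1))"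
      proof (rule sum_mono)
        fix i assume "i \<in> {..<k}"
        then have "k - 1 = (k - Suc i) + i" by simp
        then have "real (Suc j) ^ (k - 1) = real (Suc j) ^ (k - Suc i) * real (Suc j) ^ i" by (metis power_add)
        then show "real j ^ (k - Suc i) * real (Suc j) ^ i \<le> real (Suc j) ^ (k - 1)"
          by (simp add: mult_left_mono power_mono)
      qed
      finally show ?thesis by simp
    qed
    also have "real k * real (Suc j) ^ (k - 1) \<le> real k * (2 ^ (k - 1) * (real j ^ (k - 1) + 1))"
    proof (rule mult_left_mono)
      show "real (Suc j) ^ (k - 1) \<le> 2 ^ (k - 1) * (real j ^ (k - 1) + 1)"
      proof (cases "j = 0")
        case False
        have "real (Suc j) ^ (k - 1) \<le> (2 * real j) ^ (k - 1)" using False by (intro power_mono) auto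
        also have "\<dots> = 2 ^ (k - 1) * real j ^ (k - 1)" by (rule power_mult_distrib)
        also have "\<dots> \<le> 2 ^ (k - 1) * (real j ^ (k - 1) + 1)" by (intro mult_left_mono) auto
        finally show ?thesis .
      qed (auto intro: mult_ge1_I)
    qed auto
    finally have "real (Suc j) ^ k - real j ^ k \<le> real k * (2 ^ (k - 1) * (real j ^ (k - 1) + 1))"
      by (simp add: mult_left_mono)
    then have "(real (Suc j) ^ k - real j ^ k) / real t ^ k \<le> real k * (2 ^ (k - 1) * (real j ^ (k - 1) + 1)) / real t ^ k"
      by (intro divide_right_mono) auto
    moreover have "F t (Suc j) - F t j = (real (Suc j) ^ k - real j ^ k) / real t ^ k"
      using that unfolding F_def by (simp add: power_divide diff_divide_distrib)
    ultimately show "F t (Suc j) - F t j \<le> real k * 2 ^ (k - 1) / real t ^ k * (real j ^ (k - 1) + 1)"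
      by simp
  qed (rule P01)
  have EF: "measure_pmf.expectation \<nu> (\<lambda>n. F t (Z n)) \<le> (\<Sum>j<t. real k * 2 ^ (k - 1) / real t ^ k * (real j ^ (k - 1) + 1) * P j)"
    if t: "t > 0" for t
  proof -
    have z: "(F t (Suc j) - F t j) * P j = 0" if "j \<ge> t" for j using that unfolding F_def by simp
    have "measure_pmf.expectation \<nu> (\<lambda>n. F t (Z n)) \<le> (\<Sum>j. (F t (Suc j) - F t j) * P j)"
    proof (rule expectation_abel(2))
      show "F t 0 = 0" using k1 by (simp add: F_def)
      show "F t j \<le> F t (Suc j)" for j unfolding F_def by (intro power_mono divide_right_mono) auto
      show "summable (\<lambda>j. (F t (Suc j) - F t j) * P j)" by (rule summable_finite[of "{..<t}"]) (use z in auto)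
    qed (simp add: Zgt P_def)
    also have "\<dots> = (\<Sum>j<t. (F t (Suc j) - F t j) * P j)" by (rule suminf_finite) (use z in auto)
    also have "\<dots> \<le> (\<Sum>j<t. real k * 2 ^ (k - 1) / real t ^ k * (real j ^ (k - 1) + 1) * P j)"
      by (intro sum_mono step t) auto
    finally show ?thesis .
  qed
  obtain C T where C: "C > 0" and T: "T > 0"
    and dn: "\<And>s t. T \<le> s \<Longrightarrow> s \<le> t \<Longrightarrow> r s \<le> C * (real t / real s) powr (\<alpha> + 1) * r t"
    and pos: "\<And>t. T \<le> t \<Longrightarrow> r t > 0"
    by (rule regular_massE[OF r zero_less_one]) blast
  obtain c0 where c0: "c0 > 0" "\<forall>\<^sub>F t in sequentially. r t \<ge> c0 * real t powr (- (\<alpha> + 1))"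
    using regular_mass_lower[OF r zero_less_one] by auto
  define W where "W = real k * 2 ^ (k - 1)"
  have W: "W > 0" unfolding W_def using k1 by simp
  have "(\<lambda>t. measure_pmf.expectation \<nu> (\<lambda>n. F t (Z n)) / (real t * r t)) \<longlonglongrightarrow> 0"
  proof (rule tendstoI)
    fix e :: real assume e: "e > 0"
    \<comment> \<open>Adjusted so that the part from large \<open>j\<close> is
      \<open>2 * W * C * e' = e / 4\<close>.\<close>
    define e' where "e' = e / (8 * W * C)"
    have e': "e' > 0" unfolding e'_def using e W C by simp
    have "\<forall>\<^sub>F j in sequentially. norm (P j) \<le> e' * norm (real j * r j)"
      using landau_o.smallD[OF tail e'] unfolding P_def .
    then obtain j1 where j1: "\<And>j. j \<ge> j1 \<Longrightarrow> \<bar>P j\<bar> \<le> e' * \<bar>real j * r j\<bar>"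
      by (auto simp: eventually_sequentially)
    define j0 where "j0 = max j1 T"
    have Pj: "P j \<le> e' * (real j * r j)" if "j \<ge> j0" for j
      using j1[of j] pos[of j] that P01[of j] unfolding j0_def by simp
    \<comment> \<open>The finitely many \<open>j < j0\<close> cost a constant, hence order
      \<open>t^(-k)\<close> after scaling; this is negligible because \<open>t * r t\<close> is at
      least of order \<open>t powr (- \<alpha>)\<close>.\<close>
    define A where "A = real j0 * (real j0 ^ (k - 1) + 1)"
    have "\<forall>\<^sub>F t in sequentially. W * A / c0 * real t powr (\<alpha> - real k) < e / 2"
    proof -
      have "(\<lambda>t::nat. real t powr (\<alpha> - real k)) \<longlonglongrightarrow> 0" using k by real_asymp
      from tendsto_mult_right_zero[OF this, of "W * A / c0"] show ?thesis
        by (rule order_tendstoD) (use e in auto)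
    qed
    then show "\<forall>\<^sub>F t in sequentially. dist (measure_pmf.expectation \<nu> (\<lambda>n. F t (Z n)) / (real t * r t)) 0 < e"
      using eventually_ge_at_top[of "max j0 1"] c0(2)
    proof eventually_elim
      case (elim t)
      have t: "t > 0" "t \<ge> j0" using elim by auto
      have t0: "real t > 0" using t by simp
      have rt: "r t > 0" using pos[of t] t unfolding j0_def by simp
      let ?B = "e' * 2 * C * real t ^ k * r t"
      have big: "(real j ^ (k - 1) + 1) * P j \<le> ?B" if j: "j0 \<le> j" "j < t" for j
      proof -
        have jT: "T \<le> j" "j > 0" using j T unfolding j0_def by auto
        have "real j ^ (k - 1) + 1 \<le> 2 * real j ^ (k - 1)" using jT by simp
        then have "(real j ^ (k - 1) + 1) * P j \<le> 2 * real j ^ (k - 1) * (e' * (real j * r j))"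
          using Pj[OF j(1)] P01 by (intro mult_mono) auto
        also have "\<dots> = 2 * e' * (real j ^ (k - 1) * real j) * r j" by simp
        also have "real j ^ (k - 1) * real j = real j ^ k" using k1 by (cases k) auto
        also have "2 * e' * real j ^ k * r j \<le> 2 * e' * real j ^ k * (C * (real t / real j) powr (\<alpha> + 1) * r t)"
          using dn[OF jT(1), of t] j e' by (intro mult_left_mono) auto
        also have "\<dots> = 2 * e' * C * (real j ^ k * (real t / real j) powr (\<alpha> + 1)) * r t" by simp
        also have "real j ^ k * (real t / real j) powr (\<alpha> + 1) = real j powr (real k - (\<alpha> + 1)) * real t powr (\<alpha> + 1)"
          using jT by (simp add: powr_divide powr_diff powr_realpow)
        also have "2 * e' * C * (real j powr (real k - (\<alpha> + 1)) * real t powr (\<alpha> + 1)) * r t \<le>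
            2 * e' * C * (real t powr (real k - (\<alpha> + 1)) * real t powr (\<alpha> + 1)) * r t"
          using e' C rt j k by (intro mult_right_mono mult_left_mono powr_mono2) auto
        also have "real t powr (real k - (\<alpha> + 1)) * real t powr (\<alpha> + 1) = real t ^ k"
          using t0 by (simp add: powr_realpow flip: powr_add)
        finally show ?thesis by (simp add: mult_ac)
      qed
      have "(\<Sum>j<t. (real j ^ (k - 1) + 1) * P j) \<le> (\<Sum>j<t. ?B + (if j < j0 then real j0 ^ (k - 1) + 1 else 0))"
      proof (rule sum_mono)
        fix j assume j: "j \<in> {..<t}"
        show "(real j ^ (k - 1) + 1) * P j \<le> ?B + (if j < j0 then real j0 ^ (k - 1) + 1 else 0)"
        proof (cases "j < j0")
          case True
          have "(real j ^ (k - 1) + 1) * P j \<le> (real j0 ^ (k - 1) + 1) * 1"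
            using True P01 by (intro mult_mono add_mono power_mono) auto
          moreover have "0 \<le> ?B" using e' C rt by simp
          ultimately have "0 + (real j ^ (k - 1) + 1) * P j \<le> ?B + (real j0 ^ (k - 1) + 1) * 1"
            by (intro add_mono)
          then show ?thesis using True by simp
        next
          case False
          then show ?thesis using big[of j] j by simp
        qed
      qed
      also have "\<dots> = real t * ?B + (\<Sum>j<t. if j < j0 then real j0 ^ (k - 1) + 1 else 0)"
        by (simp add: sum.distrib)
      also have "(\<Sum>j<t. if j < j0 then real j0 ^ (k - 1) + 1 else 0) = (\<Sum>j<j0. real j0 ^ (k - 1) + 1)"
        using t by (intro sum.mono_neutral_cong_right) auto
      also have "\<dots> = A" unfolding A_def by simp
      finally have S: "(\<Sum>j<t. (real j ^ (k - 1) + 1) * P j) \<le> real t * ?B + A" .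
      have "measure_pmf.expectation \<nu> (\<lambda>n. F t (Z n)) \<le> W / real t ^ k * (\<Sum>j<t. (real j ^ (k - 1) + 1) * P j)"
        using EF[OF t(1)] unfolding W_def by (simp add: sum_distrib_left mult.assoc)
      also have "\<dots> \<le> W / real t ^ k * (real t * ?B + A)"
        using S W by (intro mult_left_mono) auto
      also have "\<dots> = 2 * W * C * e' * (real t * r t) + W * A / real t ^ k"
        using t0 by (simp add: field_simps)
      finally have "measure_pmf.expectation \<nu> (\<lambda>n. F t (Z n)) / (real t * r t) \<le>
          (2 * W * C * e' * (real t * r t) + W * A / real t ^ k) / (real t * r t)"
        using t0 rt by (intro divide_right_mono) auto
      also have "\<dots> = 2 * W * C * e' + W * A / real t ^ k / (real t * r t)"
        using t0 rt by (simp add: add_divide_distrib)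
      also have "2 * W * C * e' = e / 4" unfolding e'_def using W C by simp
      also have "W * A / real t ^ k / (real t * r t) \<le> W * A / real t ^ k / (real t * (c0 * real t powr (- (\<alpha> + 1))))"
      proof (intro divide_left_mono mult_left_mono elim)
        show "0 \<le> W * A / real t ^ k" using W unfolding A_def by simp
      qed (use t0 rt c0 in auto)
      also have "\<dots> = W * A / c0 * (real t powr (\<alpha> + 1) / (real t * real t ^ k))"
        unfolding powr_minus_divide using t0 by (simp add: field_simps)
      also have "real t powr (\<alpha> + 1) / (real t * real t ^ k) = real t powr (\<alpha> - real k)"
        using t0 by (simp add: powr_add powr_diff powr_realpow)
      finally have "measure_pmf.expectation \<nu> (\<lambda>n. F t (Z n)) / (real t * r t) < e"
        using elim(1) e by linarith
      moreover have "0 \<le> measure_pmf.expectation \<nu> (\<lambda>n. F t (Z n)) / (real t * r t)"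
        using t0 rt by (intro divide_nonneg_nonneg integral_nonneg_AE) (auto simp: F_def)
      ultimately show ?case by (simp add: dist_real_def)
    qed
  qed
  then show ?thesis unfolding F_def Z_def .
qed

text \<open>Here \<open>n * q\<close> is a multiple of \<open>n / t^2\<close>. With
  \<open>2 * K = k + 1\<close>, one of the \<open>k + 1\<close> factors \<open>sqrt n / t\<close>
  combines with the concentration factor \<open>1 / sqrt n\<close> to \<open>1 / t\<close>, and
  \<open>(sqrt n / t)^k / t\<close> remains. For \<open>n\<close> beyond \<open>t^2 / C0\<close>,
  concentration is at most of order \<open>1 / t\<close> and the truncated ratio in \<open>G\<close>
  is bounded below, so both ranges share the remainder \<open>R\<close>.\<close>

lemma finite_variance_asymp:
  fixes p :: "int pmf" and \<nu> :: "nat pmf"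
  assumes \<nu>: "integrable (measure_pmf \<nu>) real" and \<alpha>: "\<alpha> > 0"
    and r: "regular_mass (\<lambda>t. pmf p (int t)) \<alpha>"
    and mgf: "Q \<ge> 1" "\<And>y. y \<ge> 1 \<Longrightarrow> mgf_bound p real_of_int y (Q * y powr (- 2))"
    and conc: "D > 0" "\<And>n t. n > 0 \<Longrightarrow> pmf (walk p n) t \<le> D * real n powr (- (1 / 2))"
    and tail: "(\<lambda>t. measure (measure_pmf \<nu>) {n. real n > (real t)\<^sup>2}) \<in> o(\<lambda>t. real t * pmf p (int t))"
  shows "random_walk_asymp p \<nu>"
proof -
  \<comment> \<open>A natural exponent above \<open>\<alpha> + 1\<close>, as
    \<open>truncated_power_moment\<close> requires.\<close>
  define k where "k = nat \<lceil>\<alpha> + 2\<rceil>"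
  have k: "real k > \<alpha> + 1" "real k \<ge> 1" unfolding k_def using \<alpha> by linarith+
  define K where "K = (real k + 1) / 2"
  have K: "K \<ge> 1" "K > 0" unfolding K_def using k by auto
  obtain C1 where C1: "C1 > 0" "\<forall>\<^sub>F t in sequentially. \<forall>n>0. \<forall>q>0. real t - real n * 0 \<ge> real t / 2 \<longrightarrow>
    mgf_bound p (\<lambda>x. real_of_int x - 0) ((real t - real n * 0) / (2 * K)) q \<longrightarrow> real n * q \<le> 1 \<longrightarrow>
    pmf (walk p n) (int t) \<le> C1 * (real n * pmf p (int t) + real n powr (- (1 / 2)) * (real n * q) powr K)"
    using walk_deviation_regular[OF \<alpha> r K(2) conc, of 0] by auto
  define C0 where "C0 = Q * (2 * K)\<^sup>2"
  have C0: "C0 \<ge> 1"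
  proof -
    have "1 \<le> (2 * K)\<^sup>2" using K by (intro one_le_power) auto
    then show ?thesis unfolding C0_def using mgf(1) mult_mono[of 1 Q 1 "(2 * K)\<^sup>2"] by simp
  qed
  define C2 where "C2 = C1 * C0 powr K"
  define C3 where "C3 = D * sqrt C0 * sqrt C0 ^ k"
  have C23: "C2 > 0" "C3 > 0" unfolding C2_def C3_def using C1 C0 conc(1) by auto
  define G where "G n t = (real (min (nat \<lceil>sqrt (real n)\<rceil>) t) / real t) ^ k" for n t :: nat
  define R where "R n t = (C2 + C3) / real t * G n t" for n t :: nat
  have G01: "0 \<le> G n t" "G n t \<le> 1" for n t
    unfolding G_def by (auto intro!: power_le_one simp: divide_le_eq_1)
  have evy: "\<forall>\<^sub>F t in sequentially. real t / (2 * K) \<ge> 1" using K(2) by real_asymp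
  show ?thesis
  proof (rule random_walk_asympI[OF \<nu> r \<alpha>, where C = C1 and R = R])
    show "\<forall>\<^sub>F t in sequentially. \<forall>n. pmf (walk p n) (int t) \<le> C1 * real n * pmf p (int t) + R n t"
      using C1(2) evy eventually_gt_at_top[of 0]
    proof eventually_elim
      case (elim t)
      let ?y = "real t / (2 * K)"
      have t0: "real t > 0" using elim by simp
      have y0: "?y > 0" using elim(2) by linarith
      let ?q = "Q * ?y powr (- 2)"
      have qe: "?q = C0 / (real t)\<^sup>2"
        unfolding C0_def powr_minus_divide using t0 K by (simp add: powr_numeral power_divide)
      have q0: "?q > 0" unfolding qe using C0 t0 by simp
      show ?case
      proof
        fix n
        show "pmf (walk p n) (int t) \<le> C1 * real n * pmf p (int t) + R n t"
        proof (cases "n = 0")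
          case True
          then show ?thesis using elim C23 G01[of n t] by (simp add: walk_0_pos R_def)
        next
          case False
          then have n: "n > 0" by simp
          show ?thesis
          proof (cases "real n * ?q \<le> 1")
            case True
            have nt: "real n \<le> (real t)\<^sup>2"
            proof -
              have "real n * 1 \<le> real n * C0" using C0 by (intro mult_left_mono) auto
              also have "\<dots> \<le> (real t)\<^sup>2" using True t0 unfolding qe by (simp add: divide_le_eq)
              finally show ?thesis by simp
            qed
            then have st: "sqrt (real n) \<le> real t" using t0 by (simp add: real_le_lsqrt)
            have sG: "(sqrt (real n) / real t) ^ k \<le> G n t"
            proof -
              have "sqrt (real n) \<le> real (min (nat \<lceil>sqrt (real n)\<rceil>) t)"
                using st by (auto simp: min_def)
              then show ?thesis unfolding G_def by (intro power_mono divide_right_mono) auto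
            qed
            have "pmf (walk p n) (int t) \<le> C1 * (real n * pmf p (int t) + real n powr (- (1 / 2)) * (real n * ?q) powr K)"
              using elim(1) n q0 True mgf(2)[OF elim(2)] by simp
            also have "C1 * (real n * pmf p (int t) + real n powr (- (1 / 2)) * (real n * ?q) powr K) =
                C1 * real n * pmf p (int t) + C2 / real t * (sqrt (real n) / real t) ^ k"
            proof -
              define x where "x = sqrt (real n)"
              have x0: "x > 0" unfolding x_def using n by simp
              have nx: "real n = x\<^sup>2" unfolding x_def by simp
              have "real n * ?q = C0 * (x / real t)\<^sup>2" unfolding qe nx by (simp add: power_divide)
              then have "(real n * ?q) powr K = C0 powr K * ((x / real t)\<^sup>2) powr K" by (simp only: powr_mult)
              also have "((x / real t)\<^sup>2) powr K = (x / real t) powr (real k + 1)"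
              proof -
                have "(x / real t)\<^sup>2 = (x / real t) powr 2" using x0 t0 by (simp add: powr_numeral)
                moreover have "2 * K = real k + 1" unfolding K_def by simp
                ultimately show ?thesis by (simp only: powr_powr)
              qed
              also have "\<dots> = (x / real t) ^ k * (x / real t)" using x0 t0 by (simp add: powr_add powr_realpow)
              finally have e: "(real n * ?q) powr K = C0 powr K * ((x / real t) ^ k * (x / real t))" .
              have "real n powr (- (1 / 2)) = 1 / x"
                unfolding powr_minus_divide x_def by (simp add: powr_half_sqrt)
              then show ?thesis unfolding e C2_def x_def[symmetric] using x0 by (simp add: algebra_simps)
            qed
            also have "C2 / real t * (sqrt (real n) / real t) ^ k \<le> R n t"
            proof -
              have "C2 / real t * (sqrt (real n) / real t) ^ k \<le> (C2 + C3) / real t * G n t"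
                using sG C23 t0 by (intro mult_mono divide_right_mono) auto
              then show ?thesis unfolding R_def .
            qed
            finally show ?thesis by (simp add: mult_ac)
          next
            case False
            then have nC: "real n * C0 > (real t)\<^sup>2" unfolding qe using t0 by (simp add: field_simps)
            then have "sqrt ((real t)\<^sup>2) \<le> sqrt (real n * C0)" by (intro real_sqrt_le_mono) auto
            then have s: "real t \<le> sqrt (real n) * sqrt C0" using t0 by (simp add: real_sqrt_mult)
            have sC: "sqrt C0 \<ge> 1" using C0 by simp
            have "1 / sqrt C0 \<le> real (min (nat \<lceil>sqrt (real n)\<rceil>) t) / real t"
            proof (cases "nat \<lceil>sqrt (real n)\<rceil> \<le> t")
              case True
              have "sqrt (real n) \<le> real (nat \<lceil>sqrt (real n)\<rceil>)" by linarith
              then have "sqrt (real n) * sqrt C0 \<le> real (nat \<lceil>sqrt (real n)\<rceil>) * sqrt C0"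
                using C0 by (intro mult_right_mono) auto
              with s have "real t \<le> real (nat \<lceil>sqrt (real n)\<rceil>) * sqrt C0" by linarith
              then show ?thesis using True t0 C0 by (simp add: field_simps)
            next
              case False
              then show ?thesis using t0 sC C0 by (simp add: min_def divide_le_eq)
            qed
            then have "(1 / sqrt C0) ^ k \<le> G n t" unfolding G_def using C0 by (intro power_mono) auto
            then have G1: "1 \<le> sqrt C0 ^ k * G n t" using C0 by (simp add: power_divide divide_le_eq mult.commute)
            have "pmf (walk p n) (int t) \<le> D * real n powr (- (1 / 2))" by (rule conc(2)[OF n])
            also have "real n powr (- (1 / 2)) = 1 / sqrt (real n)"
              unfolding powr_minus_divide by (simp add: powr_half_sqrt)
            also have "1 / sqrt (real n) \<le> sqrt C0 / real t" using s n t0 by (simp add: field_simps)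
            also have "D * (sqrt C0 / real t) \<le> D * (sqrt C0 / real t) * (sqrt C0 ^ k * G n t)"
              using mult_left_mono[OF G1, of "D * (sqrt C0 / real t)"] conc(1) t0 C0 by simp
            finally have "pmf (walk p n) (int t) \<le> C3 / real t * G n t"
              unfolding C3_def using conc(1) by (simp add: mult_ac)
            also have "\<dots> \<le> R n t" unfolding R_def using C23 t0 G01 by (intro mult_right_mono divide_right_mono) auto
            finally show ?thesis using C1 by (simp add: add_increasing)
          qed
        qed
      qed
    qed
    show "integrable (measure_pmf \<nu>) (\<lambda>n. R n t)" for t
      unfolding R_def by (intro integrable_mult_right integrable_pmf_bounded[where B = 1]) (use G01 in auto)
    have "(\<lambda>t. (C2 + C3) * (measure_pmf.expectation \<nu> (\<lambda>n. G n t) / (real t * pmf p (int t)))) \<longlonglongrightarrow> (C2 + C3) * 0"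
      unfolding G_def by (intro tendsto_mult_left truncated_power_moment[OF r k(1) \<alpha> tail])
    then show "(\<lambda>t. measure_pmf.expectation \<nu> (\<lambda>n. R n t) / pmf p (int t)) \<longlonglongrightarrow> 0"
      unfolding R_def by simp
  qed (use G01 C23 in \<open>auto simp: R_def\<close>)
qed

section \<open>The ranges of the tail index\<close>

lemma eventual_powr_bound:
  fixes f :: "nat \<Rightarrow> real"
  assumes f1: "\<And>k. f k \<le> 1" and b: "b \<ge> 0" and ev: "\<forall>\<^sub>F k in sequentially. f k \<le> C * real (Suc k) powr (- b)"
  shows "\<exists>C>0. \<forall>k. f k \<le> C * real (Suc k) powr (- b)"
proof -
  obtain T where T: "\<And>k. k \<ge> T \<Longrightarrow> f k \<le> C * real (Suc k) powr (- b)" using ev by (auto simp: eventually_sequentially)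
  define D where "D = max C (real (Suc T) powr b)"
  have "f k \<le> D * real (Suc k) powr (- b)" for k
  proof (cases "k \<ge> T")
    case True
    have "f k \<le> C * real (Suc k) powr (- b)" by (rule T[OF True])
    also have "\<dots> \<le> D * real (Suc k) powr (- b)" by (intro mult_right_mono) (auto simp: D_def)
    finally show ?thesis .
  next
    case False
    have "1 = real (Suc T) powr b * real (Suc T) powr (- b)" by (simp flip: powr_add)
    also have "\<dots> \<le> D * real (Suc k) powr (- b)"
    proof (intro mult_mono powr_mono2')
      show "real (Suc T) powr b \<le> D" by (simp add: D_def)
      then show "0 \<le> D" by (rule order_trans[OF powr_ge_zero])
    qed (use False b in auto)
    finally show ?thesis using f1[of k] by linarith
  qed
  moreover have "D > 0" by (simp add: D_def less_max_iff_disj)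
  ultimately show ?thesis by blast
qed

lemma right_tail_bound:
  fixes p :: "int pmf"
  assumes \<alpha>: "\<alpha> > 1" and up: "\<forall>\<^sub>F k in sequentially. pmf p (int k) \<le> A * real k powr (- \<alpha>)"
  shows "\<exists>C>0. \<forall>k. measure (measure_pmf p) {x. nat x > k} \<le> C * real (Suc k) powr (- (\<alpha> - 1))"
proof -
  obtain k0 where k0: "\<And>k. k \<ge> k0 \<Longrightarrow> pmf p (int k) \<le> A * real k powr (- \<alpha>)" using up by (auto simp: eventually_sequentially)
  define A' where "A' = max A 0"
  have A': "A' \<ge> 0" by (simp add: A'_def)
  have k0': "pmf p (int k) \<le> A' * real k powr (- \<alpha>)" if "k \<ge> k0" for k
    by (rule order_trans[OF k0[OF that] mult_right_mono]) (auto simp: A'_def)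
  have tail: "measure (measure_pmf p) {x. nat x > k} \<le> A' / (\<alpha> - 1) * 2 powr (\<alpha> - 1) * real (Suc k) powr (- (\<alpha> - 1))"
    if k: "k \<ge> max k0 1" for k
  proof -
    have sm: "summable (\<lambda>j. A' * real (Suc (j + k)) powr (- \<alpha>))"
      using summable_ignore_initial_segment[OF tail_powr_le(1)[of \<alpha> 1], of k] \<alpha> by (intro summable_mult) auto
    have "{x. nat x > k} = range (\<lambda>j. int (Suc (j + k)))"
    proof
      show "{x. nat x > k} \<subseteq> range (\<lambda>j. int (Suc (j + k)))"
      proof
        fix x assume "x \<in> {x. nat x > k}"
        then have "x = int (Suc ((nat x - Suc k) + k))" by auto
        then show "x \<in> range (\<lambda>j. int (Suc (j + k)))" by blast
      qed
    qed auto
    then have "ennreal (measure (measure_pmf p) {x. nat x > k}) = emeasure (measure_pmf p) (range (\<lambda>j. int (Suc (j + k))))"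
      by (simp add: measure_pmf.emeasure_eq_measure)
    also have "\<dots> = (\<integral>\<^sup>+j. pmf p (int (Suc (j + k))) \<partial>count_space UNIV)"
      by (rule nn_integral_pmf'[symmetric]) (auto simp: inj_on_def)
    also have "\<dots> = (\<Sum>j. ennreal (pmf p (int (Suc (j + k)))))" by (rule nn_integral_count_space_nat)
    also have "\<dots> \<le> (\<Sum>j. ennreal (A' * real (Suc (j + k)) powr (- \<alpha>)))"
      using k by (intro suminf_le ennreal_leI k0') auto
    also have "\<dots> = ennreal (\<Sum>j. A' * real (Suc (j + k)) powr (- \<alpha>))"
      using A' by (intro suminf_ennreal2 sm) auto
    also have "(\<Sum>j. A' * real (Suc (j + k)) powr (- \<alpha>)) = A' * (\<Sum>j. real (Suc (j + k)) powr (- \<alpha>))"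
      using summable_ignore_initial_segment[OF tail_powr_le(1)[of \<alpha> 1], of k] \<alpha> by (intro suminf_mult) auto
    also have "ennreal \<dots> \<le> ennreal (A' * (1 / (\<alpha> - 1) * real k powr (1 - \<alpha>)))"
      using A' \<alpha> k by (intro ennreal_leI mult_left_mono tail_powr_le(2)) auto
    finally have "measure (measure_pmf p) {x. nat x > k} \<le> A' * (1 / (\<alpha> - 1) * real k powr (1 - \<alpha>))"
      using A' \<alpha> by (subst (asm) ennreal_le_iff) auto
    also have "\<dots> \<le> A' * (1 / (\<alpha> - 1) * (real (Suc k) / 2) powr (- (\<alpha> - 1)))"
      using k \<alpha> A' powr_mono2'[of "1 - \<alpha>" "real (Suc k) / 2" "real k"] by (intro mult_left_mono) auto
    also have "(real (Suc k) / 2) powr (- (\<alpha> - 1)) = real (Suc k) powr (- (\<alpha> - 1)) * 2 powr (\<alpha> - 1)" by (rule powr_divide_minus) auto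
    finally show ?thesis by (simp add: mult_ac)
  qed
  show ?thesis
  proof (rule eventual_powr_bound)
    show "\<forall>\<^sub>F k in sequentially. measure (measure_pmf p) {x. nat x > k} \<le> A' / (\<alpha> - 1) * 2 powr (\<alpha> - 1) * real (Suc k) powr (- (\<alpha> - 1))"
      using eventually_ge_at_top[of "max k0 1"] by eventually_elim (rule tail)
  qed (use \<alpha> in \<open>auto simp: measure_pmf.prob_le_1\<close>)
qed

lemma two_sided_tail_bound:
  fixes p :: "int pmf"
  assumes b: "b \<ge> 0" and R: "\<And>k. measure (measure_pmf p) {x. nat x > k} \<le> C * real (Suc k) powr (- b)"
    and B: "(\<lambda>t::nat. measure (measure_pmf p) {x. x < - int t}) \<in> O(\<lambda>t. measure (measure_pmf p) {x. x > int t})"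
  shows "\<exists>C>0. \<forall>k. measure (measure_pmf p) {x. nat \<bar>x\<bar> > k} \<le> C * real (Suc k) powr (- b)"
proof -
  obtain c where c: "c > 0" "\<forall>\<^sub>F t in sequentially. norm (measure (measure_pmf p) {x. x < - int t}) \<le> c * norm (measure (measure_pmf p) {x. x > int t})"
    using landau_o.bigE[OF B] by blast
  show ?thesis
  proof (rule eventual_powr_bound)
    show "\<forall>\<^sub>F k in sequentially. measure (measure_pmf p) {x. nat \<bar>x\<bar> > k} \<le> (1 + c) * C * real (Suc k) powr (- b)"
      using c(2)
    proof eventually_elim
      case (elim k)
      have eq: "{x. x > int k} = {x. nat x > k}" by auto
      have "measure (measure_pmf p) {x. nat \<bar>x\<bar> > k} \<le> measure (measure_pmf p) ({x. x > int k} \<union> {x. x < - int k})"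
        by (intro measure_pmf.finite_measure_mono) auto
      also have "\<dots> \<le> measure (measure_pmf p) {x. x > int k} + measure (measure_pmf p) {x. x < - int k}"
        by (intro measure_subadditive) auto
      also have "\<dots> \<le> (1 + c) * measure (measure_pmf p) {x. x > int k}"
        using elim by (simp add: distrib_right)
      also have "\<dots> \<le> (1 + c) * (C * real (Suc k) powr (- b))"
        unfolding eq using c(1) R by (intro mult_left_mono) auto
      finally show ?case by (simp add: mult.assoc)
    qed
  qed (use b in \<open>auto simp: measure_pmf.prob_le_1\<close>)
qed

lemma integrable_of_tail:
  fixes p :: "int pmf"
  assumes b: "b > 1" and T: "\<And>k. measure (measure_pmf p) {x. nat \<bar>x\<bar> > k} \<le> C * real (Suc k) powr (- b)"
  shows "integrable (measure_pmf p) real_of_int"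
proof -
  have "summable (\<lambda>k. (real (Suc k) - real k) * (C * real (Suc k) powr (- b)))"
    using tail_powr_le(1)[of b 1] b by (auto intro!: summable_mult)
  then have "integrable (measure_pmf p) (\<lambda>x. real (nat \<bar>x\<bar>))"
    by (intro expectation_abel(1)[where F = real, OF _ _ T]) auto
  then show ?thesis by (rule Bochner_Integration.integrable_bound) auto
qed

text \<open>Subtracting \<open>\<mu>\<close> costs a multiple of
  \<open>huber (\<mu> / y) \<le> \<mu>^2 / y^2\<close>, which stays within the bound because
  \<open>b \<le> 2\<close>.\<close>

lemma centred_huber_bound:
  fixes p :: "int pmf"
  assumes T: "\<And>k. measure (measure_pmf p) {x. nat \<bar>x\<bar> > k} \<le> C * real (Suc k) powr (- b)" and C: "C > 0"
    and b: "1 < b" "b \<le> 2"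
  shows "\<exists>Q>0. \<forall>y\<ge>1. measure_pmf.expectation p (\<lambda>x. huber ((real_of_int x - \<mu>) / y)) \<le> Q * y powr (- b) * log_corr (b - 1) y"
proof -
  obtain K where K: "K > 0" "\<And>y. y \<ge> 1 \<Longrightarrow> measure_pmf.expectation p (\<lambda>x. huber (real (nat \<bar>x\<bar>) / y)) \<le> K * y powr (- b) * log_corr (b - 1) y"
    using huber_moment_bound[OF T C b] by blast
  have X: "integrable (measure_pmf p) real_of_int" by (rule integrable_of_tail[OF b(1) T])
  define Q where "Q = 4 * (K + \<mu>\<^sup>2)"
  have "measure_pmf.expectation p (\<lambda>x. huber ((real_of_int x - \<mu>) / y)) \<le> Q * y powr (- b) * log_corr (b - 1) y" if y: "y \<ge> 1" for y
  proof -
    have hx: "huber (real_of_int x / y) = huber (real (nat \<bar>x\<bar>) / y)" for x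
      by (simp add: huber_def power_divide abs_divide flip: of_int_power)
    have "measure_pmf.expectation p (\<lambda>x. huber ((real_of_int x - \<mu>) / y)) \<le>
       measure_pmf.expectation p (\<lambda>x. 4 * (huber (real_of_int x / y) + huber (- \<mu> / y)))"
    proof (rule integral_mono)
      show "integrable (measure_pmf p) (\<lambda>x. huber ((real_of_int x - \<mu>) / y))"
        using X by (intro integrable_huber) auto
      show "integrable (measure_pmf p) (\<lambda>x. 4 * (huber (real_of_int x / y) + huber (- \<mu> / y)))"
        using integrable_huber[OF X, of y] by auto
      show "huber ((real_of_int x - \<mu>) / y) \<le> 4 * (huber (real_of_int x / y) + huber (- \<mu> / y))" for x
        using huber_add[of "real_of_int x / y" "- \<mu> / y"] by (simp add: diff_divide_distrib)
    qed
    also have "\<dots> = 4 * (measure_pmf.expectation p (\<lambda>x. huber (real (nat \<bar>x\<bar>) / y)) + huber (- \<mu> / y))"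
      using integrable_huber[OF X, of y] unfolding hx by (simp add: Bochner_Integration.integral_add)
    also have "huber (- \<mu> / y) \<le> \<mu>\<^sup>2 * y powr (- b) * log_corr (b - 1) y"
    proof -
      have "huber (- \<mu> / y) \<le> \<mu>\<^sup>2 * y powr (- 2)"
        using huber_le_square[of "- \<mu> / y"] y unfolding powr_minus_divide by (simp add: power_divide powr_numeral)
      also have "\<dots> \<le> \<mu>\<^sup>2 * y powr (- b)" using y b by (intro mult_left_mono powr_mono) auto
      also have "\<dots> * 1 \<le> \<mu>\<^sup>2 * y powr (- b) * log_corr (b - 1) y" by (intro mult_left_mono log_corr_ge_1 y) auto
      finally show ?thesis by simp
    qed
    finally show ?thesis using K(2)[OF y] unfolding Q_def by (simp add: algebra_simps)
  qed
  moreover have "Q > 0" unfolding Q_def using K(1) by (simp add: add_pos_nonneg)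
  ultimately show ?thesis by blast
qed

lemma mgf_bound_centred_le:
  fixes p :: "int pmf"
  assumes "integrable (measure_pmf p) real_of_int" "measure_pmf.expectation p real_of_int = \<mu>" "y > 0"
    and "measure_pmf.expectation p (\<lambda>x. huber ((real_of_int x - \<mu>) / y)) \<le> q"
  shows "mgf_bound p (\<lambda>x. real_of_int x - \<mu>) y q"
proof (rule mgf_bound_mono[OF mgf_bound_centred assms(4)])
  show "integrable (measure_pmf p) (\<lambda>x. real_of_int x - \<mu>)" using assms(1) by simp
  show "measure_pmf.expectation p (\<lambda>x. real_of_int x - \<mu>) = 0"
    using assms(1,2) by (subst Bochner_Integration.integral_diff) auto
qed (rule assms(3))

text \<open>For negative drift \<open>u = t + n * |\<mu>|\<close> is at least \<open>t\<close> and
  at least \<open>n * |\<mu>|\<close>, so \<open>drift_domination\<close> covers every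
  \<open>n\<close>. Positive drift goes through the Green function, whose bound uses
  \<open>g + d > 1\<close>.\<close>

lemma nonzero_drift_asymp:
  fixes p :: "int pmf" and \<nu> :: "nat pmf"
  assumes \<nu>: "integrable (measure_pmf \<nu>) real"
    and \<alpha>: "\<alpha> > 0" and r: "regular_mass (\<lambda>t. pmf p (int t)) \<alpha>" and d: "d > 0"
    and X: "integrable (measure_pmf p) real_of_int" "measure_pmf.expectation p real_of_int = \<mu>"
    and Q: "Q > 0" "\<And>y. y \<ge> 1 \<Longrightarrow> measure_pmf.expectation p (\<lambda>x. huber ((real_of_int x - \<mu>) / y)) \<le> Q * y powr (- (1 + d))"
    and conc: "D > 0" "\<And>n t. n > 0 \<Longrightarrow> pmf (walk p n) t \<le> D * real n powr (- g)"
    and g: "g \<ge> 0" "g + d > 1"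
    and \<mu>: "\<mu> \<noteq> 0" "\<mu> > 0 \<Longrightarrow> (\<lambda>n. pmf \<nu> n) \<in> o(\<lambda>n. pmf p (int n))"
  shows "random_walk_asymp p \<nu>"
proof -
  have mgf: "mgf_bound p (\<lambda>x. real_of_int x - \<mu>) y (Q * y powr (- (1 + d)))" if "y \<ge> 1" for y
    by (rule mgf_bound_centred_le[OF X _ Q(2)[OF that]]) (use that in simp)
  show ?thesis
  proof (cases "\<mu> > 0")
    case True
    obtain U where "\<And>m t. (\<Sum>n\<le>m. pmf (walk p n) t) \<le> U"
      using green_bounded[OF X True Q conc g] by blast
    from positive_drift_asymp[OF \<nu> \<alpha> r d True Q(1) mgf this \<mu>(2)[OF True]] show ?thesis .
  next
    case False
    then have neg: "\<mu> < 0" using \<mu>(1) by simp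
    obtain C where C: "\<forall>\<^sub>F t in sequentially. \<forall>n.
      real t - real n * \<mu> \<ge> real t / 2 \<and> real n \<le> 1 / (- \<mu>) * (real t - real n * \<mu>) \<longrightarrow>
      pmf (walk p n) (int t) \<le> C * real n * pmf p (int t)"
      using drift_domination[OF \<alpha> r d _ Q(1) mgf, of "1 / (- \<mu>)"] neg by auto
    have "real t - real n * \<mu> \<ge> real t / 2" "real n \<le> 1 / (- \<mu>) * (real t - real n * \<mu>)" for n t :: nat
    proof -
      have nm: "real n * \<mu> \<le> 0" using neg by (simp add: mult_nonneg_nonpos)
      then show "real t - real n * \<mu> \<ge> real t / 2" by (smt (verit) field_sum_of_halves of_nat_0_le_iff)
      have "real n * (- \<mu>) \<le> real t - real n * \<mu>" by simp
      then show "real n \<le> 1 / (- \<mu>) * (real t - real n * \<mu>)" using neg by (simp add: field_simps)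
    qed
    with C have "\<forall>\<^sub>F t in sequentially. \<forall>n. pmf (walk p n) (int t) \<le> C * real n * pmf p (int t)" by simp
    from random_walk_asymp_dominated[OF \<nu> r \<alpha> this] show ?thesis .
  qed
qed

section \<open>Specialisation to the individual tail indices\<close>

lemma power_law_lower:
  fixes p :: "int pmf"
  assumes a: "a > 0" and lim: "(\<lambda>t::nat. pmf p (int t)) \<sim>[at_top] (\<lambda>t. a * real t powr (- \<alpha>))"
  obtains k1 where "k1 > 0" "\<And>k. k \<ge> k1 \<Longrightarrow> pmf p (int k) \<ge> a / 2 * real k powr (- \<alpha>)"
proof -
  obtain T where T: "\<And>t. t \<ge> T \<Longrightarrow> a / 2 * real t powr (- \<alpha>) \<le> pmf p (int t)"
    using powr_asymp_bounds[OF a lim] by (auto simp: eventually_sequentially)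
  show ?thesis by (rule that[of "Suc T"]) (use T in auto)
qed

lemma regular_mass_two_atoms:
  assumes "regular_mass (\<lambda>t. pmf p (int t)) \<alpha>"
  obtains k where "pmf p k > 0" "pmf p (k + 1) > 0"
proof -
  obtain T where T: "\<And>t. t \<ge> T \<Longrightarrow> pmf p (int t) > 0"
    using regular_mass_pos[OF assms] by (auto simp: eventually_sequentially)
  show ?thesis by (rule that[of "int T"]) (use T[of T] T[of "Suc T"] in \<open>auto simp: add.commute\<close>)
qed

lemma onesided_mgf_bound:
  fixes p :: "int pmf"
  assumes a: "a > 0" and lim: "(\<lambda>t::nat. pmf p (int t)) \<sim>[at_top] (\<lambda>t. a * real t powr (- (1 + b)))"
    and b: "0 < b" "b \<le> 1"
  shows "\<exists>Q>0. \<forall>y\<ge>1. mgf_bound p real_of_int y (Q * y powr (- b) * log_corr b y)"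
proof -
  have "\<forall>\<^sub>F k in sequentially. pmf p (int k) \<le> 2 * a * real k powr (- (1 + b))"
    using powr_asymp_bounds[OF a lim] by eventually_elim blast
  from right_tail_bound[OF _ this] b obtain C where C: "C > 0"
    "\<And>k. measure (measure_pmf p) {x. nat x > k} \<le> C * real (Suc k) powr (- b)" by auto
  obtain K where K: "K > 0" "\<And>y. y \<ge> 1 \<Longrightarrow> measure_pmf.expectation p (\<lambda>x. min (real (nat x) / y) 1) \<le> K * y powr (- b) * log_corr b y"
    using truncated_mean_bound[OF C(2,1) b] by blast
  have "mgf_bound p real_of_int y (K * y powr (- b) * log_corr b y)" if y: "y \<ge> 1" for y
  proof (rule mgf_bound_mono[OF mgf_bound_onesided])
    have "max (real_of_int x) 0 = real (nat x)" for x by (cases "x \<ge> 0") auto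
    then show "measure_pmf.expectation p (\<lambda>x. min (max (real_of_int x) 0 / y) 1) \<le> K * y powr (- b) * log_corr b y"
      using K(2)[OF y] by simp
  qed (use y in simp)
  then show ?thesis using K(1) by blast
qed

text \<open>The mean need not exist, so the step is left uncentred and only its positive part is
  used: for \<open>b = \<alpha> - 1 < 1\<close> the truncated mean has the order
  \<open>y powr (- b)\<close> that \<open>stable_domination\<close> asks for.\<close>

lemma asymp_index_lt_2:
  fixes p :: "int pmf" and \<nu> :: "nat pmf"
  assumes \<nu>: "integrable (measure_pmf \<nu>) real" and \<alpha>: "1 < \<alpha>" "\<alpha> < 2"
    and a: "a > 0" and lim: "(\<lambda>t::nat. pmf p (int t)) \<sim>[at_top] (\<lambda>t. a * real t powr (- \<alpha>))"
  shows "random_walk_asymp p \<nu>"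
proof -
  define b where "b = \<alpha> - 1"
  have b: "0 < b" "b < 1" and \<alpha>b: "\<alpha> = 1 + b" using \<alpha> by (auto simp: b_def)
  note lim' = lim[unfolded \<alpha>b]
  have r: "regular_mass (\<lambda>t. pmf p (int t)) (1 + b)" by (rule regular_mass_powr[OF a lim'])
  obtain k1 where k1: "k1 > 0" "\<And>k. k \<ge> k1 \<Longrightarrow> pmf p (int k) \<ge> a / 2 * real k powr (- (1 + b))"
    by (rule power_law_lower[OF a lim']) blast
  obtain D where D: "D > 0" "\<And>n t. n > 0 \<Longrightarrow> pmf (walk p n) t \<le> D * real n powr (- (1 / b))"
    using concentration_heavy[OF half_gt_zero[OF a] b(1) k1, unfolded minus_divide_left[symmetric]] by blast
  obtain Q where Q: "Q > 0" "\<And>y. y \<ge> 1 \<Longrightarrow> mgf_bound p real_of_int y (Q * y powr (- b))"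
    using onesided_mgf_bound[OF a lim' b(1)] b by (auto simp: log_corr_def)
  have low: "\<forall>\<^sub>F t in sequentially. a / 2 * real t powr (- (1 + b)) \<le> pmf p (int t)"
    using powr_asymp_bounds[OF a lim'] by eventually_elim blast
  obtain C where "\<forall>\<^sub>F t in sequentially. \<forall>n. pmf (walk p n) (int t) \<le> C * real n * pmf p (int t)"
    using stable_domination[OF b(1) r _ low Q D] a by auto
  from random_walk_asymp_dominated[OF \<nu> r _ this] show ?thesis using b by simp
qed

lemma asymp_index_2:
  fixes p :: "int pmf" and \<nu> :: "nat pmf"
  assumes \<nu>: "integrable (measure_pmf \<nu>) real"
    and a: "a > 0" and lim: "(\<lambda>t::nat. pmf p (int t)) \<sim>[at_top] (\<lambda>t. a * real t powr (- 2))"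
    and \<tau>: "\<tau> > 0" and mom: "integrable (measure_pmf \<nu>) (\<lambda>n. real n * ln (real n) powr (2 + \<tau>))"
  shows "random_walk_asymp p \<nu>"
proof -
  have lim': "(\<lambda>t::nat. pmf p (int t)) \<sim>[at_top] (\<lambda>t. a * real t powr (- (1 + 1)))" using lim by simp
  have r: "regular_mass (\<lambda>t. pmf p (int t)) (1 + 1)" by (rule regular_mass_powr[OF a lim'])
  obtain k1 where k1: "k1 > 0" "\<And>k. k \<ge> k1 \<Longrightarrow> pmf p (int k) \<ge> a / 2 * real k powr (- (1 + 1))"
    by (rule power_law_lower[OF a lim']) blast
  obtain D where D: "D > 0" "\<And>n t. n > 0 \<Longrightarrow> pmf (walk p n) t \<le> D * real n powr (- 1 / 1)"
    using concentration_heavy[OF half_gt_zero[OF a] zero_less_one k1] by blast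
  have D': "pmf (walk p n) t \<le> D * real n powr (- (1 / 1)) * ln (real n) powr (- 0)" if "n > 1" for n t
    using D(2)[of n t] that by simp
  obtain Q where Q: "Q > 0" "\<And>y. y \<ge> 1 \<Longrightarrow> mgf_bound p real_of_int y (Q * y powr (- 1) * (1 + ln y))"
    using onesided_mgf_bound[OF a lim'] by (auto simp: log_corr_def)
  have low: "\<forall>\<^sub>F t in sequentially. a / 2 * real t powr (- (1 + 1)) \<le> pmf p (int t)"
    using powr_asymp_bounds[OF a lim'] by eventually_elim blast
  show ?thesis
    by (rule log_corrected_asymp[OF \<nu> zero_less_one r _ low Q D(1) D' _ _ \<tau> mom]) (use a in auto)
qed

lemma power_law_two_sided_tail:
  fixes p :: "int pmf"
  assumes a: "a > 0" and lim: "(\<lambda>t::nat. pmf p (int t)) \<sim>[at_top] (\<lambda>t. a * real t powr (- (1 + b)))" and b: "b > 0"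
    and B: "(\<lambda>t::nat. measure (measure_pmf p) {x. x < - int t}) \<in> O(\<lambda>t. measure (measure_pmf p) {x. x > int t})"
  shows "\<exists>C>0. \<forall>k. measure (measure_pmf p) {x. nat \<bar>x\<bar> > k} \<le> C * real (Suc k) powr (- b)"
proof -
  have "\<forall>\<^sub>F k in sequentially. pmf p (int k) \<le> 2 * a * real k powr (- (1 + b))"
    using powr_asymp_bounds[OF a lim] by eventually_elim blast
  from right_tail_bound[OF _ this] b obtain C where C: "C > 0"
    "\<And>k. measure (measure_pmf p) {x. nat x > k} \<le> C * real (Suc k) powr (- b)" by auto
  show ?thesis by (rule two_sided_tail_bound[OF _ C(2) B]) (use b in simp)
qed

lemma asymp_index_between_2_3:
  fixes p :: "int pmf" and \<nu> :: "nat pmf"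
  assumes \<nu>: "integrable (measure_pmf \<nu>) real" and \<alpha>: "2 < \<alpha>" "\<alpha> < 3"
    and a: "a > 0" and lim: "(\<lambda>t::nat. pmf p (int t)) \<sim>[at_top] (\<lambda>t. a * real t powr (- \<alpha>))"
    and B: "(\<lambda>t::nat. measure (measure_pmf p) {x. x < - int t}) \<in> O(\<lambda>t. measure (measure_pmf p) {x. x > int t})"
    and \<mu>: "measure_pmf.expectation p real_of_int = \<mu>"
    and D: "\<mu> > 0 \<Longrightarrow> (\<lambda>n. pmf \<nu> n) \<in> o(\<lambda>n. pmf p (int n))"
  shows "random_walk_asymp p \<nu>"
proof -
  define b where "b = \<alpha> - 1"
  have b: "1 < b" "b < 2" and \<alpha>b: "\<alpha> = 1 + b" using \<alpha> by (auto simp: b_def)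
  have b0: "b > 0" using b by simp
  note lim' = lim[unfolded \<alpha>b]
  have r: "regular_mass (\<lambda>t. pmf p (int t)) (1 + b)" by (rule regular_mass_powr[OF a lim'])
  obtain k1 where k1: "k1 > 0" "\<And>k. k \<ge> k1 \<Longrightarrow> pmf p (int k) \<ge> a / 2 * real k powr (- (1 + b))"
    by (rule power_law_lower[OF a lim']) blast
  obtain E where E: "E > 0" "\<And>n t. n > 0 \<Longrightarrow> pmf (walk p n) t \<le> E * real n powr (- (1 / b))"
    using concentration_heavy[OF half_gt_zero[OF a] b0 k1, unfolded minus_divide_left[symmetric]] by blast
  obtain C where C: "C > 0" "\<And>k. measure (measure_pmf p) {x. nat \<bar>x\<bar> > k} \<le> C * real (Suc k) powr (- b)"
    using power_law_two_sided_tail[OF a lim' b0 B] by blast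
  have X: "integrable (measure_pmf p) real_of_int" by (rule integrable_of_tail[OF b(1) C(2)])
  obtain Q where Q: "Q > 0" "\<And>y. y \<ge> 1 \<Longrightarrow> measure_pmf.expectation p (\<lambda>x. huber ((real_of_int x - \<mu>) / y)) \<le> Q * y powr (- b)"
    using centred_huber_bound[OF C(2,1) b(1), of \<mu>] b by (auto simp: log_corr_def)
  show ?thesis
  proof (cases "\<mu> = 0")
    case True
    have mgf: "mgf_bound p real_of_int y (Q * y powr (- b))" if "y \<ge> 1" for y
      using mgf_bound_centred_le[OF X \<mu> _ Q(2)[OF that]] that True by simp
    have low: "\<forall>\<^sub>F t in sequentially. a / 2 * real t powr (- (1 + b)) \<le> pmf p (int t)"
      using powr_asymp_bounds[OF a lim'] by eventually_elim blast
    obtain C where "\<forall>\<^sub>F t in sequentially. \<forall>n. pmf (walk p n) (int t) \<le> C * real n * pmf p (int t)"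
      using stable_domination[OF b0 r _ low Q(1) mgf E] a by auto
    from random_walk_asymp_dominated[OF \<nu> r _ this] show ?thesis using b by simp
  next
    case False
    \<comment> \<open>The exponents are \<open>g = 1 / b\<close> and \<open>d = b - 1\<close>;
      \<open>g + d > 1\<close> amounts to \<open>(b - 1)^2 > 0\<close>.\<close>
    have gd: "1 / b + (b - 1) > 1"
    proof -
      have "0 < (b - 1)\<^sup>2 / b" using b by simp
      also have "(b - 1)\<^sup>2 / b = 1 / b + (b - 1) - 1" using b by (simp add: field_simps power2_eq_square)
      finally show ?thesis by simp
    qed
    have Q': "measure_pmf.expectation p (\<lambda>x. huber ((real_of_int x - \<mu>) / y)) \<le> Q * y powr (- (1 + (b - 1)))" if "y \<ge> 1" for y
      using Q(2)[OF that] by simp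
    show ?thesis
      by (rule nonzero_drift_asymp[OF \<nu> _ r _ X \<mu> Q(1) Q' E _ gd False D]) (use b in auto)
  qed
qed

lemma asymp_index_3:
  fixes p :: "int pmf" and \<nu> :: "nat pmf"
  assumes \<nu>: "integrable (measure_pmf \<nu>) real"
    and a: "a > 0" and lim: "(\<lambda>t::nat. pmf p (int t)) \<sim>[at_top] (\<lambda>t. a * real t powr (- 3))"
    and B: "(\<lambda>t::nat. measure (measure_pmf p) {x. x < - int t}) \<in> O(\<lambda>t. measure (measure_pmf p) {x. x > int t})"
    and \<mu>: "measure_pmf.expectation p real_of_int = \<mu>"
    and D: "\<mu> > 0 \<Longrightarrow> (\<lambda>n. pmf \<nu> n) \<in> o(\<lambda>n. pmf p (int n))"
    and mom: "\<mu> = 0 \<Longrightarrow> \<exists>\<tau>>0. integrable (measure_pmf \<nu>) (\<lambda>n. real n * ln (real n) powr (1 + \<tau>))"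
  shows "random_walk_asymp p \<nu>"
proof -
  have lim': "(\<lambda>t::nat. pmf p (int t)) \<sim>[at_top] (\<lambda>t. a * real t powr (- (1 + 2)))" using lim by simp
  have r: "regular_mass (\<lambda>t. pmf p (int t)) (1 + 2)" by (rule regular_mass_powr[OF a lim'])
  obtain k1 where k1: "k1 > 0" "\<And>k. k \<ge> k1 \<Longrightarrow> pmf p (int k) \<ge> a / 2 * real k powr (- 3)"
    by (rule power_law_lower[OF a lim]) blast
  obtain C where C: "C > 0" "\<And>k. measure (measure_pmf p) {x. nat \<bar>x\<bar> > k} \<le> C * real (Suc k) powr (- 2)"
    using power_law_two_sided_tail[OF a lim' _ B] by auto
  have X: "integrable (measure_pmf p) real_of_int" by (rule integrable_of_tail[OF _ C(2)]) simp
  show ?thesis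
  proof (cases "\<mu> = 0")
    case True
    obtain \<tau> where \<tau>: "\<tau> > 0" "integrable (measure_pmf \<nu>) (\<lambda>n. real n * ln (real n) powr (1 + \<tau>))"
      using mom[OF True] by blast
    obtain Q where Q: "Q > 0" "\<And>y. y \<ge> 1 \<Longrightarrow> measure_pmf.expectation p (\<lambda>x. huber ((real_of_int x - \<mu>) / y)) \<le> Q * y powr (- 2) * (1 + ln y)"
      using centred_huber_bound[OF C(2,1), of \<mu>] by (auto simp: log_corr_def)
    have mgf: "mgf_bound p real_of_int y (Q * y powr (- 2) * (1 + ln y))" if "y \<ge> 1" for y
      using mgf_bound_centred_le[OF X \<mu> _ Q(2)[OF that]] that True by simp
    have low: "\<forall>\<^sub>F t in sequentially. a / 2 * real t powr (- (1 + 2)) \<le> pmf p (int t)"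
      using powr_asymp_bounds[OF a lim'] by eventually_elim blast
    obtain E where E: "E > 0" "\<And>n t. n > 1 \<Longrightarrow> pmf (walk p n) t \<le> E * (real n * ln (real n)) powr (- 1 / 2)"
      using concentration_log[OF half_gt_zero[OF a] k1] by blast
    have E': "pmf (walk p n) t \<le> E * real n powr (- (1 / 2)) * ln (real n) powr (- (1 / 2))" if "n > 1" for n t
      using E(2)[OF that, of t] by (simp add: powr_mult)
    show ?thesis
      by (rule log_corrected_asymp[OF \<nu> _ r _ low Q(1) mgf E(1) E' _ _ \<tau>]) (use a in auto)
  next
    case False
    \<comment> \<open>With drift the logarithm at \<open>b = 2\<close> is avoided by weakening the
      tail exponent to \<open>7/4\<close>: then \<open>d = 3/4\<close>, and with
      \<open>g = 1/2\<close> still \<open>g + d > 1\<close>.\<close>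
    have T: "measure (measure_pmf p) {x. nat \<bar>x\<bar> > k} \<le> C * real (Suc k) powr (- (7 / 4))" for k
    proof -
      have "C * real (Suc k) powr (- 2) \<le> C * real (Suc k) powr (- (7 / 4))"
        using C(1) by (intro mult_left_mono powr_mono) auto
      then show ?thesis using C(2)[of k] by linarith
    qed
    obtain Q where Q: "Q > 0" "\<And>y. y \<ge> 1 \<Longrightarrow> measure_pmf.expectation p (\<lambda>x. huber ((real_of_int x - \<mu>) / y)) \<le> Q * y powr (- (1 + 3 / 4))"
      using centred_huber_bound[OF T C(1), of \<mu>] by (auto simp: log_corr_def)
    obtain k where "pmf p k > 0" "pmf p (k + 1) > 0" using regular_mass_two_atoms[OF r] by blast
    from concentration_sqrt[OF this] obtain E where E: "E > 0" "\<And>n t. n > 0 \<Longrightarrow> pmf (walk p n) t \<le> E * real n powr (- (1 / 2))"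
      by auto
    show ?thesis
      by (rule nonzero_drift_asymp[OF \<nu> _ r _ X \<mu> Q E _ _ False D]) auto
  qed
qed

text \<open>\<open>\<alpha> > 3\<close> gives the positive part a second moment, and the negative
  part has one by hypothesis. The variance is finite, \<open>q\<close> is of order
  \<open>y^(-2)\<close>, and the drift case runs with \<open>d = 1\<close> and
  \<open>g = 1/2\<close>.\<close>

lemma asymp_index_gt_3:
  fixes p :: "int pmf" and \<nu> :: "nat pmf"
  assumes \<nu>: "integrable (measure_pmf \<nu>) real" and \<alpha>: "\<alpha> > 3"
    and r: "regular_mass (\<lambda>t. pmf p (int t)) \<alpha>"
    and left: "integrable (measure_pmf p) (\<lambda>x. (real_of_int x)\<^sup>2 * indicator {x. x < 0} x)"
    and \<mu>: "measure_pmf.expectation p real_of_int = \<mu>"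
    and D: "\<mu> > 0 \<Longrightarrow> (\<lambda>n. pmf \<nu> n) \<in> o(\<lambda>n. pmf p (int n))"
    and tail: "\<mu> = 0 \<Longrightarrow> (\<lambda>t. measure (measure_pmf \<nu>) {n. real n > (real t)\<^sup>2}) \<in> o(\<lambda>t. real t * pmf p (int t))"
  shows "random_walk_asymp p \<nu>"
proof -
  \<comment> \<open>Half of the gap \<open>\<alpha> - 3\<close> absorbs the slowly varying factor
    and leaves an exponent above three.\<close>
  define \<delta> where "\<delta> = (\<alpha> - 3) / 2"
  have \<delta>: "\<delta> > 0" "\<alpha> - \<delta> > 3" unfolding \<delta>_def using \<alpha> by (auto simp: field_simps)
  obtain A where "\<forall>\<^sub>F t in sequentially. pmf p (int t) \<le> A * real t powr (- (\<alpha> - \<delta>))"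
    using regular_mass_upper[OF r \<delta>(1)] by auto
  from right_tail_bound[OF _ this] \<delta>(2) obtain C where C: "C > 0"
    "\<And>k. measure (measure_pmf p) {x. nat x > k} \<le> C * real (Suc k) powr (- (\<alpha> - \<delta> - 1))" by auto
  have "integrable (measure_pmf p) (\<lambda>x. (real (nat x))\<^sup>2)"
  proof (rule expectation_abel(1)[where F = "\<lambda>k. (real k)\<^sup>2", OF _ _ C(2)])
    show "summable (\<lambda>k. ((real (Suc k))\<^sup>2 - (real k)\<^sup>2) * (C * real (Suc k) powr (- (\<alpha> - \<delta> - 1))))"
    proof (rule summable_comparison_test_ev)
      show "summable (\<lambda>k. 2 * C * real (Suc k) powr (- (\<alpha> - \<delta> - 2)))"
        using tail_powr_le(1)[of "\<alpha> - \<delta> - 2" 1] \<delta> by (intro summable_mult) auto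
      show "\<forall>\<^sub>F k in sequentially. norm (((real (Suc k))\<^sup>2 - (real k)\<^sup>2) * (C * real (Suc k) powr (- (\<alpha> - \<delta> - 1))))
          \<le> 2 * C * real (Suc k) powr (- (\<alpha> - \<delta> - 2))"
      proof (intro always_eventually allI)
        fix k
        have "(real (Suc k))\<^sup>2 - (real k)\<^sup>2 = 2 * real k + 1" by (simp add: power2_eq_square algebra_simps)
        then have "norm (((real (Suc k))\<^sup>2 - (real k)\<^sup>2) * (C * real (Suc k) powr (- (\<alpha> - \<delta> - 1)))) =
            (2 * real k + 1) * (C * real (Suc k) powr (- (\<alpha> - \<delta> - 1)))" using C(1) by simp
        also have "\<dots> \<le> (2 * real (Suc k)) * (C * real (Suc k) powr (- (\<alpha> - \<delta> - 1)))"
          using C(1) by (intro mult_right_mono) auto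
        also have "\<dots> = 2 * C * (real (Suc k) * real (Suc k) powr (- (\<alpha> - \<delta> - 1)))" by simp
        also have "real (Suc k) * real (Suc k) powr (- (\<alpha> - \<delta> - 1)) = real (Suc k) powr (1 + - (\<alpha> - \<delta> - 1))"
          by (simp only: powr_add) simp
        also have "1 + - (\<alpha> - \<delta> - 1) = - (\<alpha> - \<delta> - 2)" by simp
        finally show "norm (((real (Suc k))\<^sup>2 - (real k)\<^sup>2) * (C * real (Suc k) powr (- (\<alpha> - \<delta> - 1))))
          \<le> 2 * C * real (Suc k) powr (- (\<alpha> - \<delta> - 2))" .
      qed
    qed
  qed auto
  with left have "integrable (measure_pmf p) (\<lambda>x. (real (nat x))\<^sup>2 + (real_of_int x)\<^sup>2 * indicator {x. x < 0} x)" by simp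
  also have "(\<lambda>x. (real (nat x))\<^sup>2 + (real_of_int x)\<^sup>2 * indicator {x. x < 0} x) = (\<lambda>x. (real_of_int x)\<^sup>2)"
    by (auto simp: indicator_def)
  finally have X2: "integrable (measure_pmf p) (\<lambda>x. (real_of_int x)\<^sup>2)" .
  have X: "integrable (measure_pmf p) real_of_int"
    by (rule measure_pmf.square_integrable_imp_integrable[OF _ X2]) simp
  define S where "S = measure_pmf.expectation p (\<lambda>x. (real_of_int x - \<mu>)\<^sup>2)"
  have Xc: "integrable (measure_pmf p) (\<lambda>x. (real_of_int x - \<mu>)\<^sup>2)"
    using X X2 by (simp add: power2_diff)
  have S0: "S \<ge> 0" unfolding S_def by (intro integral_nonneg_AE) auto
  define Q where "Q = S + 1"
  have Q0: "Q > 0" "Q \<ge> 1" unfolding Q_def using S0 by auto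
  have Q: "measure_pmf.expectation p (\<lambda>x. huber ((real_of_int x - \<mu>) / y)) \<le> Q * y powr (- (1 + 1))" if y: "y \<ge> 1" for y
  proof -
    have "measure_pmf.expectation p (\<lambda>x. huber ((real_of_int x - \<mu>) / y)) \<le> measure_pmf.expectation p (\<lambda>x. (real_of_int x - \<mu>)\<^sup>2 / y\<^sup>2)"
    proof (rule integral_mono)
      show "integrable (measure_pmf p) (\<lambda>x. huber ((real_of_int x - \<mu>) / y))" using X by (intro integrable_huber) auto
      show "huber ((real_of_int x - \<mu>) / y) \<le> (real_of_int x - \<mu>)\<^sup>2 / y\<^sup>2" for x
        using huber_le_square[of "(real_of_int x - \<mu>) / y"] by (simp add: power_divide)
    qed (use Xc in simp)
    also have "\<dots> = S / y\<^sup>2" unfolding S_def by simp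
    also have "\<dots> \<le> Q / y\<^sup>2" unfolding Q_def by (intro divide_right_mono) auto
    also have "\<dots> = Q * y powr (- (1 + 1))" unfolding powr_minus_divide using y by (simp add: powr_numeral)
    finally show ?thesis .
  qed
  obtain k where "pmf p k > 0" "pmf p (k + 1) > 0" using regular_mass_two_atoms[OF r] by blast
  from concentration_sqrt[OF this] obtain E where E: "E > 0" "\<And>n t. n > 0 \<Longrightarrow> pmf (walk p n) t \<le> E * real n powr (- (1 / 2))"
    by auto
  have \<alpha>0: "\<alpha> > 0" using \<alpha> by simp
  show ?thesis
  proof (cases "\<mu> = 0")
    case True
    have mgf: "mgf_bound p real_of_int y (Q * y powr (- 2))" if "y \<ge> 1" for y
      using mgf_bound_centred_le[OF X \<mu> _ Q[OF that]] that True by simp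
    show ?thesis by (rule finite_variance_asymp[OF \<nu> \<alpha>0 r Q0(2) mgf E tail[OF True]])
  next
    case False
    show ?thesis by (rule nonzero_drift_asymp[OF \<nu> \<alpha>0 r _ X \<mu> Q0(1) Q E _ _ False D]) auto
  qed
qed

text \<open>A zero mean is separated: the counting variable is then almost surely zero and both
  sides vanish for \<open>t > 0\<close>, so they are eventually equal. Otherwise the ratio may be
  divided by the mean.\<close>

lemma random_walk_asymp_equiv:
  assumes \<nu>: "integrable (measure_pmf \<nu>) real"
    and r: "regular_mass (\<lambda>t. pmf p (int t)) \<alpha>" and as: "random_walk_asymp p \<nu>"
  shows "(\<lambda>t. measure_pmf.expectation \<nu> (\<lambda>n. pmf (walk p n) (int t))) \<sim>[at_top]
    (\<lambda>t. measure_pmf.expectation \<nu> real * pmf p (int t))"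
proof (cases "measure_pmf.expectation \<nu> real = 0")
  case True
  then have ae: "AE n in \<nu>. real n = 0" using \<nu> by (subst (asm) integral_nonneg_eq_0_iff_AE) auto
  have "measure_pmf.expectation \<nu> (\<lambda>n. pmf (walk p n) (int t)) = 0" if "t > 0" for t
  proof -
    have "measure_pmf.expectation \<nu> (\<lambda>n. pmf (walk p n) (int t)) = measure_pmf.expectation \<nu> (\<lambda>_. 0)"
      using ae that by (intro integral_cong_AE) (auto simp: walk_0_pos elim: eventually_mono)
    then show ?thesis by simp
  qed
  then have "\<forall>\<^sub>F t in sequentially. measure_pmf.expectation \<nu> (\<lambda>n. pmf (walk p n) (int t)) =
     measure_pmf.expectation \<nu> real * pmf p (int t)"
    using True by (intro eventually_mono[OF eventually_gt_at_top[of 0]]) simp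
  then show ?thesis by (rule asymp_equiv_refl_ev)
next
  case False
  let ?E = "measure_pmf.expectation \<nu> real"
  have "(\<lambda>t. measure_pmf.expectation \<nu> (\<lambda>n. pmf (walk p n) (int t)) / pmf p (int t) / ?E) \<longlonglongrightarrow> ?E / ?E"
    using as False unfolding random_walk_asymp_def by (intro tendsto_divide) auto
  then show ?thesis using False by (intro asymp_equivI') (simp add: mult.commute)
qed

lemma smallo_iterated_log:
  fixes p :: "int pmf" and f :: "nat \<Rightarrow> real"
  assumes a: "a > 0" and lim: "(\<lambda>t::nat. pmf p (int t)) \<sim>[at_top] (\<lambda>t. a * real t powr (- 3))"
    and f: "f \<in> o(\<lambda>t. real t powr (-3) * inverse (ln (ln (real t))))"
  shows "f \<in> o(\<lambda>n. pmf p (int n))"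
proof -
  have "(\<lambda>t::nat. real t powr (-3) * inverse (ln (ln (real t)))) \<in> O(\<lambda>t. real t powr (-3))" by real_asymp
  moreover have "(\<lambda>t::nat. real t powr (-3)) \<in> O(\<lambda>n. pmf p (int n))"
  proof (rule landau_o.bigI[of "2 / a"])
    show "\<forall>\<^sub>F t in sequentially. norm (real t powr (-3)) \<le> 2 / a * norm (pmf p (int t))"
      using powr_asymp_bounds[OF a lim] by eventually_elim (use a in \<open>simp add: field_simps\<close>)
  qed (use a in simp)
  ultimately show ?thesis using f landau_o.small_big_trans landau_o.big_trans by blast
qed

theorem theorem2:
  fixes M :: "'a measure" and X :: "nat \<Rightarrow> 'a \<Rightarrow> int" and N :: "'a \<Rightarrow> nat"
    and \<alpha> \<mu> :: real
  assumes "random_sum M X N"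
    and "integrable M (\<lambda>\<omega>. real (N \<omega>))"
    and "\<mu> = (\<integral>\<omega>. real_of_int (X 1 \<omega>) \<partial>M)"
  shows
    "(1 < \<alpha> \<and> \<alpha> < 2 \<and> cond_A' M (X 1) \<alpha> \<longrightarrow> random_sum_asymp M X N) \<and>

     (\<alpha> = 2 \<and> cond_A' M (X 1) \<alpha> \<and>
       (\<exists>\<tau>>0. integrable M (\<lambda>\<omega>. real (N \<omega>) * ln (real (N \<omega>)) powr (2 + \<tau>)))
       \<longrightarrow> random_sum_asymp M X N) \<and>

     (2 < \<alpha> \<and> \<alpha> < 3 \<longrightarrow>
       (\<mu> \<le> 0 \<and> cond_A' M (X 1) \<alpha> \<and> cond_B M (X 1) \<longrightarrow> random_sum_asymp M X N) \<and>
       (\<mu> > 0 \<and> cond_A' M (X 1) \<alpha> \<and> cond_B M (X 1) \<and> cond_D M (X 1) N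
         \<longrightarrow> random_sum_asymp M X N)) \<and>

     (\<alpha> = 3 \<and> cond_A' M (X 1) \<alpha> \<and> cond_B M (X 1) \<and>
       (\<mu> > 0 \<longrightarrow>
         (\<lambda>t::nat. \<P>(\<omega> in M. N \<omega> = t)) \<in> o(\<lambda>t. real t powr (-3) * inverse (ln (ln (real t))))) \<and>
       (\<mu> = 0 \<longrightarrow>
         (\<exists>\<tau>>0. integrable M (\<lambda>\<omega>. real (N \<omega>) * ln (real (N \<omega>)) powr (1 + \<tau>))))
       \<longrightarrow> random_sum_asymp M X N) \<and>

     (\<alpha> > 3 \<longrightarrow>
       (cond_A M (X 1) \<alpha> \<and> cond_C M (X 1) \<and>
         (\<mu> = 0 \<longrightarrow> (\<exists>\<tau>>0. cond_E M (X 1) N \<tau>)) \<and>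
         (\<mu> > 0 \<longrightarrow> cond_D M (X 1) N)
         \<longrightarrow> random_sum_asymp M X N) \<and>
       (\<mu> = 0 \<and> cond_A' M (X 1) \<alpha> \<and> cond_C M (X 1) \<and> cond_E M (X 1) N 0
         \<longrightarrow> random_sum_asymp M X N))"
proof -
  interpret random_sum M X N by (rule assms(1))
  obtain p where p: "measure_pmf p = distr M (count_space UNIV) (X 1)" using step_pmf by blast
  obtain \<nu> where \<nu>: "measure_pmf \<nu> = distr M (count_space UNIV) N" using count_pmf by blast
  have mX: "X 1 \<in> measurable M (count_space UNIV)" by (rule measurable_X) simp
  have PX: "\<P>(\<omega> in M. P (X 1 \<omega>)) = measure (measure_pmf p) {x. P x}" for P
    unfolding p by (subst measure_distr[OF mX]) (auto intro!: arg_cong[where f = "measure M"])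
  have PN: "\<P>(\<omega> in M. P (N \<omega>)) = measure (measure_pmf \<nu>) {x. P x}" for P
    unfolding \<nu> by (subst measure_distr[OF measurable_N]) (auto intro!: arg_cong[where f = "measure M"])
  have pX: "\<P>(\<omega> in M. X 1 \<omega> = k) = pmf p k" for k
    using PX[of "\<lambda>x. x = k"] by (simp add: measure_pmf_single)
  have pN: "\<P>(\<omega> in M. N \<omega> = n) = pmf \<nu> n" for n
    using PN[of "\<lambda>x. x = n"] by (simp add: measure_pmf_single)
  have iN: "integrable M (\<lambda>\<omega>. f (N \<omega>)) \<longleftrightarrow> integrable (measure_pmf \<nu>) f" for f :: "nat \<Rightarrow> real"
    unfolding \<nu> by (subst integrable_distr_eq[OF measurable_N]) auto
  have EN: "(\<integral>\<omega>. real (N \<omega>) \<partial>M) = measure_pmf.expectation \<nu> real"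
    unfolding \<nu> by (subst integral_distr[OF measurable_N]) auto
  have int\<nu>: "integrable (measure_pmf \<nu>) real" using assms(2) iN[of real] by simp
  have \<mu>: "measure_pmf.expectation p real_of_int = \<mu>"
    unfolding assms(3) p by (subst integral_distr[OF mX]) auto
  have goal: "random_sum_asymp M X N"
    if "regular_mass (\<lambda>t. pmf p (int t)) \<alpha>" "random_walk_asymp p \<nu>"
    using random_walk_asymp_equiv[OF int\<nu> that]
    unfolding random_sum_asymp_def prob_random_sum[OF p \<nu>] EN pX .
  have A': "\<exists>a>0. (\<lambda>t::nat. pmf p (int t)) \<sim>[at_top] (\<lambda>t. a * real t powr (- \<alpha>))" if "cond_A' M (X 1) \<alpha>"
    using that unfolding cond_A'_def pX .
  have rA': "regular_mass (\<lambda>t. pmf p (int t)) \<alpha>" if "cond_A' M (X 1) \<alpha>"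
    using A'[OF that] regular_mass_powr by blast
  have rA: "regular_mass (\<lambda>t. pmf p (int t)) \<alpha>" if "cond_A M (X 1) \<alpha>"
    using that regular_mass_slowly_varying[of _ "\<lambda>t. pmf p (int t)" \<alpha>] unfolding cond_A_def pX by blast
  have B: "(\<lambda>t::nat. measure (measure_pmf p) {x. x < - int t}) \<in> O(\<lambda>t. measure (measure_pmf p) {x. x > int t})"
    if "cond_B M (X 1)"
    using that PX[of "\<lambda>x. x < - int _"] PX[of "\<lambda>x. x > int _"] unfolding cond_B_def by simp
  have C: "integrable (measure_pmf p) (\<lambda>x. (real_of_int x)\<^sup>2 * indicator {x. x < 0} x)" if "cond_C M (X 1)"
  proof -
    \<comment> \<open>(C) at \<open>t = 0\<close> contains the second moment of the negative
      part.\<close>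
    have "integrable M (\<lambda>\<omega>. (real_of_int (X 1 \<omega>))\<^sup>2 * indicator {\<omega>. X 1 \<omega> < - int 0} \<omega>)"
      using that unfolding cond_C_def by blast
    then show ?thesis unfolding p by (subst integrable_distr_eq[OF mX]) (auto simp: indicator_def)
  qed
  have D: "(\<lambda>n. pmf \<nu> n) \<in> o(\<lambda>n. pmf p (int n))" if "cond_D M (X 1) N"
    using that unfolding cond_D_def pX pN .
  \<comment> \<open>Once \<open>ln t \<ge> 1\<close>, the threshold in (E) lies at or below
    \<open>t^2\<close>, so (E) with any \<open>\<tau> \<ge> 0\<close> controls the tail beyond
    \<open>t^2\<close>.\<close>
  have E: "(\<lambda>t. measure (measure_pmf \<nu>) {n. real n > (real t)\<^sup>2}) \<in> o(\<lambda>t. real t * pmf p (int t))"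
    if "cond_E M (X 1) N \<tau>" "\<tau> \<ge> 0" for \<tau>
  proof -
    have 1: "(\<lambda>t::nat. measure (measure_pmf \<nu>) {n. real n > (real t)\<^sup>2 * ln (real t) powr (-\<tau>)}) \<in> o(\<lambda>t. real t * pmf p (int t))"
      using that(1) PN[of "\<lambda>n. real n > (real _)\<^sup>2 * ln (real _) powr (-\<tau>)"] unfolding cond_E_def pX by simp
    have "(\<lambda>t. measure (measure_pmf \<nu>) {n. real n > (real t)\<^sup>2}) \<in>
        O(\<lambda>t. measure (measure_pmf \<nu>) {n. real n > (real t)\<^sup>2 * ln (real t) powr (-\<tau>)})"
    proof (rule landau_o.bigI[of 1])
      have "\<forall>\<^sub>F t::nat in sequentially. ln (real t) \<ge> 1" by real_asymp
      then show "\<forall>\<^sub>F t in sequentially. norm (measure (measure_pmf \<nu>) {n. real n > (real t)\<^sup>2}) \<le>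
         1 * norm (measure (measure_pmf \<nu>) {n. real n > (real t)\<^sup>2 * ln (real t) powr (-\<tau>)})"
      proof eventually_elim
        case (elim t)
        have "ln (real t) powr (-\<tau>) \<le> 1 powr (-\<tau>)" using elim that(2) by (intro powr_mono2') auto
        then have le: "(real t)\<^sup>2 * ln (real t) powr (-\<tau>) \<le> (real t)\<^sup>2" by (intro mult_left_le) auto
        have "measure (measure_pmf \<nu>) {n. real n > (real t)\<^sup>2} \<le>
            measure (measure_pmf \<nu>) {n. real n > (real t)\<^sup>2 * ln (real t) powr (-\<tau>)}"
          by (intro measure_pmf.finite_measure_mono) (use le_less_trans[OF le] in blast, simp)
        then show ?case by simp
      qed
    qed simp
    from landau_o.big_small_trans[OF this 1] show ?thesis .
  qed
  show ?thesis
  proof (intro conjI impI; (elim conjE)?)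
    assume \<alpha>: "1 < \<alpha>" "\<alpha> < 2" and c: "cond_A' M (X 1) \<alpha>"
    obtain a where a: "a > 0" "(\<lambda>t::nat. pmf p (int t)) \<sim>[at_top] (\<lambda>t. a * real t powr (- \<alpha>))" using A'[OF c] by blast
    show "random_sum_asymp M X N" by (rule goal[OF rA'[OF c] asymp_index_lt_2[OF int\<nu> \<alpha> a]])
  next
    assume \<alpha>: "\<alpha> = 2" and c: "cond_A' M (X 1) \<alpha>"
      and "\<exists>\<tau>>0. integrable M (\<lambda>\<omega>. real (N \<omega>) * ln (real (N \<omega>)) powr (2 + \<tau>))"
    then obtain \<tau> where \<tau>: "\<tau> > 0" "integrable (measure_pmf \<nu>) (\<lambda>n. real n * ln (real n) powr (2 + \<tau>))"
      using iN by blast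
    obtain a where a: "a > 0" "(\<lambda>t::nat. pmf p (int t)) \<sim>[at_top] (\<lambda>t. a * real t powr (- 2))" using A'[OF c] \<alpha> by blast
    show "random_sum_asymp M X N" by (rule goal[OF rA'[OF c] asymp_index_2[OF int\<nu> a \<tau>]])
  next
    assume \<alpha>: "2 < \<alpha>" "\<alpha> < 3" and m: "\<mu> \<le> 0" and c: "cond_A' M (X 1) \<alpha>" "cond_B M (X 1)"
    obtain a where a: "a > 0" "(\<lambda>t::nat. pmf p (int t)) \<sim>[at_top] (\<lambda>t. a * real t powr (- \<alpha>))" using A'[OF c(1)] by blast
    show "random_sum_asymp M X N"
      by (rule goal[OF rA'[OF c(1)] asymp_index_between_2_3[OF int\<nu> \<alpha> a B[OF c(2)] \<mu>]]) (use m in simp)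
  next
    assume \<alpha>: "2 < \<alpha>" "\<alpha> < 3" and c: "cond_A' M (X 1) \<alpha>" "cond_B M (X 1)" "cond_D M (X 1) N"
    obtain a where a: "a > 0" "(\<lambda>t::nat. pmf p (int t)) \<sim>[at_top] (\<lambda>t. a * real t powr (- \<alpha>))" using A'[OF c(1)] by blast
    show "random_sum_asymp M X N"
      by (rule goal[OF rA'[OF c(1)] asymp_index_between_2_3[OF int\<nu> \<alpha> a B[OF c(2)] \<mu> D[OF c(3)]]])
  next
    assume \<alpha>: "\<alpha> = 3" and c: "cond_A' M (X 1) \<alpha>" "cond_B M (X 1)"
      and pos: "\<mu> > 0 \<longrightarrow>
         (\<lambda>t::nat. \<P>(\<omega> in M. N \<omega> = t)) \<in> o(\<lambda>t. real t powr (-3) * inverse (ln (ln (real t))))"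
      and zero: "\<mu> = 0 \<longrightarrow>
         (\<exists>\<tau>>0. integrable M (\<lambda>\<omega>. real (N \<omega>) * ln (real (N \<omega>)) powr (1 + \<tau>)))"
    obtain a where a: "a > 0" "(\<lambda>t::nat. pmf p (int t)) \<sim>[at_top] (\<lambda>t. a * real t powr (- 3))" using A'[OF c(1)] \<alpha> by blast
    show "random_sum_asymp M X N"
    proof (rule goal[OF rA'[OF c(1)] asymp_index_3[OF int\<nu> a B[OF c(2)] \<mu>]])
      show "(\<lambda>n. pmf \<nu> n) \<in> o(\<lambda>n. pmf p (int n))" if "\<mu> > 0"
        using pos that smallo_iterated_log[OF a] unfolding pN by blast
      show "\<exists>\<tau>>0. integrable (measure_pmf \<nu>) (\<lambda>n. real n * ln (real n) powr (1 + \<tau>))" if "\<mu> = 0"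
        using zero that iN by blast
    qed
  next
    assume \<alpha>: "\<alpha> > 3" and c: "cond_A M (X 1) \<alpha>" "cond_C M (X 1)"
      and zero: "\<mu> = 0 \<longrightarrow> (\<exists>\<tau>>0. cond_E M (X 1) N \<tau>)" and pos: "\<mu> > 0 \<longrightarrow> cond_D M (X 1) N"
    show "random_sum_asymp M X N"
      by (rule goal[OF rA[OF c(1)] asymp_index_gt_3[OF int\<nu> \<alpha> rA[OF c(1)] C[OF c(2)] \<mu>]])
         (use zero pos D E less_imp_le in blast)+
  next
    assume \<alpha>: "\<alpha> > 3" and "\<mu> = 0" and c: "cond_A' M (X 1) \<alpha>" "cond_C M (X 1)" "cond_E M (X 1) N 0"
    show "random_sum_asymp M X N"
      by (rule goal[OF rA'[OF c(1)] asymp_index_gt_3[OF int\<nu> \<alpha> rA'[OF c(1)] C[OF c(2)] \<mu> _ E[OF c(3)]]])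
         (use \<open>\<mu> = 0\<close> in auto)
  qed
qed

end
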